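(* Let $G$ be a graph, let $k$ be a positive integer, and let $f$ be a positive integer-valued function on $V(G)$ satisfying $f(v) \le \frac{1}{2}d_G(v)< f(v)+k$ for each vertex $v$. Assume that $bi(G)\ge k-1$ and that $(k-1)\sum_{v\in V(G)}f(v)$ is even. If $G$ is $(6k-7)$-edge-connected, then $G$ has a spanning subgraph $H$ such that for each vertex $v$, $$d_H(v)\in \{f(v),f(v)+k\}.$$
   Context: Graphs are finite and may have loops and multiple edges; $d_G(v)$ is the degree of $v$ (a loop counts twice). A graph $G$ is $\lambda$-edge-connected if for every nonempty proper subset $A\subset V(G)$ the number of edges with exactly one end in $A$ is at least $\lambda$. The bipartite index $bi(G)$ is the minimum of $|E(G)\setminus E(H)|$ over all bipartite spanning subgraphs $H$ of $G$. *)

theory Defs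
  imports Complex_Main "HOL-Library.Uprod"
begin

text \<open>
  Multigraphs: every edge has an unordered pair of ends, so that loops (\<^term>\<open>Upair v v\<close>) and
  parallel edges (distinct edges with the same ends) are possible.
\<close>

record ('v, 'e) mgraph =
  verts :: "'v set"
  edges :: "'e set"
  ends :: "'e \<Rightarrow> 'v uprod"

locale multigraph =
  fixes G :: "('v, 'e) mgraph" (structure)
  assumes finite_verts: "finite (verts G)"
    and finite_edges: "finite (edges G)"
    and ends_in_verts: "e \<in> edges G \<Longrightarrow> set_uprod (ends G e) \<subseteq> verts G"

text \<open>A loop at \<open>v\<close> occurs in both summands and is therefore counted twice.\<close>

definition degree :: "('v, 'e) mgraph \<Rightarrow> 'v \<Rightarrow> nat" where
  "degree G v = card {e \<in> edges G. v \<in> set_uprod (ends G e)} + card {e \<in> edges G. ends G e = Upair v v}"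

definition cut_edges :: "('v, 'e) mgraph \<Rightarrow> 'v set \<Rightarrow> 'e set" where
  "cut_edges G A = {e \<in> edges G. \<exists>u v. ends G e = Upair u v \<and> u \<in> A \<and> v \<notin> A}"

text \<open>The parameter is an integer because bounds such as \<open>6 * k - 7\<close> may be negative.\<close>

definition edge_connected :: "int \<Rightarrow> ('v, 'e) mgraph \<Rightarrow> bool" where
  "edge_connected l G \<longleftrightarrow>
     (\<forall>A. A \<noteq> {} \<longrightarrow> A \<subset> verts G \<longrightarrow> l \<le> int (card (cut_edges G A)))"

definition spanning_subgraph :: "('v, 'e) mgraph \<Rightarrow> ('v, 'e) mgraph \<Rightarrow> bool" where
  "spanning_subgraph H G \<longleftrightarrow>
     verts H = verts G \<and> edges H \<subseteq> edges G \<and> (\<forall>e \<in> edges H. ends H e = ends G e)"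

definition bipartite :: "('v, 'e) mgraph \<Rightarrow> bool" where
  "bipartite G \<longleftrightarrow>
     (\<exists>X Y. X \<union> Y = verts G \<and> X \<inter> Y = {} \<and>
       (\<forall>e \<in> edges G. \<exists>x \<in> X. \<exists>y \<in> Y. ends G e = Upair x y))"

text \<open>The minimum exists since the edgeless spanning subgraph is bipartite.\<close>

definition bipartite_index :: "('v, 'e) mgraph \<Rightarrow> nat" where
  "bipartite_index G =
     (LEAST n. \<exists>H. spanning_subgraph H G \<and> bipartite H \<and> n = card (edges G - edges H))"

end

theory Submission
  imports Defs
begin

text \<open>
  Let \<open>X\<close> be a side of a maximum cut. Each vertex set keeps at least half of its cut, so the crossing
  edges form a bipartite graph that is \<open>3 * k - 3\<close>-edge-connected, and at least \<open>k - 1\<close> edges do not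
  cross. Write a spanning subgraph as a choice of signs (\<open>1\<close> for chosen edges, \<open>-1\<close> for the others)
  and negate all degrees outside \<open>X\<close>: a sign at a crossing edge becomes a direction, and a sign at an
  inside edge acts on both ends alike. The signs of \<open>k - 1\<close> inside edges are used to make the
  prescribed net degrees sum to zero modulo \<open>2 * k\<close>; the other inside edges are paired along common
  ends into further arcs, and the unpaired ones get the sign that keeps the degrees in range.

  It remains to find an orientation with prescribed net out-degrees modulo \<open>2 * k\<close>, all of absolute
  value less than \<open>2 * k\<close>. This follows the method of Thomassen and of Lovasz, Thomassen, Wu and Zhang:
  in a minimal counterexample with a partially directed root, sets whose cut is as small as the
  residue permits are contracted, other vertices are split off, and what is left is reduced by directing
  and deleting edges between vertices with residues of opposite signs.
\<close>

subsection \<open>Root-extended orientation problems\<close>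

text \<open>Contraction is what forces a directed root into the induction. Once the graph with
  \<open>A\<close> shrunk to a point is directed, the edges leaving \<open>A\<close> have fixed
  directions, and the inside of \<open>A\<close> is again an instance, whose root is the old root
  merged with everything outside \<open>A\<close>. The cut condition is calibrated for this. Degree
  and residue of a set have the same parity, so a set that satisfies the condition either meets it
  with equality at its least residue or can spare two edges. In the first case it can be the whole
  vertex set of a smaller instance. In the second it survives a split, which takes two edges from a
  cut, and also the deletion of a directed edge, which takes one edge and moves the residue by one.
  At a single vertex without slack a deletion is possible only if degree and absolute residue fall
  together; this is why the signs of residues matter. If all residues have the same sign, no edge
  joins opposite signs; an exchange of root edges at one vertex flips its sign and breaks the
  deadlock. The strict bound \<open>2 * k\<close> on the nets leaves room for the one unpaired
  inside edge that a vertex may have.\<close>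

definition weights :: "('v \<Rightarrow> 'v \<Rightarrow> int) \<Rightarrow> bool" where
  "weights mu \<longleftrightarrow> (\<forall>u v. mu u v = mu v u \<and> 0 \<le> mu u v \<and> mu u u = 0)"

text \<open>
  An orientation of the \<open>mu u v\<close> parallel edges between \<open>u\<close> and \<open>v\<close> is recorded by the number \<open>\<phi> u v\<close> of
  those directed from \<open>u\<close> to \<open>v\<close> minus the number of those directed from \<open>v\<close> to \<open>u\<close>.
\<close>

definition flow :: "'v set \<Rightarrow> ('v \<Rightarrow> 'v \<Rightarrow> int) \<Rightarrow> ('v \<Rightarrow> 'v \<Rightarrow> int) \<Rightarrow> bool" where
  "flow V mu \<phi> \<longleftrightarrow>
     (\<forall>u\<in>V. \<forall>v\<in>V. \<phi> u v = - \<phi> v u \<and> \<bar>\<phi> u v\<bar> \<le> mu u v \<and> even (\<phi> u v - mu u v))"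

definition cut_weight :: "'v set \<Rightarrow> ('v \<Rightarrow> 'v \<Rightarrow> int) \<Rightarrow> 'v set \<Rightarrow> int" where
  "cut_weight V mu A = (\<Sum>u\<in>A. \<Sum>v\<in>V - A. mu u v)"

definition set_degree :: "'v set \<Rightarrow> ('v \<Rightarrow> 'v \<Rightarrow> int) \<Rightarrow> ('v \<Rightarrow> int) \<Rightarrow> 'v set \<Rightarrow> int" where
  "set_degree V mu W A = cut_weight V mu A + sum W A"

text \<open>
  With \<open>r = 2\<close> this bounds the cut from below by \<open>2 * k - 2\<close> plus the least absolute value in the
  residue class of the net out-degree of \<open>A\<close>; with \<open>r = 0\<close> the bound has enough slack to lose two edges.
\<close>

definition roomy :: "int \<Rightarrow> int \<Rightarrow> 'v set \<Rightarrow> ('v \<Rightarrow> 'v \<Rightarrow> int) \<Rightarrow> ('v \<Rightarrow> int) \<Rightarrow> ('v \<Rightarrow> int) \<Rightarrow> 'v set \<Rightarrow> bool" where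
  "roomy k r V mu W b A \<longleftrightarrow> (\<exists>q. \<bar>sum b A + 2 * k * q\<bar> + 2 * k - r \<le> set_degree V mu W A)"

definition has_orientation :: "int \<Rightarrow> 'v set \<Rightarrow> ('v \<Rightarrow> 'v \<Rightarrow> int) \<Rightarrow> ('v \<Rightarrow> int) \<Rightarrow> ('v \<Rightarrow> int) \<Rightarrow> bool" where
  "has_orientation k V mu b z \<longleftrightarrow> (\<exists>\<phi>. flow V mu \<phi> \<and>
     (\<forall>v\<in>V. 2 * k dvd (\<Sum>u\<in>V. \<phi> v u) + z v - b v \<and> \<bar>(\<Sum>u\<in>V. \<phi> v u) + z v\<bar> < 2 * k))"

text \<open>
  The instances of the induction have a root whose edges are already directed and which is not a member
  of \<open>V\<close>: \<open>W v\<close> counts the root edges at \<open>v\<close> and \<open>z v\<close> is their net out-degree. The prescribed net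
  out-degree is \<open>b v\<close> modulo \<open>2 * k\<close>. The set \<open>X\<close> has at most one member, a vertex that is being split off completely
  and is therefore exempt from the cut condition.
\<close>

locale orient =
  fixes k :: int and V :: "'v set" and mu :: "'v \<Rightarrow> 'v \<Rightarrow> int" and b W z :: "'v \<Rightarrow> int" and X :: "'v set"
  assumes fin: "finite V" and mu: "weights mu"
    and zW: "v \<in> V \<Longrightarrow> \<bar>z v\<bar> \<le> W v" and zW_even: "v \<in> V \<Longrightarrow> even (W v - z v)"
    and par: "v \<in> V \<Longrightarrow> even (b v - set_degree V mu W {v})"
    and total: "2 * k dvd sum b V - sum z V"
    and tightV: "\<not> roomy k 0 V mu W b V"
    and cond: "A \<noteq> {} \<Longrightarrow> A \<subset> V \<Longrightarrow> (\<And>x. x \<in> X \<Longrightarrow> A \<noteq> {x}) \<Longrightarrow> roomy k 2 V mu W b A"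
    and XV: "X \<subseteq> V" and X1: "x \<in> X \<Longrightarrow> X = {x}"
    and Xb: "x \<in> X \<Longrightarrow> 2 * k dvd b x" and XW: "x \<in> X \<Longrightarrow> 2 * W x \<le> set_degree V mu W {x}"

lemma weightsD:
  assumes "weights mu"
  shows "mu u v = mu v u" "0 \<le> mu u v" "mu u u = 0"
  using assms unfolding weights_def by blast+

text \<open>The accounting rule behind every change of instance: moving the residue by
  \<open>e\<close> and lowering the set degree are paid from the same slack. Passing from
  \<open>r = 0\<close> to \<open>r = 2\<close> pays for two units in all.\<close>

lemma roomy_transfer:
  assumes "roomy k r V mu W b A" "2 * k dvd sum b' A' - sum b A - e"
    and "\<bar>e\<bar> + (set_degree V mu W A - set_degree V' mu' W' A') \<le> r' - r"
  shows "roomy k r' V' mu' W' b' A'"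
proof -
  obtain q where q: "\<bar>sum b A + 2 * k * q\<bar> + 2 * k - r \<le> set_degree V mu W A"
    using assms(1) unfolding roomy_def by blast
  obtain c where c: "sum b' A' - sum b A - e = 2 * k * c" using assms(2) by blast
  have "sum b' A' + 2 * k * (q - c) = sum b A + 2 * k * q + e" using c by (simp add: algebra_simps)
  then have "\<bar>sum b' A' + 2 * k * (q - c)\<bar> + 2 * k - r' \<le> set_degree V' mu' W' A'" using q assms(3) by linarith
  then show ?thesis unfolding roomy_def by blast
qed

lemma roomy_shift:
  assumes "roomy k r V mu W b A"
    and "\<bar>sum b' A' - sum b A\<bar> + (set_degree V mu W A - set_degree V' mu' W' A') \<le> r' - r"
  shows "roomy k r' V' mu' W' b' A'"
  by (rule roomy_transfer[OF assms(1) _ assms(2)]) simp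

lemma roomy_mod:
  assumes "roomy k r V mu W b A" "2 * k dvd sum b' A' - sum b A" "set_degree V mu W A - set_degree V' mu' W' A' \<le> r' - r"
  shows "roomy k r' V' mu' W' b' A'"
  by (rule roomy_transfer[OF assms(1), where e = 0]) (use assms(2,3) in simp_all)

text \<open>Absolute values are subadditive, while \<open>2 * k\<close> is supplied twice and
  demanded once. From \<open>r = s = 2\<close> to \<open>r' = 0\<close> the surplus is
  \<open>2 * k - 4\<close>, nonnegative for \<open>k \<ge> 2\<close>; hence \<open>V\<close>, which
  is not roomy for \<open>r = 0\<close>, cannot split into two parts with no edge between
  them.\<close>

lemma roomy_add:
  assumes "roomy k r V mu W b A" "roomy k s V mu W b B" "2 * k dvd sum b C - (sum b A + sum b B)"
    "set_degree V mu W A + set_degree V mu W B - set_degree V' mu' W' C \<le> 2 * k - r - s + r'"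
  shows "roomy k r' V' mu' W' b C"
proof -
  obtain q where q: "\<bar>sum b A + 2 * k * q\<bar> + 2 * k - r \<le> set_degree V mu W A"
    using assms(1) unfolding roomy_def by blast
  obtain p where p: "\<bar>sum b B + 2 * k * p\<bar> + 2 * k - s \<le> set_degree V mu W B"
    using assms(2) unfolding roomy_def by blast
  obtain c where c: "sum b C - (sum b A + sum b B) = 2 * k * c" using assms(3) by blast
  have "sum b C + 2 * k * (q + p - c) = (sum b A + 2 * k * q) + (sum b B + 2 * k * p)"
    using c by (simp add: algebra_simps)
  then have "\<bar>sum b C + 2 * k * (q + p - c)\<bar> + 2 * k - r' \<le> set_degree V' mu' W' C" using q p assms(4) by linarith
  then show ?thesis unfolding roomy_def by blast
qed

text \<open>A representative of absolute value at most \<open>k\<close> is a least one of its class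
  modulo \<open>2 * k\<close>, so it can replace the unknown witness in
  \<open>roomy\<close>.\<close>

lemma abs_le_shift:
  fixes k s :: int
  assumes "\<bar>s\<bar> \<le> k"
  shows "\<bar>s\<bar> \<le> \<bar>s + 2 * k * p\<bar>"
proof -
  have "k \<ge> 0" using assms by linarith
  consider "p = 0" | "p \<ge> 1" | "p \<le> -1" by linarith
  then show ?thesis
  proof cases
    case 2
    then have "2 * k * p \<ge> 2 * k * 1" using \<open>k \<ge> 0\<close> by (intro mult_left_mono) auto
    then show ?thesis using assms by linarith
  next
    case 3
    then have "2 * k * p \<le> 2 * k * (-1)" using \<open>k \<ge> 0\<close> by (intro mult_left_mono) auto
    then show ?thesis using assms by linarith
  qed simp
qed

lemma residue_exists:
  fixes k s :: int
  assumes "k > 0"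
  shows "\<exists>q. \<bar>s + 2 * k * q\<bar> \<le> k"
proof -
  define t where "t = (s + k) mod (2 * k) - k"
  have "0 \<le> (s + k) mod (2 * k)" "(s + k) mod (2 * k) < 2 * k" using assms by simp_all
  then have t: "\<bar>t\<bar> \<le> k" unfolding t_def by linarith
  have "s + 2 * k * (- ((s + k) div (2 * k))) = t"
    unfolding t_def using div_mult_mod_eq[of "s + k" "2 * k"] by (simp add: algebra_simps)
  with t show ?thesis by metis
qed

section \<open>Parity and counting identities for cuts and set degrees\<close>

lemma even_sum_sym:
  assumes "weights mu" "finite A"
  shows "even (\<Sum>u\<in>A. \<Sum>v\<in>A. mu u v)"
  using assms(2)
proof (induction A)
  case (insert x A)
  have "(\<Sum>u\<in>insert x A. \<Sum>v\<in>insert x A. mu u v) =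
      mu x x + (\<Sum>v\<in>A. mu x v) + (\<Sum>u\<in>A. mu u x) + (\<Sum>u\<in>A. \<Sum>v\<in>A. mu u v)"
    using insert by (simp add: sum.distrib)
  moreover have "(\<Sum>u\<in>A. mu u x) = (\<Sum>v\<in>A. mu x v)" using weightsD(1)[OF assms(1)] by metis
  ultimately show ?case using insert weightsD(3)[OF assms(1)] by simp
qed simp

lemma cut_singleton:
  assumes "weights mu" "finite V" "v \<in> V"
  shows "cut_weight V mu {v} = (\<Sum>u\<in>V. mu v u)"
  unfolding cut_weight_def using assms by (simp add: sum.remove weightsD(3))

lemma cut_nonneg: "weights mu \<Longrightarrow> 0 \<le> cut_weight V mu A"
  unfolding cut_weight_def by (intro sum_nonneg) (auto simp: weightsD)

lemma sum_set_degree_singletons: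
  assumes "weights mu" "finite V" "A \<subseteq> V"
  shows "(\<Sum>v\<in>A. set_degree V mu W {v}) = set_degree V mu W A + (\<Sum>u\<in>A. \<Sum>v\<in>A. mu u v)"
proof -
  have "(\<Sum>v\<in>A. cut_weight V mu {v}) = (\<Sum>v\<in>A. (\<Sum>u\<in>V - A. mu v u) + (\<Sum>u\<in>A. mu v u))"
    using assms by (intro sum.cong refl) (simp add: cut_singleton subsetD sum.subset_diff[of A V])
  then show ?thesis unfolding set_degree_def by (simp add: sum.distrib cut_weight_def)
qed

text \<open>Edges inside \<open>A\<close> are counted from both ends, hence an even number of times,
  so the parity condition at single vertices extends to all sets.\<close>

lemma sum_set_degree_parity:
  assumes "weights mu" "finite V" "A \<subseteq> V" "\<And>v. v \<in> V \<Longrightarrow> even (b v - set_degree V mu W {v})"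
  shows "even (sum b A - set_degree V mu W A)"
proof -
  have "finite A" using assms finite_subset by blast
  have "even (\<Sum>v\<in>A. b v - set_degree V mu W {v})" using assms(3,4) by (intro dvd_sum) auto
  moreover have "(\<Sum>v\<in>A. b v - set_degree V mu W {v}) = sum b A - set_degree V mu W A - (\<Sum>u\<in>A. \<Sum>v\<in>A. mu u v)"
    using sum_set_degree_singletons[OF assms(1-3)] by (simp add: sum_subtractf)
  ultimately show ?thesis using even_sum_sym[OF assms(1) \<open>finite A\<close>] by simp
qed

lemma cut_compl:
  assumes "weights mu" "A \<subseteq> V"
  shows "cut_weight V mu (V - A) = cut_weight V mu A"
proof -
  have "V - (V - A) = A" using assms(2) by blast
  then show ?thesis unfolding cut_weight_def
    by (subst sum.swap) (simp add: weightsD(1)[OF assms(1)])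
qed

lemma cut_full[simp]: "cut_weight V mu V = 0"
  unfolding cut_weight_def by simp

context orient
begin

lemmas sym = weightsD(1)[OF mu] and nonneg = weightsD(2)[OF mu] and diag = weightsD(3)[OF mu]

lemma W_nonneg: "v \<in> V \<Longrightarrow> 0 \<le> W v"
  using zW[of v] by linarith

lemma parity: "A \<subseteq> V \<Longrightarrow> even (sum b A - set_degree V mu W A)"
  by (rule sum_set_degree_parity[OF mu fin _ par])

text \<open>Failing \<open>roomy\<close> with \<open>r = 0\<close> means lying strictly below a
  bound of the same parity, so the gap is at least two. Together with \<open>roomy\<close> for
  \<open>r = 2\<close> this determines the degree exactly.\<close>

lemma tight_le:
  assumes "A \<subseteq> V" "\<not> roomy k 0 V mu W b A"
  shows "set_degree V mu W A \<le> \<bar>sum b A + 2 * k * q\<bar> + 2 * k - 2"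
proof -
  have "set_degree V mu W A < \<bar>sum b A + 2 * k * q\<bar> + 2 * k"
    using assms(2) unfolding roomy_def by (metis diff_zero linorder_not_le)
  moreover have "even (\<bar>sum b A + 2 * k * q\<bar> + 2 * k - set_degree V mu W A)" using parity[OF assms(1)] by auto
  ultimately show ?thesis by presburger
qed

lemma dgV: "set_degree V mu W V = sum W V"
  unfolding set_degree_def by simp

lemma set_degree_compl: "A \<subseteq> V \<Longrightarrow> set_degree V mu W (V - A) = cut_weight V mu A + (sum W V - sum W A)"
  unfolding set_degree_def using cut_compl[OF mu, of A V] sum_diff[OF fin, of A W] by simp

text \<open>If the root edges had a net of absolute value at least \<open>2 * k\<close>, moving it
  by \<open>2 * k\<close> towards zero would lower that value by exactly \<open>2 * k\<close>, and
  the result would witness that \<open>V\<close> is roomy. This is the bound required when only one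
  vertex is left.\<close>

lemma total_bound: "\<bar>sum z V\<bar> < 2 * k"
proof (rule ccontr)
  assume *: "\<not> ?thesis"
  obtain c where c: "sum b V - sum z V = 2 * k * c" using total by blast
  have "\<bar>sum z V\<bar> \<le> (\<Sum>v\<in>V. \<bar>z v\<bar>)" by (rule sum_abs)
  also have "\<dots> \<le> sum W V" by (intro sum_mono zW)
  finally have zV: "\<bar>sum z V\<bar> \<le> sum W V" .
  define \<sigma> :: int where "\<sigma> = (if sum z V \<ge> 0 then -1 else 1)"
  have e: "sum b V + 2 * k * (\<sigma> - c) = sum z V + 2 * k * \<sigma>" using c by (simp add: algebra_simps)
  have "\<bar>sum z V + 2 * k * \<sigma>\<bar> + 2 * k \<le> set_degree V mu W V"
    using * zV dgV unfolding \<sigma>_def by auto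
  then have "roomy k 0 V mu W b V" unfolding roomy_def using e by (metis diff_zero)
  then show False using tightV by blast
qed

lemma has_orientation_card_le_1:
  assumes "card V \<le> 1"
  shows "has_orientation k V mu b z"
proof -
  consider "V = {}" | v where "V = {v}" using assms fin card_le_Suc0_iff_eq[OF fin] by auto
  then show ?thesis
  proof cases
    case 1 then show ?thesis unfolding has_orientation_def flow_def by auto
  next
    case 2
    then have "\<bar>z v\<bar> < 2 * k" "2 * k dvd b v - z v" using total_bound total by auto
    then show ?thesis unfolding has_orientation_def flow_def using 2 diag
      by (intro exI[of _ "\<lambda>_ _. 0"]) (auto simp: dvd_diff_commute)
  qed
qed

end

subsection \<open>Splitting off\<close>

text \<open>Vanishing for \<open>x = y\<close> discards loops: splitting off two parallel edges
  between \<open>x\<close> and \<open>y\<close> then just removes both.\<close>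

definition unit_edge :: "'v \<Rightarrow> 'v \<Rightarrow> 'v \<Rightarrow> 'v \<Rightarrow> int" where
  "unit_edge x y u v = (if x \<noteq> y \<and> (u = x \<and> v = y \<or> u = y \<and> v = x) then 1 else 0)"

definition unit_arc :: "'v \<Rightarrow> 'v \<Rightarrow> 'v \<Rightarrow> 'v \<Rightarrow> int" where
  "unit_arc x y u v = (if x \<noteq> y \<and> u = x \<and> v = y then 1 else if x \<noteq> y \<and> u = y \<and> v = x then -1 else 0)"

abbreviation at_vertex :: "'v \<Rightarrow> 'v \<Rightarrow> int" where
  "at_vertex x v \<equiv> of_bool (v = x)"

lemma sum_at_vertex: "finite A \<Longrightarrow> (\<Sum>v\<in>A. at_vertex x v) = of_bool (x \<in> A)"
  by (simp add: of_bool_def)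

lemma sum_scaled_at_vertex: "finite A \<Longrightarrow> (\<Sum>v\<in>A. c * at_vertex x v) = c * of_bool (x \<in> A)"
  by (simp add: sum_at_vertex flip: sum_distrib_left)

lemma weights_unit_edge: "weights (unit_edge x y)"
  unfolding weights_def unit_edge_def by auto

lemma sum_unit_edge: "finite V \<Longrightarrow> (\<Sum>u\<in>V. unit_edge x y v u) =
    (if x \<noteq> y then (if v = x then of_bool (y \<in> V) else if v = y then of_bool (x \<in> V) else 0) else 0)"
  unfolding unit_edge_def by (auto simp: of_bool_def)

lemma cut_unit_edge:
  assumes "finite V" "A \<subseteq> V" "x \<in> V" "y \<in> V"
  shows "cut_weight V (unit_edge x y) A = of_bool ((x \<in> A) \<noteq> (y \<in> A))"
proof (cases "x = y")
  case True
  then show ?thesis by (simp add: cut_weight_def unit_edge_def)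
next
  case False
  have "finite A" using assms finite_subset by blast
  have "cut_weight V (unit_edge x y) A = (\<Sum>u\<in>A. of_bool (y \<in> V - A) * at_vertex x u + of_bool (x \<in> V - A) * at_vertex y u)"
    unfolding cut_weight_def using assms(1) False by (intro sum.cong refl) (auto simp: sum_unit_edge)
  also have "\<dots> = of_bool (y \<in> V - A) * of_bool (x \<in> A) + of_bool (x \<in> V - A) * of_bool (y \<in> A)"
    using \<open>finite A\<close> by (simp only: sum.distrib sum_scaled_at_vertex)
  also have "\<dots> = of_bool ((x \<in> A) \<noteq> (y \<in> A))"
    using assms by auto
  finally show ?thesis .
qed

lemma sum_unit_arc:
  assumes "finite V" "x \<in> V" "y \<in> V"
  shows "(\<Sum>u\<in>V. unit_arc x y v u) = at_vertex x v - at_vertex y v"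
proof (cases "x = y")
  case False
  have "(\<Sum>u\<in>V. unit_arc x y v u) = (\<Sum>u\<in>V. at_vertex x v * at_vertex y u - at_vertex y v * at_vertex x u)"
    using False by (intro sum.cong refl) (auto simp: unit_arc_def)
  also have "\<dots> = at_vertex x v - at_vertex y v"
    using assms by (simp only: sum_subtractf sum_scaled_at_vertex) simp
  finally show ?thesis .
qed (simp add: unit_arc_def)

lemma cut_add: "cut_weight V (\<lambda>u v. f u v + g u v) A = cut_weight V f A + cut_weight V g A"
  unfolding cut_weight_def by (simp add: sum.distrib)

lemma cut_diff: "cut_weight V (\<lambda>u v. f u v - g u v) A = cut_weight V f A - cut_weight V g A"
  unfolding cut_weight_def by (simp add: sum_subtractf)

section \<open>Total weight of the non-root edges, which every split or edge deletion lowers\<close>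

definition mass :: "'v set \<Rightarrow> ('v \<Rightarrow> 'v \<Rightarrow> int) \<Rightarrow> int" where
  "mass V mu = (\<Sum>u\<in>V. \<Sum>v\<in>V. mu u v)"

lemma mass_nonneg: "weights mu \<Longrightarrow> 0 \<le> mass V mu"
  unfolding mass_def by (intro sum_nonneg) (auto simp: weightsD)

lemma mass_add: "mass V (\<lambda>u v. f u v + g u v) = mass V f + mass V g"
  unfolding mass_def by (simp add: sum.distrib)

lemma mass_diff: "mass V (\<lambda>u v. f u v - g u v) = mass V f - mass V g"
  unfolding mass_def by (simp add: sum_subtractf)

lemma mass_unit_edge:
  assumes "finite V" "x \<in> V" "y \<in> V"
  shows "mass V (unit_edge x y) = (if x = y then 0 else 2)"
proof -
  have "mass V (unit_edge x y) = (\<Sum>u\<in>V. if x \<noteq> y then at_vertex x u + at_vertex y u else 0)"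
    unfolding mass_def using assms by (intro sum.cong refl) (auto simp: sum_unit_edge)
  also have "\<dots> = (if x = y then 0 else 2)"
    using assms by (auto simp: sum.distrib of_bool_def)
  finally show ?thesis .
qed

lemma flow_add:
  assumes "flow V mu \<phi>" "flow V nu \<psi>"
  shows "flow V (\<lambda>u v. mu u v + nu u v) (\<lambda>u v. \<phi> u v + \<psi> u v)"
  unfolding flow_def
proof (intro ballI conjI)
  fix u v assume uv: "u \<in> V" "v \<in> V"
  have 1: "\<phi> u v = - \<phi> v u" "\<bar>\<phi> u v\<bar> \<le> mu u v" "even (\<phi> u v - mu u v)"
    using assms(1) uv unfolding flow_def by blast+
  have 2: "\<psi> u v = - \<psi> v u" "\<bar>\<psi> u v\<bar> \<le> nu u v" "even (\<psi> u v - nu u v)"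
    using assms(2) uv unfolding flow_def by blast+
  show "\<phi> u v + \<psi> u v = - (\<phi> v u + \<psi> v u)" using 1 2 by linarith
  show "\<bar>\<phi> u v + \<psi> u v\<bar> \<le> mu u v + nu u v" using 1 2 by linarith
  show "even (\<phi> u v + \<psi> u v - (mu u v + nu u v))" using 1(3) 2(3) by presburger
qed

lemma flow_unit_edge:
  assumes "\<delta> = 1 \<or> \<delta> = -1"
  shows "flow V (unit_edge x y) (\<lambda>u v. \<delta> * unit_arc x y u v)"
  using assms unfolding flow_def unit_edge_def unit_arc_def by auto

lemma flow_split_unit_edge:
  assumes "weights mu" "y \<in> V" "w \<in> V" "flow V (\<lambda>u v. mu u v + unit_edge y w u v) \<phi>"
  obtains \<delta> :: int where "\<delta> = 1 \<or> \<delta> = -1" "flow V mu (\<lambda>u v. \<phi> u v - \<delta> * unit_arc y w u v)"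
proof (cases "y = w")
  case True
  then have "unit_edge y w = (\<lambda>_ _. 0)" "unit_arc y w = (\<lambda>_ _. 0)" unfolding unit_edge_def unit_arc_def by auto
  then show ?thesis using assms(4) that[of 1] by simp
next
  case False
  \<comment> \<open>A direction that occurs among the parallel edges: that of the majority, and
    either one if the net is zero, because parity then forces a further edge between
    \<open>y\<close> and \<open>w\<close>.\<close>
  define \<delta> :: int where "\<delta> = (if \<phi> y w \<ge> 0 then 1 else -1)"
  have \<phi>: "\<phi> u v = - \<phi> v u" "\<bar>\<phi> u v\<bar> \<le> mu u v + unit_edge y w u v" "even (\<phi> u v - (mu u v + unit_edge y w u v))"
    if "u \<in> V" "v \<in> V" for u v
    using assms(4) that unfolding flow_def by blast+
  have yw: "\<phi> w y = - \<phi> y w" "mu w y = mu y w" "0 \<le> mu y w"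
      "\<bar>\<phi> y w\<bar> \<le> mu y w + 1" "even (\<phi> y w - (mu y w + 1))"
    using \<phi>(1)[of w y] \<phi>(2,3)[of y w] assms(2,3) False weightsD(1)[OF assms(1), of w y]
        weightsD(2)[OF assms(1), of y w] by (simp_all add: unit_edge_def)
  have "\<phi> y w = 0 \<Longrightarrow> 1 \<le> mu y w" using yw(3,5) by (cases "mu y w = 0") auto
  then have b: "\<bar>\<phi> y w - \<delta>\<bar> \<le> mu y w"
    using yw(4) by (cases "\<phi> y w" "0 :: int" rule: linorder_cases) (simp_all add: \<delta>_def)
  have "flow V mu (\<lambda>u v. \<phi> u v - \<delta> * unit_arc y w u v)"
    unfolding flow_def
  proof (intro ballI)
    fix u v assume uv: "u \<in> V" "v \<in> V"
    have "unit_edge y w u v = 0" "unit_arc y w u v = 0" "unit_arc y w v u = 0"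
      if "\<not> (u = y \<and> v = w)" "\<not> (u = w \<and> v = y)"
      using that by (auto simp: unit_edge_def unit_arc_def)
    then consider "u = y" "v = w" | "u = w" "v = y" | "unit_edge y w u v = 0" "unit_arc y w u v = 0" "unit_arc y w v u = 0"
      by blast
    then show "\<phi> u v - \<delta> * unit_arc y w u v = - (\<phi> v u - \<delta> * unit_arc y w v u) \<and>
        \<bar>\<phi> u v - \<delta> * unit_arc y w u v\<bar> \<le> mu u v \<and> even (\<phi> u v - \<delta> * unit_arc y w u v - mu u v)"
    proof cases
      case 1
      then have "unit_arc y w u v = 1" "unit_arc y w v u = -1" using False unfolding unit_arc_def by auto
      moreover have "even (\<phi> y w - \<delta> - mu y w)" using yw(5) by (simp add: \<delta>_def)
      ultimately show ?thesis using 1 b yw(1) by simp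
    next
      case 2
      then have "unit_arc y w u v = -1" "unit_arc y w v u = 1" using False unfolding unit_arc_def by auto
      moreover have "even (\<phi> w y + \<delta> - mu w y)" using yw(1,2,5) by (simp add: \<delta>_def)
      moreover have "\<bar>\<phi> w y + \<delta>\<bar> \<le> mu w y" using yw(1,2) b by linarith
      ultimately show ?thesis using 2 yw(1) by simp
    next
      case 3
      then have "\<phi> u v - \<delta> * unit_arc y w u v = \<phi> u v" "\<phi> v u - \<delta> * unit_arc y w v u = \<phi> v u"
        "\<bar>\<phi> u v\<bar> \<le> mu u v" "even (\<phi> u v - mu u v)"
        using \<phi>(2,3)[OF uv] by auto
      then show ?thesis using \<phi>(1)[OF uv] by metis
    qed
  qed
  then show ?thesis using that[of \<delta>] \<delta>_def by presburger
qed

definition lift :: "('v \<Rightarrow> 'v \<Rightarrow> int) \<Rightarrow> 'v \<Rightarrow> 'v \<Rightarrow> 'v \<Rightarrow> 'v \<Rightarrow> 'v \<Rightarrow> int" where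
  "lift mu x y w u v = mu u v - unit_edge x y u v - unit_edge x w u v + unit_edge y w u v"

lemma has_orientation_lift:
  assumes "finite V" "x \<in> V" "y \<in> V" "w \<in> V" "x \<noteq> y" "x \<noteq> w"
    and "weights (\<lambda>u v. mu u v - unit_edge x y u v - unit_edge x w u v)"
    and "has_orientation k V (lift mu x y w) b z"
  shows "has_orientation k V mu b z"
proof -
  obtain \<phi> where \<phi>: "flow V (lift mu x y w) \<phi>"
    "\<forall>v\<in>V. 2 * k dvd (\<Sum>u\<in>V. \<phi> v u) + z v - b v \<and> \<bar>(\<Sum>u\<in>V. \<phi> v u) + z v\<bar> < 2 * k"
    using assms(8) unfolding has_orientation_def by blast
  from \<phi>(1) have "flow V (\<lambda>u v. (mu u v - unit_edge x y u v - unit_edge x w u v) + unit_edge y w u v) \<phi>"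
    unfolding lift_def[abs_def] .
  from flow_split_unit_edge[OF assms(7,3,4) this] obtain \<delta> :: int where \<delta>: "\<delta> = 1 \<or> \<delta> = -1"
    "flow V (\<lambda>u v. mu u v - unit_edge x y u v - unit_edge x w u v) (\<lambda>u v. \<phi> u v - \<delta> * unit_arc y w u v)" by blast
  \<comment> \<open>The direction of the new edge is handed to the path through \<open>x\<close>:
    for \<open>\<delta> = 1\<close> the edges run from \<open>y\<close> to \<open>x\<close> and from
    \<open>x\<close> to \<open>w\<close>, so no net changes.\<close>
  define \<psi> where "\<psi> u v = \<phi> u v - \<delta> * unit_arc y w u v + (- \<delta>) * unit_arc x y u v + \<delta> * unit_arc x w u v" for u v
  have "- \<delta> = 1 \<or> - \<delta> = -1" using \<delta>(1) by linarith
  from flow_add[OF flow_add[OF \<delta>(2) flow_unit_edge[OF this, of V x y]] flow_unit_edge[OF \<delta>(1), of V x w]]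
  have f: "flow V mu \<psi>" by (simp add: \<psi>_def[abs_def])
  have s: "(\<Sum>u\<in>V. \<psi> v u) = (\<Sum>u\<in>V. \<phi> v u)" for v
  proof -
    have "(\<Sum>u\<in>V. \<psi> v u)
       = (\<Sum>u\<in>V. \<phi> v u) - \<delta> * (\<Sum>u\<in>V. unit_arc y w v u) + (- \<delta>) * (\<Sum>u\<in>V. unit_arc x y v u) + \<delta> * (\<Sum>u\<in>V. unit_arc x w v u)"
      unfolding sum.distrib sum_subtractf sum_distrib_left \<psi>_def ..
    then show ?thesis using assms by (simp add: sum_unit_arc algebra_simps)
  qed
  show ?thesis unfolding has_orientation_def
  proof (intro exI conjI ballI)
    fix v assume "v \<in> V"
    with \<phi>(2) show "2 * k dvd (\<Sum>u\<in>V. \<psi> v u) + z v - b v" "\<bar>(\<Sum>u\<in>V. \<psi> v u) + z v\<bar> < 2 * k"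
      unfolding s by blast+
  qed (fact f)
qed

lemma set_degree_lift:
  assumes "finite V" "A \<subseteq> V" "x \<in> V" "y \<in> V" "w \<in> V" "x \<noteq> y" "x \<noteq> w"
  shows "set_degree V (lift mu x y w) W A =
    set_degree V mu W A - 2 * of_bool (x \<in> A \<and> y \<notin> A \<and> w \<notin> A \<or> x \<notin> A \<and> y \<in> A \<and> w \<in> A)"
  using assms unfolding set_degree_def lift_def[abs_def] by (auto simp: cut_add cut_diff cut_unit_edge)

lemma weights_lift:
  assumes "weights mu" "1 \<le> mu x y" "1 \<le> mu x w" "y = w \<Longrightarrow> 2 \<le> mu x y"
  shows "weights (\<lambda>u v. mu u v - unit_edge x y u v - unit_edge x w u v)" "weights (lift mu x y w)"
proof -
  show 1: "weights (\<lambda>u v. mu u v - unit_edge x y u v - unit_edge x w u v)"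
    unfolding weights_def
  proof (intro allI)
    fix u v
    have "unit_edge x y u v + unit_edge x w u v \<le> mu u v"
    proof -
      have "u = x \<and> v = y \<or> u = y \<and> v = x \<or> u = x \<and> v = w \<or> u = w \<and> v = x
        \<or> unit_edge x y u v = 0 \<and> unit_edge x w u v = 0"
        unfolding unit_edge_def by metis
      moreover have "x \<noteq> y" "x \<noteq> w" using assms(2,3) weightsD(3)[OF assms(1)] by force+
      moreover have "unit_edge x y x w = of_bool (y = w)" "unit_edge x w x y = of_bool (y = w)"
        "unit_edge x y w x = of_bool (y = w)" "unit_edge x w y x = of_bool (y = w)"
        "unit_edge x y x y = 1" "unit_edge x y y x = 1" "unit_edge x w x w = 1" "unit_edge x w w x = 1"
        using calculation(2,3) by (auto simp: unit_edge_def)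
      ultimately show ?thesis
        using assms(2-4) weightsD(1)[OF assms(1), of x y] weightsD(1)[OF assms(1), of x w]
          weightsD(2)[OF assms(1), of u v]
        by (elim disjE conjE) (cases "y = w"; simp)+
    qed
    then show "mu u v - unit_edge x y u v - unit_edge x w u v = mu v u - unit_edge x y v u - unit_edge x w v u \<and>
        0 \<le> mu u v - unit_edge x y u v - unit_edge x w u v \<and> mu u u - unit_edge x y u u - unit_edge x w u u = 0"
      using weightsD(1,2)[OF assms(1), of u v] weightsD(3)[OF assms(1), of u] weightsD(1,2)[OF weights_unit_edge[of x y], of u v] weightsD(3)[OF weights_unit_edge[of x y], of u]
        weightsD(1,2)[OF weights_unit_edge[of x w], of u v] weightsD(3)[OF weights_unit_edge[of x w], of u] by linarith
  qed
  show "weights (lift mu x y w)"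
    unfolding weights_def lift_def
  proof (intro allI)
    fix u v
    show "mu u v - unit_edge x y u v - unit_edge x w u v + unit_edge y w u v = mu v u - unit_edge x y v u - unit_edge x w v u + unit_edge y w v u \<and>
        0 \<le> mu u v - unit_edge x y u v - unit_edge x w u v + unit_edge y w u v \<and>
        mu u u - unit_edge x y u u - unit_edge x w u u + unit_edge y w u u = 0"
      using weightsD(1,2)[OF 1, of u v] weightsD(3)[OF 1, of u] weightsD(1,2)[OF weights_unit_edge[of y w], of u v] weightsD(3)[OF weights_unit_edge[of y w], of u] by linarith
  qed
qed

lemma mass_lift:
  assumes "finite V" "x \<in> V" "y \<in> V" "w \<in> V" "x \<noteq> y" "x \<noteq> w"
  shows "mass V (lift mu x y w) < mass V mu"
  using assms unfolding lift_def[abs_def] by (simp add: mass_add mass_diff mass_unit_edge)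

text \<open>A split costs two units exactly at the sets that separate \<open>x\<close> from both
  \<open>y\<close> and \<open>w\<close>, and \<open>room\<close> supplies the slack there. An exempt
  vertex can only be \<open>x\<close> itself without root edges, for which the bound on
  \<open>2 * W x\<close> is trivial.\<close>

lemma (in orient) orient_lift:
  assumes "x \<in> V" "y \<in> V" "w \<in> V" "x \<noteq> y" "x \<noteq> w"
    and "1 \<le> mu x y" "1 \<le> mu x w" "y = w \<Longrightarrow> 2 \<le> mu x y"
    and X: "\<And>v. v \<in> X \<Longrightarrow> v = x \<and> W x = 0"
    and room: "\<And>A. A \<noteq> {} \<Longrightarrow> A \<subset> V \<Longrightarrow> (\<And>v. v \<in> X \<Longrightarrow> A \<noteq> {v}) \<Longrightarrow>
      x \<in> A \<and> y \<notin> A \<and> w \<notin> A \<or> x \<notin> A \<and> y \<in> A \<and> w \<in> A \<Longrightarrow> roomy k 0 V mu W b A"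
  shows "orient k V (lift mu x y w) b W z X"
proof
  note dgl = set_degree_lift[OF fin _ assms(1-5)]
  show "even (b v - set_degree V (lift mu x y w) W {v})" if "v \<in> V" for v
    using par[OF that] dgl[of "{v}"] that by simp
  have "set_degree V (lift mu x y w) W V = set_degree V mu W V" using dgl[of V] assms by simp
  then show "\<not> roomy k 0 V (lift mu x y w) W b V" using tightV unfolding roomy_def by simp
  show "roomy k 2 V (lift mu x y w) W b A" if A: "A \<noteq> {}" "A \<subset> V" "\<And>v. v \<in> X \<Longrightarrow> A \<noteq> {v}" for A
  proof (cases "x \<in> A \<and> y \<notin> A \<and> w \<notin> A \<or> x \<notin> A \<and> y \<in> A \<and> w \<in> A")
    case True
    show ?thesis by (rule roomy_shift[OF room[OF A True]]) (use A dgl[of A] True in auto)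
  next
    case False
    show ?thesis by (rule roomy_shift[OF cond[OF A]]) (use A dgl[of A] False in auto)
  qed
  show "2 * W v \<le> set_degree V (lift mu x y w) W {v}" if "v \<in> X" for v
    using X[OF that] cut_nonneg[OF weights_lift(2)[OF mu assms(6-8)], of V "{x}"] by (simp add: set_degree_def)
  show "weights (lift mu x y w)" using weights_lift(2)[OF mu assms(6,7)] assms(8) by blast
qed (fact fin total XV | erule zW zW_even X1 Xb)+

subsection \<open>Deleting edges\<close>

definition bump :: "('v \<Rightarrow> int) \<Rightarrow> 'v \<Rightarrow> int \<Rightarrow> 'v \<Rightarrow> int" where
  "bump f x c v = f v + c * at_vertex x v"

lemma sum_bump: "finite A \<Longrightarrow> sum (bump f x c) A = sum f A + c * of_bool (x \<in> A)"
  unfolding bump_def by (simp only: sum.distrib sum_scaled_at_vertex)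

definition remove_edge :: "('v \<Rightarrow> 'v \<Rightarrow> int) \<Rightarrow> 'v \<Rightarrow> 'v \<Rightarrow> 'v \<Rightarrow> 'v \<Rightarrow> int" where
  "remove_edge mu x y u v = mu u v - unit_edge x y u v"

lemma weights_remove_edge:
  assumes "weights mu" "1 \<le> mu x y"
  shows "weights (remove_edge mu x y)"
  unfolding weights_def
proof (intro allI)
  fix u v
  have "unit_edge x y u v \<le> mu u v"
    using assms(2) weightsD(1)[OF assms(1), of x y] weightsD(2)[OF assms(1), of u v]
    by (auto simp: unit_edge_def)
  then show "remove_edge mu x y u v = remove_edge mu x y v u \<and> 0 \<le> remove_edge mu x y u v
      \<and> remove_edge mu x y u u = 0"
    using weightsD(1)[OF assms(1), of u v] weightsD(1)[OF weights_unit_edge, of x y u v]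
      weightsD(3)[OF assms(1), of u] weightsD(3)[OF weights_unit_edge, of x y u]
    unfolding remove_edge_def by linarith
qed

lemma cut_remove_edge:
  assumes "finite V" "A \<subseteq> V" "x \<in> V" "y \<in> V"
  shows "cut_weight V (remove_edge mu x y) A = cut_weight V mu A - of_bool ((x \<in> A) \<noteq> (y \<in> A))"
  using assms unfolding remove_edge_def[abs_def] by (simp add: cut_diff cut_unit_edge)

lemma mass_remove_edge:
  assumes "finite V" "x \<in> V" "y \<in> V" "x \<noteq> y"
  shows "mass V (remove_edge mu x y) < mass V mu"
  using assms unfolding remove_edge_def[abs_def] by (simp add: mass_diff mass_unit_edge)

lemma flow_remove_edge:
  assumes "flow V (remove_edge mu x y) \<phi>" "\<delta> = 1 \<or> \<delta> = -1"
  shows "flow V mu (\<lambda>u v. \<phi> u v + \<delta> * unit_arc x y u v)"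
  using flow_add[OF assms(1) flow_unit_edge[OF assms(2), of V x y]] by (simp add: remove_edge_def)

lemma net_remove_edge:
  assumes "finite V" "x \<in> V" "y \<in> V"
  shows "(\<Sum>u\<in>V. \<phi> v u + \<delta> * unit_arc x y v u) = (\<Sum>u\<in>V. \<phi> v u) + \<delta> * at_vertex x v - \<delta> * at_vertex y v"
proof -
  have "(\<Sum>u\<in>V. \<phi> v u + \<delta> * unit_arc x y v u) = (\<Sum>u\<in>V. \<phi> v u) + \<delta> * (\<Sum>u\<in>V. unit_arc x y v u)"
    by (simp add: sum.distrib sum_distrib_left)
  then show ?thesis using assms by (simp add: sum_unit_arc algebra_simps)
qed

text \<open>A split in which one of the two edges is a root edge: a root edge of direction
  \<open>\<delta>\<close> at \<open>x\<close> together with an edge \<open>x y\<close> becomes a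
  root edge of the same direction at \<open>y\<close>. To undo it, the edge \<open>x y\<close> is
  directed so that the path passes through \<open>x\<close>.\<close>

lemma has_orientation_root_lift:
  assumes "finite V" "x \<in> V" "y \<in> V" "\<delta> = 1 \<or> \<delta> = -1"
    and "has_orientation k V (remove_edge mu x y) b (bump (bump z x (-\<delta>)) y \<delta>)"
  shows "has_orientation k V mu b z"
proof -
  obtain \<phi> where \<phi>: "flow V (remove_edge mu x y) \<phi>"
    "\<forall>v\<in>V. 2 * k dvd (\<Sum>u\<in>V. \<phi> v u) + bump (bump z x (-\<delta>)) y \<delta> v - b v \<and>
      \<bar>(\<Sum>u\<in>V. \<phi> v u) + bump (bump z x (-\<delta>)) y \<delta> v\<bar> < 2 * k"
    using assms(5) unfolding has_orientation_def by blast
  have d: "- \<delta> = 1 \<or> - \<delta> = -1" using assms(4) by linarith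
  have e: "(\<Sum>u\<in>V. \<phi> v u + - \<delta> * unit_arc x y v u) + z v = (\<Sum>u\<in>V. \<phi> v u) + bump (bump z x (-\<delta>)) y \<delta> v" for v
    unfolding net_remove_edge[OF assms(1-3)] bump_def by (simp add: algebra_simps)
  show ?thesis unfolding has_orientation_def
  proof (intro exI conjI ballI)
    show "flow V mu (\<lambda>u v. \<phi> u v + - \<delta> * unit_arc x y u v)" by (rule flow_remove_edge[OF \<phi>(1) d])
    fix v assume "v \<in> V"
    with \<phi>(2) show "2 * k dvd (\<Sum>u\<in>V. \<phi> v u + - \<delta> * unit_arc x y v u) + z v - b v"
      "\<bar>(\<Sum>u\<in>V. \<phi> v u + - \<delta> * unit_arc x y v u) + z v\<bar> < 2 * k"
      unfolding e by blast+
  qed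
qed

text \<open>Under the parity condition, \<open>\<bar>z - \<delta>\<bar> \<le> W - 1\<close> says
  that at least one of the \<open>W\<close> root edges has direction
  \<open>\<delta>\<close>.\<close>

lemma root_edge_direction:
  fixes z W :: int
  assumes "1 \<le> W" "\<bar>z\<bar> \<le> W" "even (W - z)"
  obtains \<delta> :: int where "\<delta> = 1 \<or> \<delta> = -1" "\<bar>z - \<delta>\<bar> \<le> W - 1"
proof (cases "z \<ge> 0")
  case True
  have "\<bar>z - 1\<bar> \<le> W - 1" using assms True by (cases "z = 0"; cases "W = 1") auto
  then show ?thesis using that[of 1] by simp
next
  case False
  have "\<bar>z - (-1)\<bar> \<le> W - 1" using assms False by linarith
  then show ?thesis using that[of "-1"] by blast
qed

text \<open>Only sets with \<open>x\<close> inside and \<open>y\<close> outside lose degree; in the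
  other direction the new root edge makes up for the lost cut edge. At an exempt \<open>x\<close>
  both sides of \<open>2 * W x \<le> set_degree V mu W {x}\<close> fall by two.\<close>

lemma (in orient) orient_root_lift:
  assumes "x \<in> V" "y \<in> V" "x \<noteq> y" "1 \<le> mu x y" "\<delta> = 1 \<or> \<delta> = -1" "\<bar>z x - \<delta>\<bar> \<le> W x - 1"
    and X: "\<And>v. v \<in> X \<Longrightarrow> v = x"
    and room: "\<And>A. A \<noteq> {} \<Longrightarrow> A \<subset> V \<Longrightarrow> (\<And>v. v \<in> X \<Longrightarrow> A \<noteq> {v}) \<Longrightarrow>
      x \<in> A \<Longrightarrow> y \<notin> A \<Longrightarrow> roomy k 0 V mu W b A"
  shows "orient k V (remove_edge mu x y) b (bump (bump W x (-1)) y 1) (bump (bump z x (-\<delta>)) y \<delta>) X"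
    (is "orient k V ?mu b ?W ?z X")
proof
  have dg': "set_degree V ?mu ?W A = set_degree V mu W A - 2 * of_bool (x \<in> A \<and> y \<notin> A)" if "A \<subseteq> V" for A
    using cut_remove_edge[OF fin that assms(1,2), of mu] finite_subset[OF that fin]
    by (simp add: set_degree_def sum_bump)
  show "\<bar>?z v\<bar> \<le> ?W v" if "v \<in> V" for v
    using zW[OF that] assms(3,5,6) by (auto simp: bump_def)
  show "even (?W v - ?z v)" if "v \<in> V" for v
    using zW_even[OF that] assms(5) by (auto simp: bump_def)
  show "even (b v - set_degree V ?mu ?W {v})" if "v \<in> V" for v
    using par[OF that] dg'[of "{v}"] that by simp
  show "2 * k dvd sum b V - sum ?z V"
    using total fin assms(1,2) by (simp add: sum_bump)
  have "set_degree V ?mu ?W V = set_degree V mu W V" using dg'[of V] assms by simp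
  then show "\<not> roomy k 0 V ?mu ?W b V" using tightV unfolding roomy_def by simp
  show "roomy k 2 V ?mu ?W b A" if A: "A \<noteq> {}" "A \<subset> V" "\<And>v. v \<in> X \<Longrightarrow> A \<noteq> {v}" for A
  proof (cases "x \<in> A \<and> y \<notin> A")
    case True
    then have "roomy k 0 V mu W b A" using room[OF A] by blast
    then show ?thesis by (rule roomy_shift) (use A dg'[of A] True in auto)
  next
    case False
    show ?thesis by (rule roomy_shift[OF cond[OF A]]) (use A dg'[of A] False in auto)
  qed
  show "2 * ?W v \<le> set_degree V ?mu ?W {v}" if "v \<in> X" for v
    using X[OF that] XW[OF that] dg'[of "{x}"] assms(1,3) by (simp add: bump_def)
  show "weights ?mu" by (rule weights_remove_edge[OF mu assms(4)])
qed (fact fin XV | erule X1 Xb)+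

text \<open>Restoring a deleted edge breaks the bound only at
  \<open>n = \<sigma> * (2 * k - 1)\<close>. That would put \<open>b\<close> into the zero class,
  but it has a representative whose absolute value lies between \<open>1\<close> and
  \<open>k\<close>.\<close>

lemma shift_bound:
  fixes k n b q \<sigma> :: int
  assumes "\<sigma> = 1 \<or> \<sigma> = -1" "2 * k dvd n - (b - \<sigma>)" "1 \<le> \<sigma> * (b + 2 * k * q)" "\<sigma> * (b + 2 * k * q) \<le> k" "\<bar>n\<bar> < 2 * k"
  shows "\<bar>n + \<sigma>\<bar> < 2 * k"
proof (rule ccontr)
  assume "\<not> ?thesis"
  then have n: "n = \<sigma> * (2 * k - 1)" using assms(1,5) by auto
  obtain c where c: "n - (b - \<sigma>) = 2 * k * c" using assms(2) by blast
  have "b + 2 * k * q = 2 * k * (\<sigma> - c + q)" using c n by (simp add: algebra_simps)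
  then have "2 * k dvd \<sigma> * (b + 2 * k * q)" by simp
  then have "2 * k \<le> \<sigma> * (b + 2 * k * q)" using assms(3) by (intro zdvd_imp_le) auto
  then show False using assms(3,4) by linarith
qed

text \<open>With \<open>\<sigma> = 1\<close>, an edge leaving \<open>x\<close> can be deleted:
  residue and degree both fall by one and the cut condition at \<open>{x}\<close> persists. A
  residue of \<open>k\<close> modulo \<open>2 * k\<close> qualifies for both signs if the degree is
  large enough.\<close>

definition signed_tight :: "int \<Rightarrow> 'v set \<Rightarrow> ('v \<Rightarrow> 'v \<Rightarrow> int) \<Rightarrow> ('v \<Rightarrow> int) \<Rightarrow> ('v \<Rightarrow> int) \<Rightarrow> int \<Rightarrow> 'v \<Rightarrow> bool" where
  "signed_tight k V mu W b \<sigma> x \<longleftrightarrow> (\<exists>q. 1 \<le> \<sigma> * (b x + 2 * k * q) \<and> \<sigma> * (b x + 2 * k * q) \<le> k \<and>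
     \<sigma> * (b x + 2 * k * q) + 2 * k - 2 \<le> set_degree V mu W {x})"

lemma has_orientation_delete_root_edge:
  assumes "\<delta> = 1 \<or> \<delta> = -1" "signed_tight k V mu W b \<delta> x"
    and "has_orientation k V mu (bump b x (-\<delta>)) (bump z x (-\<delta>))"
  shows "has_orientation k V mu b z"
proof -
  obtain \<phi> where \<phi>: "flow V mu \<phi>"
    "\<forall>v\<in>V. 2 * k dvd (\<Sum>u\<in>V. \<phi> v u) + bump z x (-\<delta>) v - bump b x (-\<delta>) v \<and>
      \<bar>(\<Sum>u\<in>V. \<phi> v u) + bump z x (-\<delta>) v\<bar> < 2 * k"
    using assms(3) unfolding has_orientation_def by blast
  obtain q where q: "1 \<le> \<delta> * (b x + 2 * k * q)" "\<delta> * (b x + 2 * k * q) \<le> k"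
    using assms(2) unfolding signed_tight_def by blast
  have "2 * k dvd (\<Sum>u\<in>V. \<phi> v u) + z v - b v \<and> \<bar>(\<Sum>u\<in>V. \<phi> v u) + z v\<bar> < 2 * k" if "v \<in> V" for v
  proof (cases "v = x")
    case True
    have "2 * k dvd ((\<Sum>u\<in>V. \<phi> x u) + z x - \<delta>) - (b x - \<delta>)" "\<bar>(\<Sum>u\<in>V. \<phi> x u) + z x - \<delta>\<bar> < 2 * k"
      using \<phi>(2) that True by (auto simp: bump_def algebra_simps)
    from this shift_bound[OF assms(1) this(1) q this(2)] show ?thesis using True by (simp add: algebra_simps)
  qed (use \<phi>(2) that in \<open>auto simp: bump_def add_diff_eq\<close>)
  then show ?thesis using \<phi>(1) unfolding has_orientation_def by blast
qed

lemma has_orientation_delete_edge: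
  assumes "finite V" "x \<in> V" "y \<in> V" "x \<noteq> y"
    and "signed_tight k V mu W b 1 x" "signed_tight k V mu W b (-1) y"
    and "has_orientation k V (remove_edge mu x y) (bump (bump b x (-1)) y 1) z"
  shows "has_orientation k V mu b z"
proof -
  obtain \<phi> where \<phi>: "flow V (remove_edge mu x y) \<phi>"
    "\<And>v. v \<in> V \<Longrightarrow> 2 * k dvd (\<Sum>u\<in>V. \<phi> v u) + z v - bump (bump b x (-1)) y 1 v"
    "\<And>v. v \<in> V \<Longrightarrow> \<bar>(\<Sum>u\<in>V. \<phi> v u) + z v\<bar> < 2 * k"
    using assms(7) unfolding has_orientation_def by blast
  obtain q where q: "1 \<le> 1 * (b x + 2 * k * q)" "1 * (b x + 2 * k * q) \<le> k"
    using assms(5) unfolding signed_tight_def by blast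
  obtain p where p: "1 \<le> -1 * (b y + 2 * k * p)" "-1 * (b y + 2 * k * p) \<le> k"
    using assms(6) unfolding signed_tight_def by blast
  define \<psi> where "\<psi> u v = \<phi> u v + 1 * unit_arc x y u v" for u v
  have net: "(\<Sum>u\<in>V. \<psi> v u) = (\<Sum>u\<in>V. \<phi> v u) + at_vertex x v - at_vertex y v" for v
    unfolding \<psi>_def net_remove_edge[OF assms(1-3)] by simp
  have "2 * k dvd (\<Sum>u\<in>V. \<psi> v u) + z v - b v \<and> \<bar>(\<Sum>u\<in>V. \<psi> v u) + z v\<bar> < 2 * k" if v: "v \<in> V" for v
  proof -
    consider "v = x" | "v = y" | "v \<noteq> x" "v \<noteq> y" by blast
    then show ?thesis
    proof cases
      case 1
      have "2 * k dvd ((\<Sum>u\<in>V. \<phi> x u) + z x) - (b x - 1)"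
        using \<phi>(2)[OF v] 1 assms(4) by (simp add: bump_def)
      from this shift_bound[OF _ this q] \<phi>(3)[OF v] show ?thesis
        unfolding net using 1 assms(4) by (simp add: algebra_simps)
    next
      case 2
      have "2 * k dvd ((\<Sum>u\<in>V. \<phi> y u) + z y) - (b y - (-1))"
        using \<phi>(2)[OF v] 2 assms(4) by (simp add: bump_def)
      from this shift_bound[OF _ this p] \<phi>(3)[OF v] show ?thesis
        unfolding net using 2 assms(4) by (simp add: algebra_simps)
    next
      case 3
      then show ?thesis unfolding net using \<phi>(2)[OF v] \<phi>(3)[OF v] by (simp add: bump_def)
    qed
  qed
  moreover have "flow V mu \<psi>" unfolding \<psi>_def[abs_def] by (rule flow_remove_edge[OF \<phi>(1)]) simp
  ultimately show ?thesis unfolding has_orientation_def by blast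
qed

context orient
begin

lemma signed_tight_roomy:
  assumes "x \<in> V" "signed_tight k V mu W b \<sigma> x" "\<sigma> = 1 \<or> \<sigma> = -1"
    and "sum b' {x} = b x - \<sigma>" "set_degree V' mu' W' {x} = set_degree V mu W {x} - 1"
  shows "roomy k 2 V' mu' W' b' {x}"
proof -
  obtain q where "1 \<le> \<sigma> * (b x + 2 * k * q)" "\<sigma> * (b x + 2 * k * q) + 2 * k - 2 \<le> set_degree V mu W {x}"
    using assms(2) unfolding signed_tight_def by blast
  then have "\<bar>sum b' {x} + 2 * k * q\<bar> + 2 * k - 2 \<le> set_degree V' mu' W' {x}"
    using assms(3-5) by auto
  then show ?thesis unfolding roomy_def by blast
qed

lemma orient_delete_root_edge:
  assumes "x \<in> V" "\<delta> = 1 \<or> \<delta> = -1" "\<bar>z x - \<delta>\<bar> \<le> W x - 1" "X = {}"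
    and t: "signed_tight k V mu W b \<delta> x"
    and room: "\<And>A. A \<subset> V \<Longrightarrow> x \<in> A \<Longrightarrow> A \<noteq> {x} \<Longrightarrow> roomy k 0 V mu W b A"
  shows "orient k V mu (bump b x (-\<delta>)) (bump W x (-1)) (bump z x (-\<delta>)) {}"
    (is "orient k V mu ?b ?W ?z {}")
proof
  have dg': "set_degree V mu ?W A = set_degree V mu W A - of_bool (x \<in> A)" and b': "sum ?b A = sum b A - \<delta> * of_bool (x \<in> A)"
    if "A \<subseteq> V" for A
    using finite_subset[OF that fin] by (simp_all add: set_degree_def sum_bump)
  show "\<bar>?z v\<bar> \<le> ?W v" if "v \<in> V" for v
    using zW[OF that] assms(3) by (auto simp: bump_def)
  show "even (?W v - ?z v)" if "v \<in> V" for v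
    using zW_even[OF that] assms(2) by (auto simp: bump_def)
  show "even (?b v - set_degree V mu ?W {v})" if "v \<in> V" for v
    using par[OF that] dg'[of "{v}"] that assms(2) by (auto simp: bump_def)
  show "2 * k dvd sum ?b V - sum ?z V"
    using total fin by (simp add: sum_bump)
  \<comment> \<open>Passing back to the old instance, the unit change of the residue is paid for by
    the regained root edge, so no slack is spent.\<close>
  show "\<not> roomy k 0 V mu ?W ?b V"
  proof
    assume "roomy k 0 V mu ?W ?b V"
    then have "roomy k 0 V mu W b V"
      by (rule roomy_shift) (use dg'[of V] b'[of V] assms(1,2) in auto)
    then show False using tightV by blast
  qed
  show "roomy k 2 V mu ?W ?b A" if A: "A \<noteq> {}" "A \<subset> V" for A
  proof (cases "x \<in> A")
    case True
    show ?thesis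
    proof (cases "A = {x}")
      case True
      show ?thesis unfolding True
        by (rule signed_tight_roomy[OF assms(1) t assms(2)]) (use dg'[of "{x}"] b'[of "{x}"] assms(1) in auto)
    next
      case False
      from room[OF A(2) True False] show ?thesis
        by (rule roomy_shift) (use dg'[of A] b'[of A] A True assms(2) in auto)
    qed
  next
    case False
    have "roomy k 2 V mu W b A" using cond A assms(4) by blast
    then show ?thesis by (rule roomy_shift) (use dg'[of A] b'[of A] A False in auto)
  qed
qed (use fin mu in auto)

lemma orient_delete_edge:
  assumes "x \<in> V" "y \<in> V" "x \<noteq> y" "1 \<le> mu x y" "X = {}"
    and tx: "signed_tight k V mu W b 1 x" and ty: "signed_tight k V mu W b (-1) y"
    and room: "\<And>A. A \<subset> V \<Longrightarrow> A \<noteq> {} \<Longrightarrow> A \<noteq> {x} \<Longrightarrow> A \<noteq> {y} \<Longrightarrow> (x \<in> A) \<noteq> (y \<in> A) \<Longrightarrow>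
      roomy k 0 V mu W b A"
  shows "orient k V (remove_edge mu x y) (bump (bump b x (-1)) y 1) W z {}"
    (is "orient k V ?mu ?b W z {}")
proof
  have dg': "set_degree V ?mu W A = set_degree V mu W A - of_bool ((x \<in> A) \<noteq> (y \<in> A))"
    and b': "sum ?b A = sum b A - of_bool (x \<in> A) + of_bool (y \<in> A)"
    if "A \<subseteq> V" for A
    using finite_subset[OF that fin] cut_remove_edge[OF fin that assms(1,2), of mu]
    by (simp_all add: set_degree_def sum_bump)
  show "even (?b v - set_degree V ?mu W {v})" if "v \<in> V" for v
    using par[OF that] dg'[of "{v}"] that assms(3) by (auto simp: bump_def)
  have "set_degree V ?mu W V = set_degree V mu W V" "sum ?b V = sum b V" using dg'[of V] b'[of V] assms by auto
  then show "2 * k dvd sum ?b V - sum z V" "\<not> roomy k 0 V ?mu W ?b V"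
    using total tightV unfolding roomy_def by auto
  show "roomy k 2 V ?mu W ?b A" if A: "A \<noteq> {}" "A \<subset> V" for A
  proof (cases "(x \<in> A) \<noteq> (y \<in> A)")
    case True
    consider "A = {x}" | "A = {y}" | "A \<noteq> {x}" "A \<noteq> {y}" by blast
    then show ?thesis
    proof cases
      case 1
      show ?thesis unfolding 1
        by (rule signed_tight_roomy[OF assms(1) tx]) (use dg'[of "{x}"] b'[of "{x}"] assms(1,3) in auto)
    next
      case 2
      show ?thesis unfolding 2
        by (rule signed_tight_roomy[OF assms(2) ty]) (use dg'[of "{y}"] b'[of "{y}"] assms(2,3) in auto)
    next
      case 3
      from room[OF A(2,1) 3 True] show ?thesis
        by (rule roomy_shift) (use dg'[of A] b'[of A] A True in auto)
    qed
  next
    case False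
    have "roomy k 2 V mu W b A" using cond A assms(5) by blast
    then show ?thesis by (rule roomy_shift) (use dg'[of A] b'[of A] A False in auto)
  qed
  show "weights ?mu" by (rule weights_remove_edge[OF mu assms(4)])
qed (use fin zW zW_even in auto)

end

subsection \<open>Exchanging a root edge, and small cases\<close>

text \<open>Let \<open>t\<close> be the representative of \<open>b\<close> between \<open>1\<close>
  and \<open>k - 1\<close>. In the permitted range \<open>n\<close> can only be
  \<open>t + k + 1\<close> or \<open>t + 1 - k\<close>; subtracting \<open>k + 1\<close> leaves
  \<open>t\<close> or \<open>t - 2 * k\<close>.\<close>

lemma replaced_bound:
  fixes k n b q :: int
  assumes "2 * k dvd n - (b + (k + 1))" "1 \<le> b + 2 * k * q" "b + 2 * k * q < k" "\<bar>n\<bar> < 2 * k"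
  shows "\<bar>n - (k + 1)\<bar> < 2 * k"
proof -
  define t where "t = b + 2 * k * q"
  obtain c where "n - (b + (k + 1)) = 2 * k * c" using assms(1) by blast
  then have n: "n = t + k + 1 + 2 * k * (c - q)" unfolding t_def by (simp add: algebra_simps)
  have k: "k > 0" using assms(2,3) by linarith
  have t: "1 \<le> t" "t < k" using assms(2,3) unfolding t_def by auto
  consider "c - q = 0" | "c - q = -1" | "c - q \<ge> 1" | "c - q \<le> -2" by linarith
  then show ?thesis
  proof cases
    case 1 then show ?thesis using n t by simp
  next
    case 2
    then have "n = t + 1 - k" using n unfolding 2 by simp
    then show ?thesis using t by linarith
  next
    case 3
    then have "2 * k * (c - q) \<ge> 2 * k * 1" using k by (intro mult_left_mono) auto
    then show ?thesis using n t assms(4) by linarith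
  next
    case 4
    then have "2 * k * (c - q) \<le> 2 * k * (-2)" using k by (intro mult_left_mono) auto
    then show ?thesis using n t assms(4) by linarith
  qed
qed

lemma replaced_bound_signed:
  fixes k n b q \<sigma> :: int
  assumes \<sigma>: "\<sigma> = 1 \<or> \<sigma> = -1" and "2 * k dvd n - (b + \<sigma> * (k + 1))" "1 \<le> \<sigma> * (b + 2 * k * q)"
    "\<sigma> * (b + 2 * k * q) < k" "\<bar>n\<bar> < 2 * k"
  shows "\<bar>n - \<sigma> * (k + 1)\<bar> < 2 * k"
  using \<sigma>
proof
  assume "\<sigma> = 1"
  then show ?thesis using replaced_bound[of k n b q] assms by simp
next
  assume s: "\<sigma> = -1"
  have "2 * k dvd - (n - (b + \<sigma> * (k + 1)))" using assms(2) by (simp only: dvd_minus_iff)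
  then have "2 * k dvd (-n) - (-b + (k + 1))" using s by (simp add: algebra_simps)
  from replaced_bound[OF this, of "-q"] assms(3-5) s show ?thesis by (simp add: algebra_simps abs_if split: if_splits)
qed

text \<open>
  Modulo \<open>2 * k\<close>, one root edge into \<open>x\<close> has the same effect on the net as \<open>k - 1\<close> root edges out of
  \<open>x\<close>, but the exchange turns \<open>x\<close> into a vertex from which further edges can be deleted.
\<close>

lemma has_orientation_exchange:
  assumes "finite V" "x \<in> V" "y \<in> V" "x \<noteq> y" and \<sigma>: "\<sigma> = 1 \<or> \<sigma> = -1"
    and "1 \<le> \<sigma> * (b x + 2 * k * q)" "\<sigma> * (b x + 2 * k * q) < k"
    and "signed_tight k V mu W b \<sigma> y"
    and "has_orientation k V (remove_edge mu x y) (bump (bump b x (\<sigma> * (k + 1))) y (-\<sigma>)) (bump z x (\<sigma> * k))"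
  shows "has_orientation k V mu b z"
proof -
  obtain \<phi> where \<phi>: "flow V (remove_edge mu x y) \<phi>"
    "\<And>v. v \<in> V \<Longrightarrow> 2 * k dvd (\<Sum>u\<in>V. \<phi> v u) + bump z x (\<sigma> * k) v - bump (bump b x (\<sigma> * (k + 1))) y (-\<sigma>) v"
    "\<And>v. v \<in> V \<Longrightarrow> \<bar>(\<Sum>u\<in>V. \<phi> v u) + bump z x (\<sigma> * k) v\<bar> < 2 * k"
    using assms(9) unfolding has_orientation_def by blast
  obtain p where p: "1 \<le> \<sigma> * (b y + 2 * k * p)" "\<sigma> * (b y + 2 * k * p) \<le> k"
    using assms(8) unfolding signed_tight_def by blast
  define \<psi> where "\<psi> u v = \<phi> u v + (-\<sigma>) * unit_arc x y u v" for u v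
  have net: "(\<Sum>u\<in>V. \<psi> v u) = (\<Sum>u\<in>V. \<phi> v u) - \<sigma> * at_vertex x v + \<sigma> * at_vertex y v" for v
    unfolding \<psi>_def net_remove_edge[OF assms(1-3)] by simp
  have "2 * k dvd (\<Sum>u\<in>V. \<psi> v u) + z v - b v \<and> \<bar>(\<Sum>u\<in>V. \<psi> v u) + z v\<bar> < 2 * k" if v: "v \<in> V" for v
  proof -
    consider "v = x" | "v = y" | "v \<noteq> x" "v \<noteq> y" by blast
    then show ?thesis
    proof cases
      case 1
      define n where "n = (\<Sum>u\<in>V. \<phi> x u) + z x + \<sigma> * k"
      have n: "2 * k dvd n - (b x + \<sigma> * (k + 1))" "\<bar>n\<bar> < 2 * k"
        using \<phi>(2)[OF v] \<phi>(3)[OF v] 1 assms(4) by (simp_all add: bump_def n_def add.assoc)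
      have e: "(\<Sum>u\<in>V. \<psi> x u) + z x = n - \<sigma> * (k + 1)"
        unfolding net n_def using assms(4) by (simp add: algebra_simps)
      have "n - \<sigma> * (k + 1) - b x = n - (b x + \<sigma> * (k + 1))" by simp
      then have "2 * k dvd n - \<sigma> * (k + 1) - b x" using n(1) by argo
      then show ?thesis unfolding 1 e using replaced_bound_signed[OF \<sigma> n(1) assms(6,7) n(2)] by blast
    next
      case 2
      have "2 * k dvd ((\<Sum>u\<in>V. \<phi> y u) + z y) - (b y - \<sigma>)"
        using \<phi>(2)[OF v] 2 assms(4) by (simp add: bump_def)
      from this shift_bound[OF \<sigma> this p] \<phi>(3)[OF v] show ?thesis
        unfolding net using 2 assms(4) by (simp add: bump_def algebra_simps)
    next
      case 3
      then show ?thesis unfolding net using \<phi>(2)[OF v] \<phi>(3)[OF v] by (simp add: bump_def)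
    qed
  qed
  moreover have "flow V mu \<psi>" unfolding \<psi>_def[abs_def] by (rule flow_remove_edge[OF \<phi>(1)]) (use \<sigma> in auto)
  ultimately show ?thesis unfolding has_orientation_def by blast
qed

text \<open>Read with \<open>\<sigma> = 1\<close>: all root edges enter \<open>V\<close>. One of
  those at \<open>x\<close> is traded for \<open>k - 1\<close> leaving ones, so \<open>W x\<close>
  grows by \<open>k - 2\<close> and \<open>z x\<close> by \<open>k\<close>; the target at
  \<open>x\<close> is shifted by the same \<open>k\<close>. At once an edge directed from
  \<open>y\<close> to \<open>x\<close> is deleted, which adds one more to the target at
  \<open>x\<close> and makes the mass fall. The residue \<open>t\<close> of \<open>x\<close> turns
  into \<open>t + 1 - k\<close>, which is negative or zero.\<close>

lemma (in orient) orient_exchange: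
  assumes "x \<in> V" "y \<in> V" "x \<noteq> y" "1 \<le> mu x y" "X = {}" "k \<ge> 2" and \<sigma>: "\<sigma> = 1 \<or> \<sigma> = -1"
    and t: "1 \<le> \<sigma> * (b x + 2 * k * q)" "\<sigma> * (b x + 2 * k * q) < k"
      "\<sigma> * (b x + 2 * k * q) + 2 * k - 2 \<le> set_degree V mu W {x}"
    and ty: "signed_tight k V mu W b \<sigma> y"
    and z: "\<And>v. v \<in> V \<Longrightarrow> z v = - \<sigma> * W v" and "W x \<ge> 1"
    and room: "\<And>A. A \<subset> V \<Longrightarrow> A \<noteq> {} \<Longrightarrow> A \<noteq> {x} \<Longrightarrow> A \<noteq> {y} \<Longrightarrow> x \<in> A \<or> y \<in> A \<Longrightarrow>
      roomy k 0 V mu W b A"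
  shows "orient k V (remove_edge mu x y) (bump (bump b x (\<sigma> * (k + 1))) y (-\<sigma>))
    (bump W x (k - 2)) (bump z x (\<sigma> * k)) {}"
    (is "orient k V ?mu ?b ?W ?z {}")
proof
  have dg': "set_degree V ?mu ?W A = set_degree V mu W A - of_bool ((x \<in> A) \<noteq> (y \<in> A)) + (k - 2) * of_bool (x \<in> A)"
    and b': "sum ?b A = sum b A + \<sigma> * (k + 1) * of_bool (x \<in> A) - \<sigma> * of_bool (y \<in> A)"
    if "A \<subseteq> V" for A
    using finite_subset[OF that fin] cut_remove_edge[OF fin that assms(1,2), of mu]
    by (simp_all add: set_degree_def sum_bump)
  show "\<bar>?z v\<bar> \<le> ?W v" if "v \<in> V" for v
    using z[OF that] zW[OF that] \<sigma> \<open>W x \<ge> 1\<close> \<open>k \<ge> 2\<close> by (auto simp: bump_def)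
  show "even (?W v - ?z v)" if "v \<in> V" for v
    using zW_even[OF that] \<sigma> by (auto simp: bump_def)
  show "even (?b v - set_degree V ?mu ?W {v})" if "v \<in> V" for v
    using par[OF that] dg'[of "{v}"] that assms(3) \<sigma> by (auto simp: bump_def)
  show tot: "2 * k dvd sum ?b V - sum ?z V"
    using total fin b'[of V] assms(1,2) by (simp add: sum_bump algebra_simps)
  \<comment> \<open>As all root edges point the same way, the bound on \<open>sum z V\<close> bounds
    \<open>sum W V\<close>. Hence the new total \<open>\<sigma> * (k - sum W V)\<close> has absolute
    value below \<open>k\<close> and is a least representative.\<close>
  have sz: "sum z V = - \<sigma> * sum W V" using z by (simp add: sum_distrib_left)
  have "W x \<le> sum W V" using member_le_sum[of x V W] assms(1) W_nonneg fin by auto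
  then have B: "1 \<le> sum W V" "sum W V < 2 * k"
    using \<open>W x \<ge> 1\<close> total_bound \<sigma> unfolding sz by auto
  show "\<not> roomy k 0 V ?mu ?W ?b V"
  proof
    assume "roomy k 0 V ?mu ?W ?b V"
    then obtain p where p: "\<bar>sum ?b V + 2 * k * p\<bar> + 2 * k \<le> sum W V + k - 2"
      unfolding roomy_def using dg'[of V] assms(1,2) dgV by auto
    obtain c where c: "sum b V - sum z V = 2 * k * c" using total by blast
    have e: "sum ?b V + 2 * k * p = \<sigma> * (k - sum W V) + 2 * k * (c + p)"
      using c sz b'[of V] assms(1,2) by (simp add: algebra_simps)
    have "\<bar>\<sigma> * (k - sum W V)\<bar> \<le> \<bar>sum ?b V + 2 * k * p\<bar>"
      unfolding e by (rule abs_le_shift) (use B \<sigma> in auto)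
    then show False using p \<sigma> by auto
  qed
  show "roomy k 2 V ?mu ?W ?b A" if A: "A \<noteq> {}" "A \<subset> V" for A
  proof -
    have AV: "A \<subseteq> V" using A by blast
    consider "A = {x}" | "A = {y}" | "A \<noteq> {x}" "A \<noteq> {y}" "x \<in> A \<or> y \<in> A" | "x \<notin> A" "y \<notin> A"
      by satx
    then show ?thesis
    proof cases
      case 1
      \<comment> \<open>The value \<open>t + k + 1\<close> is lowered by \<open>2 * k\<close>. Its
        new absolute value is \<open>k - 1 - t\<close>, and the degree has grown by
        \<open>k - 3\<close>; the condition then amounts to \<open>t \<ge> 1\<close>.\<close>
      have "sum ?b {x} + 2 * k * (q - \<sigma>) = \<sigma> * (\<sigma> * (b x + 2 * k * q) + 1 - k)"
        using b'[of "{x}"] assms(1,3) \<sigma> by (auto simp: algebra_simps)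
      then have "\<bar>sum ?b {x} + 2 * k * (q - \<sigma>)\<bar> + 2 * k - 2 \<le> set_degree V ?mu ?W {x}"
        using dg'[of "{x}"] assms(1,3) t \<sigma> by auto
      then show ?thesis unfolding 1 roomy_def by blast
    next
      case 2
      show ?thesis unfolding 2
        by (rule signed_tight_roomy[OF assms(2) ty \<sigma>]) (use dg'[of "{y}"] b'[of "{y}"] assms(2,3) in auto)
    next
      case 3
      have r: "roomy k 0 V mu W b A" using room[OF A(2,1) 3] .
      show ?thesis
      proof (cases "x \<in> A \<and> y \<notin> A")
        case True
        \<comment> \<open>Counting the change of residue as \<open>\<sigma> * (1 - k)\<close> rather
          than \<open>\<sigma> * (k + 1)\<close>, its \<open>k - 1\<close> units minus the
          \<open>k - 3\<close> gained in degree cost exactly two.\<close>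
        have "sum ?b A - sum b A - \<sigma> * (1 - k) = 2 * k * \<sigma>" using b'[OF AV] True by (simp add: algebra_simps)
        then have "2 * k dvd sum ?b A - sum b A - \<sigma> * (1 - k)" by simp
        with r show ?thesis by (rule roomy_transfer) (use dg'[OF AV] True \<sigma> \<open>k \<ge> 2\<close> in auto)
      next
        case False
        have "\<bar>sum ?b A - sum b A\<bar> + (set_degree V mu W A - set_degree V ?mu ?W A) \<le> 2"
          using dg'[OF AV] b'[OF AV] False \<sigma> \<open>k \<ge> 2\<close> by (cases "x \<in> A"; cases "y \<in> A") auto
        then show ?thesis by (intro roomy_shift[OF r]) simp
      qed
    next
      case 4
      have "roomy k 2 V mu W b A" by (rule cond[OF A]) (use assms(5) in simp)
      then show ?thesis by (rule roomy_shift) (use dg'[OF AV] b'[OF AV] 4 in simp)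
    qed
  qed
  show "weights ?mu" by (rule weights_remove_edge[OF mu assms(4)])
qed (use fin in auto)

section \<open>Pendant exempt vertices, and instances on two vertices\<close>

lemma sum_pair_support:
  fixes f :: "'v \<Rightarrow> int"
  assumes "finite V" "y \<in> V" "\<And>u. u \<in> V \<Longrightarrow> u \<noteq> y \<Longrightarrow> f u = 0"
  shows "sum f V = f y"
proof -
  have "sum f V = sum f {y}" by (rule sum.mono_neutral_right) (use assms in auto)
  then show ?thesis by simp
qed

context orient
begin

lemma pendant_set_degree:
  assumes "x \<in> V" "y \<in> V" "y \<noteq> x" and nbr: "\<And>v. v \<in> V \<Longrightarrow> v \<noteq> y \<Longrightarrow> mu x v = 0" and B: "B \<subseteq> V - {x}"
  shows "set_degree (V - {x}) mu (bump W y (W x)) B = set_degree V mu W (if y \<in> B then insert x B else B)"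
proof -
  have fB: "finite B" "x \<notin> B" using B fin finite_subset by auto
  have *: "(\<Sum>v\<in>V - {x} - B. mu u v) = (\<Sum>v\<in>V - B. mu u v) - mu u x" if "u \<in> B" for u
  proof -
    have "V - {x} - B = V - B - {x}" by blast
    then show ?thesis using fB fin assms(1) by (simp add: sum_diff1)
  qed
  show ?thesis
  proof (cases "y \<in> B")
    case False
    have "mu u x = 0" if "u \<in> B" for u using nbr[of u] that B False sym[of u x] by auto
    then have "cut_weight (V - {x}) mu B = cut_weight V mu B" unfolding cut_weight_def using * by simp
    then show ?thesis using False fB by (simp add: set_degree_def sum_bump)
  next
    case True
    have "V - insert x B = V - {x} - B" by blast
    moreover have "(\<Sum>v\<in>V - {x} - B. mu x v) = 0" using True nbr by (intro sum.neutral) auto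
    ultimately have "cut_weight V mu (insert x B) = cut_weight (V - {x}) mu B" unfolding cut_weight_def using fB by simp
    then show ?thesis using True fB by (simp add: set_degree_def sum_bump)
  qed
qed

text \<open>A set \<open>B\<close> of the smaller instance corresponds to \<open>insert x B\<close>
  if \<open>y \<in> B\<close> and to \<open>B\<close> otherwise. In neither case does an edge at
  \<open>x\<close> cross the cut, and residues agree because \<open>b x\<close> vanishes modulo
  \<open>2 * k\<close>.\<close>

lemma orient_drop_pendant:
  assumes "x \<in> X" "y \<in> V" "y \<noteq> x" and nbr: "\<And>v. v \<in> V \<Longrightarrow> v \<noteq> y \<Longrightarrow> mu x v = 0"
  shows "orient k (V - {x}) mu b (bump W y (W x)) (bump z y (z x)) {}"
proof
  have xV: "x \<in> V" using assms(1) XV by blast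
  note dg' = pendant_set_degree[OF xV assms(2,3) nbr]
  have bx: "2 * k dvd b x" using Xb[OF assms(1)] .
  show "\<bar>bump z y (z x) v\<bar> \<le> bump W y (W x) v" if "v \<in> V - {x}" for v
    using zW[of v] zW[of x] that xV by (auto simp: bump_def)
  show "even (bump W y (W x) v - bump z y (z x) v)" if "v \<in> V - {x}" for v
    using zW_even[of v] zW_even[of x] that xV by (auto simp: bump_def)
  show "even (b v - set_degree (V - {x}) mu (bump W y (W x)) {v})" if "v \<in> V - {x}" for v
  proof (cases "v = y")
    case True
    have "even (sum b {x, y} - set_degree V mu W {x, y})" by (rule parity) (use xV assms in auto)
    moreover have "even (b x)" using bx by (meson dvd_mult_left)
    ultimately show ?thesis using dg'[of "{v}"] True that assms(3) by auto
  next
    case False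
    then show ?thesis using dg'[of "{v}"] that par[of v] by auto
  qed
  have sbx: "sum b (insert x B) = b x + sum b B" if "B \<subseteq> V - {x}" for B
    using that fin finite_subset[of B V] by (intro sum.insert) auto
  have V: "insert x (V - {x}) = V" using xV by blast
  have sV: "sum b V = b x + sum b (V - {x})" using sbx[of "V - {x}"] V by simp
  have "sum (bump z y (z x)) (V - {x}) = sum z V"
    using fin xV assms(2,3) by (simp add: sum_bump sum_diff1) (simp add: bump_def)
  then show "2 * k dvd sum b (V - {x}) - sum (bump z y (z x)) (V - {x})"
    using total bx sV by (metis (no_types, opaque_lifting) add_diff_eq dvd_add_right_iff)
  show "\<not> roomy k 0 (V - {x}) mu (bump W y (W x)) b (V - {x})"
  proof
    assume "roomy k 0 (V - {x}) mu (bump W y (W x)) b (V - {x})"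
    then have "roomy k 0 V mu W b V"
      by (rule roomy_mod) (use dg'[of "V - {x}"] V assms(2,3) bx sV in auto)
    then show False using tightV by blast
  qed
  show "roomy k 2 (V - {x}) mu (bump W y (W x)) b B" if B: "B \<noteq> {}" "B \<subset> V - {x}" for B
  proof -
    let ?B = "if y \<in> B then insert x B else B"
    have "roomy k 2 V mu W b ?B"
    proof (rule cond)
      show "?B \<noteq> {}" using B by auto
      show "?B \<subset> V" using B xV by auto
      show "?B \<noteq> {v}" if "v \<in> X" for v
        using X1[OF assms(1)] that B assms(3) by auto
    qed
    then show ?thesis
      by (rule roomy_mod) (use dg'[of B] B bx sbx[of B] in auto)
  qed
qed (use fin mu in auto)

text \<open>The edges between \<open>x\<close> and \<open>y\<close> only have to balance the root
  edges at \<open>x\<close>, giving \<open>x\<close> net zero. The bound on \<open>2 * W x\<close>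
  says that there are enough of them, and by parity the surplus can be directed half each
  way.\<close>

lemma has_orientation_drop_pendant:
  assumes "x \<in> X" "y \<in> V" "y \<noteq> x" and nbr: "\<And>v. v \<in> V \<Longrightarrow> v \<noteq> y \<Longrightarrow> mu x v = 0" and "k > 0"
    and s: "has_orientation k (V - {x}) mu b (bump z y (z x))"
  shows "has_orientation k V mu b z"
proof -
  have xV: "x \<in> V" using assms(1) XV by blast
  obtain \<phi> where \<phi>: "flow (V - {x}) mu \<phi>"
    "\<And>v. v \<in> V - {x} \<Longrightarrow> 2 * k dvd (\<Sum>u\<in>V - {x}. \<phi> v u) + bump z y (z x) v - b v \<and>
      \<bar>(\<Sum>u\<in>V - {x}. \<phi> v u) + bump z y (z x) v\<bar> < 2 * k"
    using s unfolding has_orientation_def by blast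
  have muxy: "set_degree V mu W {x} = mu x y + W x"
    unfolding set_degree_def using cut_singleton[OF mu fin xV] sum_pair_support[OF fin assms(2), of "mu x"] nbr by simp
  have Wx: "\<bar>z x\<bar> \<le> mu x y" using XW[OF assms(1)] zW[OF xV] muxy by linarith
  have "even (b x)" using Xb[OF assms(1)] by (meson dvd_mult_left)
  then have ev: "even (z x - mu x y)" using par[OF xV] zW_even[OF xV] muxy by auto
  define \<psi> where "\<psi> u v = (if u = x then - z x * at_vertex y v else if v = x then z x * at_vertex y u else \<phi> u v)" for u v
  have "flow V mu \<psi>"
    unfolding flow_def
  proof (intro ballI conjI)
    fix u v assume uv: "u \<in> V" "v \<in> V"
    have F: "\<psi> u v = - \<psi> v u \<and> \<bar>\<psi> u v\<bar> \<le> mu u v \<and> even (\<psi> u v - mu u v)" if "u \<noteq> x" "v \<noteq> x"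
    proof -
      have "\<psi> u v = \<phi> u v" "\<psi> v u = \<phi> v u" "u \<in> V - {x}" "v \<in> V - {x}"
        using that uv by (simp_all add: \<psi>_def)
      with \<phi>(1) show ?thesis unfolding flow_def by metis
    qed
    show "\<psi> u v = - \<psi> v u"
    proof (cases "u = x \<or> v = x")
      case True
      then show ?thesis using assms(3) by (auto simp: \<psi>_def)
    qed (use F in blast)
    have N: "mu x w = 0" if "w \<in> V" "w \<noteq> y" for w using nbr that by blast
    have R: "\<bar>- z x * at_vertex y w\<bar> \<le> mu x w \<and> even (- z x * at_vertex y w - mu x w)" if "w \<in> V" for w
      using Wx ev N[OF that] by (cases "w = y") simp_all
    have R': "\<bar>z x * at_vertex y w\<bar> \<le> mu w x \<and> even (z x * at_vertex y w - mu w x)" if "w \<in> V" for w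
      using R[OF that] sym[of x w] by simp
    show "\<bar>\<psi> u v\<bar> \<le> mu u v" "even (\<psi> u v - mu u v)"
      using F[THEN conjunct2] R[of v] R'[of u] uv by (cases "u = x"; cases "v = x"; simp add: \<psi>_def)+
  qed
  moreover have "2 * k dvd (\<Sum>u\<in>V. \<psi> v u) + z v - b v \<and> \<bar>(\<Sum>u\<in>V. \<psi> v u) + z v\<bar> < 2 * k" if v: "v \<in> V" for v
  proof (cases "v = x")
    case True
    have "(\<Sum>u\<in>V. \<psi> x u) = \<psi> x y" by (rule sum_pair_support[OF fin assms(2)]) (simp add: \<psi>_def)
    then have "(\<Sum>u\<in>V. \<psi> x u) + z x = 0" by (simp add: \<psi>_def)
    then show ?thesis using True Xb[OF assms(1)] \<open>k > 0\<close> by simp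
  next
    case False
    have "(\<Sum>u\<in>V. \<psi> v u) = \<psi> v x + (\<Sum>u\<in>V - {x}. \<psi> v u)" by (rule sum.remove[OF fin xV])
    also have "\<dots> = z x * at_vertex y v + (\<Sum>u\<in>V - {x}. \<phi> v u)" using False by (simp add: \<psi>_def)
    finally have "(\<Sum>u\<in>V. \<psi> v u) + z v = (\<Sum>u\<in>V - {x}. \<phi> v u) + bump z y (z x) v" by (simp add: bump_def)
    then show ?thesis using \<phi>(2)[of v] v False by simp
  qed
  ultimately show ?thesis unfolding has_orientation_def by blast
qed

text \<open>Only the net \<open>s\<close> of \<open>x\<close> is to be chosen; \<open>y\<close> then
  receives \<open>z y - s\<close>. The least representative \<open>t\<close> works unless
  \<open>t\<close> and \<open>z y\<close> have strictly opposite signs. In that case a shift by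
  \<open>2 * k\<close> towards \<open>z y\<close> gives absolute value
  \<open>2 * k - \<bar>t\<bar>\<close>, which the available edges admit because
  \<open>\<bar>t\<bar> \<ge> 1\<close>.\<close>

lemma has_orientation_two_vertices:
  assumes V: "V = {x, y}" "x \<noteq> y" and "k > 0" "W x = 0" "roomy k 2 V mu W b {x}"
  shows "has_orientation k V mu b z"
proof -
  have zx: "z x = 0" using zW[of x] assms by auto
  have m: "set_degree V mu W {x} = mu x y" unfolding set_degree_def cut_weight_def using assms by (simp add: insert_Diff_if)
  obtain q where q: "\<bar>b x + 2 * k * q\<bar> + 2 * k - 2 \<le> mu x y"
    using assms(5) m unfolding roomy_def by auto
  obtain p where p: "\<bar>b x + 2 * k * p\<bar> \<le> k" using residue_exists[OF \<open>k > 0\<close>] by blast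
  define t where "t = b x + 2 * k * p"
  have "\<bar>t\<bar> \<le> \<bar>t + 2 * k * (q - p)\<bar>" by (rule abs_le_shift) (use p t_def in simp)
  then have tm: "\<bar>t\<bar> + 2 * k - 2 \<le> mu x y" using q unfolding t_def by (simp add: algebra_simps)
  have tk: "\<bar>t\<bar> \<le> k" using p unfolding t_def .
  have Z: "\<bar>z y\<bar> < 2 * k" using total_bound V zx by simp
  have "sum b V - sum z V = b x + b y - z y" using V zx by simp
  then obtain c where c: "b x + b y - z y = 2 * k * c" using total unfolding dvd_def by metis
  have "even (b x - mu x y)" using par[of x] V(1) unfolding m by simp
  then have te: "even (t - mu x y)" unfolding t_def by simp
  obtain d where d: "\<bar>t + 2 * k * d\<bar> \<le> mu x y" "\<bar>t + 2 * k * d\<bar> < 2 * k" "\<bar>z y - (t + 2 * k * d)\<bar> < 2 * k"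
  proof -
    consider "t \<ge> 0 \<and> z y \<ge> 0 \<or> t \<le> 0 \<and> z y \<le> 0" | "t < 0" "z y > 0" | "t > 0" "z y < 0" by linarith
    then show ?thesis
    proof cases
      case 1
      show ?thesis by (rule that[of 0]) (use 1 tm tk Z \<open>k > 0\<close> in \<open>simp_all, linarith\<close>)
    next
      case 2
      show ?thesis by (rule that[of 1]) (use 2 tm tk Z in simp_all)
    next
      case 3
      show ?thesis by (rule that[of "-1"]) (use 3 tm tk Z in simp_all)
    qed
  qed
  define s where "s = t + 2 * k * d"
  define \<psi> where "\<psi> u v = s * unit_arc x y u v" for u v
  have "even (s - mu x y)" using te unfolding s_def by simp
  then have f: "flow V mu \<psi>"
    unfolding flow_def \<psi>_def V(1) using d(1) V(2) sym[of y x] diag[of x] diag[of y]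
    by (simp add: unit_arc_def s_def[symmetric])
  have net: "(\<Sum>u\<in>V. \<psi> v u) = s * at_vertex x v - s * at_vertex y v" for v
  proof -
    have "(\<Sum>u\<in>V. \<psi> v u) = s * (\<Sum>u\<in>V. unit_arc x y v u)" unfolding \<psi>_def by (simp only: sum_distrib_left)
    also have "(\<Sum>u\<in>V. unit_arc x y v u) = at_vertex x v - at_vertex y v" by (rule sum_unit_arc[OF fin]) (use V in auto)
    finally show ?thesis by (simp only: right_diff_distrib)
  qed
  have "s - b x = 2 * k * (p + d)" unfolding s_def t_def by (simp add: algebra_simps)
  then have 1: "2 * k dvd s - b x" by simp
  have "- s + z y - b y = 2 * k * (- p - d - c)" unfolding s_def t_def using c by (simp add: algebra_simps)
  then have 2: "2 * k dvd - s + z y - b y" by (metis dvd_triv_left)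
  have 3: "\<bar>s\<bar> < 2 * k" "\<bar>- s + z y\<bar> < 2 * k" using d unfolding s_def by linarith+
  have "2 * k dvd (\<Sum>u\<in>V. \<psi> v u) + z v - b v \<and> \<bar>(\<Sum>u\<in>V. \<psi> v u) + z v\<bar> < 2 * k" if v: "v \<in> V" for v
  proof -
    consider "v = x" | "v = y" using v V(1) by blast
    then show ?thesis by cases (use 1 2 3 V(2) zx in \<open>simp_all add: net\<close>)
  qed
  with f show ?thesis unfolding has_orientation_def by blast
qed

end

subsection \<open>Contraction\<close>

lemma distribute_flow:
  fixes c :: "'v \<Rightarrow> int"
  assumes "finite A" "\<And>x. x \<in> A \<Longrightarrow> 0 \<le> c x" "\<bar>s\<bar> \<le> sum c A" "even (s - sum c A)"
  shows "\<exists>g. (\<forall>x\<in>A. \<bar>g x\<bar> \<le> c x \<and> even (g x - c x)) \<and> sum g A = s"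
  using assms
proof (induction A arbitrary: s rule: finite_induct)
  case (insert x A)
  define C where "C = sum c A"
  have C: "0 \<le> C" unfolding C_def using insert by (intro sum_nonneg) auto
  have s: "\<bar>s\<bar> \<le> c x + C" "even (s - (c x + C))" "0 \<le> c x" using insert by (auto simp: C_def)
  \<comment> \<open>Greedy choice: \<open>x\<close> takes all of \<open>c x\<close> unless the rest
    would then have to go below \<open>- C\<close>. Both candidates have the parity of
    \<open>C\<close>.\<close>
  define s' where "s' = max (- C) (s - c x)"
  have s': "\<bar>s'\<bar> \<le> C" "even (s' - C)" "\<bar>s - s'\<bar> \<le> c x" "even (s - s' - c x)"
    using s C unfolding s'_def by (auto simp: max_def abs_le_iff)
  obtain g where g: "\<forall>x\<in>A. \<bar>g x\<bar> \<le> c x \<and> even (g x - c x)" "sum g A = s'"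
    using insert.IH[of s'] insert.prems s' unfolding C_def by auto
  have "sum (g(x := s - s')) A = sum g A" using insert.hyps by (intro sum.cong) auto
  then show ?case
    using g s' insert.hyps by (intro exI[of _ "g(x := s - s')"]) auto
qed simp

text \<open>The contracted vertex is named by a member \<open>a\<close> of \<open>A\<close>, so the
  quotient keeps the vertex type for which the induction hypothesis is available.\<close>

definition fiber :: "'v set \<Rightarrow> 'v \<Rightarrow> 'v \<Rightarrow> 'v set" where
  "fiber A a u = (if u = a then A else {u})"

definition contract_fun :: "'v set \<Rightarrow> 'v \<Rightarrow> ('v \<Rightarrow> int) \<Rightarrow> 'v \<Rightarrow> int" where
  "contract_fun A a f u = sum f (fiber A a u)"

definition contract_weights :: "'v set \<Rightarrow> 'v \<Rightarrow> ('v \<Rightarrow> 'v \<Rightarrow> int) \<Rightarrow> 'v \<Rightarrow> 'v \<Rightarrow> int" where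
  "contract_weights A a mu u v = (if u = v then 0 else \<Sum>x\<in>fiber A a u. \<Sum>y\<in>fiber A a v. mu x y)"

definition preimage :: "'v set \<Rightarrow> 'v \<Rightarrow> 'v set \<Rightarrow> 'v set" where
  "preimage A a B = (if a \<in> B then B \<union> A else B)"

locale contraction =
  fixes V A :: "'v set" and a :: 'v
  assumes fin_V: "finite V" and AV: "A \<subseteq> V" and aA: "a \<in> A"
begin

abbreviation "Q \<equiv> insert a (V - A)"

lemma fin_A: "finite A" using AV fin_V finite_subset by blast

lemma preimage_fibers: "B \<subseteq> Q \<Longrightarrow> preimage A a B = (\<Union>u\<in>B. fiber A a u)"
  unfolding preimage_def fiber_def using aA by auto

lemma sum_fibers:
  assumes "B \<subseteq> Q"
  shows "(\<Sum>u\<in>B. sum f (fiber A a u)) = sum f (preimage A a B)"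
proof -
  have "finite B" using assms fin_V finite_subset by (metis finite_Diff finite_insert)
  then show ?thesis unfolding preimage_fibers[OF assms]
    by (intro sum.UNION_disjoint[symmetric]) (use assms fin_A in \<open>auto simp: fiber_def\<close>)
qed

lemma preimage_diff: "B \<subseteq> Q \<Longrightarrow> preimage A a (Q - B) = V - preimage A a B"
  unfolding preimage_def using AV aA by auto

lemma preimage_Q: "preimage A a Q = V"
  unfolding preimage_def using AV aA by auto

lemma cut_contract:
  assumes "B \<subseteq> Q"
  shows "cut_weight Q (contract_weights A a mu) B = cut_weight V mu (preimage A a B)"
proof -
  have "cut_weight Q (contract_weights A a mu) B = (\<Sum>u\<in>B. \<Sum>v\<in>Q - B. \<Sum>x\<in>fiber A a u. \<Sum>y\<in>fiber A a v. mu x y)"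
    unfolding cut_weight_def contract_weights_def by (intro sum.cong refl) auto
  also have "\<dots> = (\<Sum>u\<in>B. \<Sum>x\<in>fiber A a u. \<Sum>v\<in>Q - B. \<Sum>y\<in>fiber A a v. mu x y)"
    by (intro sum.cong refl sum.swap)
  also have "\<dots> = (\<Sum>u\<in>B. \<Sum>x\<in>fiber A a u. \<Sum>y\<in>V - preimage A a B. mu x y)"
    by (subst sum_fibers) (auto simp: preimage_diff[OF assms])
  also have "\<dots> = cut_weight V mu (preimage A a B)"
    unfolding cut_weight_def by (rule sum_fibers[OF assms])
  finally show ?thesis .
qed

lemma sum_contract: "B \<subseteq> Q \<Longrightarrow> sum (contract_fun A a f) B = sum f (preimage A a B)"
  unfolding contract_fun_def by (rule sum_fibers)

lemma set_degree_contract: "B \<subseteq> Q \<Longrightarrow>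
    set_degree Q (contract_weights A a mu) (contract_fun A a W) B = set_degree V mu W (preimage A a B)"
  unfolding set_degree_def by (simp only: cut_contract sum_contract)

lemma roomy_contract: "B \<subseteq> Q \<Longrightarrow>
    roomy k r Q (contract_weights A a mu) (contract_fun A a W) (contract_fun A a b) B
      \<longleftrightarrow> roomy k r V mu W b (preimage A a B)"
  unfolding roomy_def by (simp only: set_degree_contract sum_contract)

lemma contract_fun_a: "contract_fun A a f a = sum f A"
  and contract_fun_out: "v \<notin> A \<Longrightarrow> contract_fun A a f v = f v"
  using aA unfolding contract_fun_def fiber_def by auto

lemma weights_contract: "weights mu \<Longrightarrow> weights (contract_weights A a mu)"
  unfolding weights_def
proof (intro allI conjI)
  fix u v assume *: "\<forall>u v. mu u v = mu v u \<and> 0 \<le> mu u v \<and> mu u u = 0"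
  have "(\<Sum>x\<in>fiber A a u. \<Sum>y\<in>fiber A a v. mu x y) = (\<Sum>y\<in>fiber A a v. \<Sum>x\<in>fiber A a u. mu y x)"
    using * by (subst sum.swap) (metis (no_types, lifting) sum.cong)
  then show "contract_weights A a mu u v = contract_weights A a mu v u" unfolding contract_weights_def by simp
  show "0 \<le> contract_weights A a mu u v" unfolding contract_weights_def
    using * by (auto intro!: sum_nonneg)
qed (simp add: contract_weights_def)

text \<open>A direction of the quotient fixes, for each \<open>v\<close> outside \<open>A\<close>,
  only the net from \<open>A\<close> to \<open>v\<close>; \<open>distribute_flow\<close> spreads it
  over the actual edges. These then act as root edges for the inside. Since \<open>g\<close> arises
  from the first solution, \<open>s2\<close> must admit every such \<open>g\<close> with the right
  total.\<close>

lemma has_orientation_glue: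
  assumes mu: "weights mu"
    and s1: "has_orientation k Q (contract_weights A a mu) (contract_fun A a b) (contract_fun A a z)"
    and s2: "\<And>g. (\<And>u v. u \<in> A \<Longrightarrow> v \<in> V - A \<Longrightarrow> \<bar>g v u\<bar> \<le> mu u v \<and> even (g v u - mu u v)) \<Longrightarrow>
      2 * k dvd (\<Sum>v\<in>V - A. \<Sum>u\<in>A. g v u) + sum z A - sum b A \<Longrightarrow>
      has_orientation k A mu b (\<lambda>u. z u + (\<Sum>v\<in>V - A. g v u))"
  shows "has_orientation k V mu b z"
proof -
  obtain \<phi> where \<phi>: "flow Q (contract_weights A a mu) \<phi>"
    "\<And>v. v \<in> Q \<Longrightarrow> 2 * k dvd (\<Sum>u\<in>Q. \<phi> v u) + contract_fun A a z v - contract_fun A a b v"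
    "\<And>v. v \<in> Q \<Longrightarrow> \<bar>(\<Sum>u\<in>Q. \<phi> v u) + contract_fun A a z v\<bar> < 2 * k"
    using s1 unfolding has_orientation_def by blast
  have \<phi>D: "\<phi> u v = - \<phi> v u" "\<bar>\<phi> u v\<bar> \<le> contract_weights A a mu u v"
    "even (\<phi> u v - contract_weights A a mu u v)" if "u \<in> Q" "v \<in> Q" for u v
    using \<phi>(1) that unfolding flow_def by blast+
  have cm: "contract_weights A a mu a v = (\<Sum>u\<in>A. mu u v)" if "v \<in> V - A" for v
    using that aA unfolding contract_weights_def fiber_def by auto
  have cm': "contract_weights A a mu u v = mu u v" if "u \<in> V - A" "v \<in> V - A" for u v
    using that aA weightsD(3)[OF mu] unfolding contract_weights_def fiber_def by auto
  have "\<exists>g. (\<forall>u\<in>A. \<bar>g u\<bar> \<le> mu u v \<and> even (g u - mu u v)) \<and> sum g A = \<phi> a v" if v: "v \<in> V - A" for v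
    by (rule distribute_flow[OF fin_A]) (use weightsD(2)[OF mu] \<phi>D(2,3)[of a v] v in \<open>auto simp: cm[OF v]\<close>)
  then obtain g where g: "\<And>u v. u \<in> A \<Longrightarrow> v \<in> V - A \<Longrightarrow> \<bar>g v u\<bar> \<le> mu u v \<and> even (g v u - mu u v)"
    "\<And>v. v \<in> V - A \<Longrightarrow> sum (g v) A = \<phi> a v" by metis
  have \<phi>aa: "\<phi> a a = 0" using \<phi>D(2)[of a a] by (simp add: contract_weights_def)
  have sumQ: "(\<Sum>u\<in>Q. \<phi> v u) = \<phi> v a + (\<Sum>u\<in>V - A. \<phi> v u)" for v
    using fin_V aA by (intro sum.insert) auto
  have "(\<Sum>v\<in>V - A. \<Sum>u\<in>A. g v u) = (\<Sum>v\<in>Q. \<phi> a v)" unfolding sumQ using g(2) \<phi>aa by simp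
  then have "2 * k dvd (\<Sum>v\<in>V - A. \<Sum>u\<in>A. g v u) + sum z A - sum b A"
    using \<phi>(2)[of a] by (simp add: contract_fun_a)
  from s2[OF g(1) this] obtain \<theta> where \<theta>: "flow A mu \<theta>"
    "\<And>v. v \<in> A \<Longrightarrow> 2 * k dvd (\<Sum>u\<in>A. \<theta> v u) + (z v + (\<Sum>w\<in>V - A. g w v)) - b v"
    "\<And>v. v \<in> A \<Longrightarrow> \<bar>(\<Sum>u\<in>A. \<theta> v u) + (z v + (\<Sum>w\<in>V - A. g w v))\<bar> < 2 * k"
    unfolding has_orientation_def by blast
  define \<psi> where "\<psi> u v = (if u \<in> A then (if v \<in> A then \<theta> u v else g v u)
    else if v \<in> A then - g u v else \<phi> u v)" for u v
  have split: "(\<Sum>u\<in>V. \<psi> v u) = (\<Sum>u\<in>A. \<psi> v u) + (\<Sum>u\<in>V - A. \<psi> v u)" for v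
    using sum.subset_diff[OF AV fin_V, of "\<psi> v"] by simp
  have "flow V mu \<psi>"
    unfolding flow_def
  proof (intro ballI)
    fix u v assume uv: "u \<in> V" "v \<in> V"
    consider "u \<in> A" "v \<in> A" | "u \<in> A" "v \<in> V - A" | "u \<in> V - A" "v \<in> A" | "u \<in> V - A" "v \<in> V - A"
      using uv by blast
    then show "\<psi> u v = - \<psi> v u \<and> \<bar>\<psi> u v\<bar> \<le> mu u v \<and> even (\<psi> u v - mu u v)"
    proof cases
      case 1
      then have "\<psi> u v = \<theta> u v" "\<psi> v u = \<theta> v u" by (auto simp: \<psi>_def)
      then show ?thesis using \<theta>(1) 1 unfolding flow_def by metis
    next
      case 2
      then show ?thesis using g(1)[of u v] by (auto simp: \<psi>_def)
    next
      case 3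
      then show ?thesis using g(1)[of v u] weightsD(1)[OF mu, of u v] by (auto simp: \<psi>_def)
    next
      case 4
      then have "\<psi> u v = \<phi> u v" "\<psi> v u = \<phi> v u" by (auto simp: \<psi>_def)
      then show ?thesis using \<phi>D[of u v] 4 cm'[of u v] by (metis insertI2)
    qed
  qed
  moreover have "2 * k dvd (\<Sum>u\<in>V. \<psi> v u) + z v - b v \<and> \<bar>(\<Sum>u\<in>V. \<psi> v u) + z v\<bar> < 2 * k" if v: "v \<in> V" for v
  proof (cases "v \<in> A")
    case True
    have "(\<Sum>u\<in>V. \<psi> v u) + z v = (\<Sum>u\<in>A. \<theta> v u) + (z v + (\<Sum>w\<in>V - A. g w v))"
      unfolding split using True by (simp add: \<psi>_def)
    then show ?thesis using \<theta>(2,3)[OF True] by argo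
  next
    case False
    then have vQ: "v \<in> V - A" "v \<in> Q" using v by auto
    have "(\<Sum>u\<in>A. \<psi> v u) = - sum (g v) A" using False by (simp add: \<psi>_def sum_negf)
    also have "\<dots> = \<phi> v a" using g(2)[OF vQ(1)] \<phi>D(1)[of v a] vQ by simp
    finally have "(\<Sum>u\<in>V. \<psi> v u) + z v = (\<Sum>u\<in>Q. \<phi> v u) + contract_fun A a z v"
      unfolding split sumQ using False by (simp add: \<psi>_def contract_fun_out)
    then show ?thesis using \<phi>(2,3)[OF vQ(2)] False by (simp add: contract_fun_out)
  qed
  ultimately show ?thesis unfolding has_orientation_def by blast
qed

end

context orient
begin

lemma orient_contract:
  assumes "A \<subset> V" "a \<in> A" "2 \<le> card A"
  shows "orient k (insert a (V - A)) (contract_weights A a mu) (contract_fun A a b) (contract_fun A a W)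
    (contract_fun A a z) (X - A)"
proof -
  interpret contraction V A a by unfold_locales (use assms fin in auto)
  have pre1: "preimage A a {v} = {v}" if "v \<notin> A" for v using that aA by (auto simp: preimage_def)
  have prea: "preimage A a {a} = A" using aA by (auto simp: preimage_def)
  show ?thesis
  proof
    fix v assume v: "v \<in> Q"
    show "\<bar>contract_fun A a z v\<bar> \<le> contract_fun A a W v" "even (contract_fun A a W v - contract_fun A a z v)"
      "even (contract_fun A a b v - set_degree Q (contract_weights A a mu) (contract_fun A a W) {v})"
    proof -
      have dgv: "set_degree Q (contract_weights A a mu) (contract_fun A a W) {v} = set_degree V mu W (preimage A a {v})"
        using set_degree_contract[of "{v}"] v by simp
      have "\<bar>sum z A\<bar> \<le> sum W A" using sum_abs[of z A] sum_mono[of A "\<lambda>v. \<bar>z v\<bar>" W] zW AV by (meson order_trans subsetD)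
      moreover have "even (sum W A - sum z A)" unfolding sum_subtractf[symmetric] using zW_even AV by (intro dvd_sum) auto
      ultimately show "\<bar>contract_fun A a z v\<bar> \<le> contract_fun A a W v" "even (contract_fun A a W v - contract_fun A a z v)"
        using zW zW_even v by (cases "v = a"; simp add: contract_fun_a contract_fun_out)+
      show "even (contract_fun A a b v - set_degree Q (contract_weights A a mu) (contract_fun A a W) {v})"
        unfolding dgv using par parity[OF AV] v by (cases "v = a") (auto simp: contract_fun_a contract_fun_out pre1 prea)
    qed
  next
    show "2 * k dvd sum (contract_fun A a b) Q - sum (contract_fun A a z) Q"
      using total by (simp only: sum_contract preimage_Q order_refl)
    show "\<not> roomy k 0 Q (contract_weights A a mu) (contract_fun A a W) (contract_fun A a b) Q"
      using tightV by (simp add: roomy_contract preimage_Q)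
  next
    fix B assume B: "B \<noteq> {}" "B \<subset> Q" "\<And>x. x \<in> X - A \<Longrightarrow> B \<noteq> {x}"
    have BQ: "B \<subseteq> Q" using B by blast
    show "roomy k 2 Q (contract_weights A a mu) (contract_fun A a W) (contract_fun A a b) B"
      unfolding roomy_contract[OF BQ]
    proof (rule cond)
      show "preimage A a B \<noteq> {}" using B by (auto simp: preimage_def)
      have "preimage A a (Q - B) \<noteq> {}" using B by (auto simp: preimage_def)
      moreover have "preimage A a B \<subseteq> V" using AV BQ aA by (auto simp: preimage_def)
      ultimately show "preimage A a B \<subset> V" unfolding preimage_diff[OF BQ] by blast
      fix x assume x: "x \<in> X"
      show "preimage A a B \<noteq> {x}"
      proof
        assume p: "preimage A a B = {x}"
        show False
        proof (cases "a \<in> B")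
          case True
          then have "A \<subseteq> {x}" using p by (auto simp: preimage_def)
          then have "card A \<le> 1" using card_mono[of "{x}" A] by simp
          then show False using assms(3) by simp
        next
          case False
          then have "B = {x}" using p by (simp add: preimage_def)
          moreover from this False have "x \<notin> A" using BQ by auto
          ultimately show False using B(3)[of x] x by blast
        qed
      qed
    qed
  next
    fix x assume x: "x \<in> X - A"
    then have xV: "x \<in> V" "x \<notin> A" "x \<in> Q" using XV by auto
    show "X - A = {x}" using X1[of x] x by blast
    show "2 * k dvd contract_fun A a b x" using Xb[of x] x by (simp add: contract_fun_out)
    show "2 * contract_fun A a W x \<le> set_degree Q (contract_weights A a mu) (contract_fun A a W) {x}"
      using XW[of x] x xV set_degree_contract[of "{x}" mu W] by (simp add: contract_fun_out pre1)
  qed (use fin XV weights_contract[OF mu] in auto)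
qed

text \<open>Everything outside \<open>A\<close> is merged into the root. That \<open>A\<close> is
  not roomy for \<open>r = 0\<close> is precisely the condition \<open>tightV\<close> of the
  instance on \<open>A\<close>.\<close>

lemma orient_inside:
  assumes A: "A \<subset> V" "2 \<le> card A" "\<not> roomy k 0 V mu W b A"
    and g: "\<And>u v. u \<in> A \<Longrightarrow> v \<in> V - A \<Longrightarrow> \<bar>g v u\<bar> \<le> mu u v \<and> even (g v u - mu u v)"
    and tot: "2 * k dvd (\<Sum>v\<in>V - A. \<Sum>u\<in>A. g v u) + sum z A - sum b A"
  shows "orient k A mu b (\<lambda>u. W u + (\<Sum>v\<in>V - A. mu u v)) (\<lambda>u. z u + (\<Sum>v\<in>V - A. g v u)) (X \<inter> A)"
    (is "orient k A mu b ?W ?z _")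
proof -
  have AV: "A \<subseteq> V" and finA: "finite A" using A fin finite_subset by blast+
  have dg': "set_degree A mu ?W B = set_degree V mu W B" if "B \<subseteq> A" for B
  proof -
    have "(\<Sum>v\<in>V - B. mu u v) = (\<Sum>v\<in>A - B. mu u v) + (\<Sum>v\<in>V - A. mu u v)" for u
    proof -
      have "V - B = (A - B) \<union> (V - A)" using that AV by blast
      then show ?thesis using finA fin by (simp add: sum.union_disjoint Diff_Int_distrib2 Int_Diff disjoint_iff)
    qed
    then show ?thesis by (simp add: set_degree_def cut_weight_def sum.distrib)
  qed
  have room': "roomy k r A mu ?W b B \<longleftrightarrow> roomy k r V mu W b B" if "B \<subseteq> A" for r B
    unfolding roomy_def dg'[OF that] ..
  show ?thesis
  proof
    fix v assume v: "v \<in> A"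
    have "\<bar>\<Sum>w\<in>V - A. g w v\<bar> \<le> (\<Sum>w\<in>V - A. \<bar>g w v\<bar>)" by (rule sum_abs)
    also have "\<dots> \<le> (\<Sum>w\<in>V - A. mu v w)" using g v by (intro sum_mono) auto
    finally show "\<bar>?z v\<bar> \<le> ?W v" using zW[of v] v AV by auto
    have "even (\<Sum>w\<in>V - A. mu v w - g w v)" using g[OF v] by (intro dvd_sum) (auto simp: dvd_diff_commute)
    then show "even (?W v - ?z v)" using zW_even[of v] v AV by (auto simp: sum_subtractf)
    show "even (b v - set_degree A mu ?W {v})" using dg'[of "{v}"] par[of v] v AV by auto
  next
    have "sum ?z A = sum z A + (\<Sum>v\<in>V - A. \<Sum>u\<in>A. g v u)" by (subst sum.swap) (simp add: sum.distrib)
    then have "sum b A - sum ?z A = - ((\<Sum>v\<in>V - A. \<Sum>u\<in>A. g v u) + sum z A - sum b A)" by linarith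
    then show "2 * k dvd sum b A - sum ?z A" using tot by (simp only: dvd_minus_iff)
    show "\<not> roomy k 0 A mu ?W b A" using A(3) room'[of A] by blast
    show "roomy k 2 A mu ?W b B" if "B \<noteq> {}" "B \<subset> A" "\<And>x. x \<in> X \<inter> A \<Longrightarrow> B \<noteq> {x}" for B
    proof -
      have BA: "B \<subseteq> A" using that by blast
      have "roomy k 2 V mu W b B" by (rule cond) (use that AV in auto)
      then show ?thesis using room'[OF BA] by blast
    qed
  next
    fix x assume x: "x \<in> X \<inter> A"
    then have xV: "x \<in> V" using XV by blast
    show "X \<inter> A = {x}" using X1[of x] x by blast
    show bx: "2 * k dvd b x" using Xb x by blast
    \<comment> \<open>The exempt \<open>x\<close> has residue zero, so \<open>A\<close> and
      \<open>A - {x}\<close> have the same residue. Comparing the tight \<open>A\<close> with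
      \<open>A - {x}\<close> shows that the edges from \<open>x\<close> out of \<open>A\<close>,
      root edges included, are at most those from \<open>x\<close> into \<open>A\<close>.\<close>
    have "roomy k 2 V mu W b (A - {x})"
    proof (rule cond)
      have c: "card (A - {x}) = card A - 1" using x finA by simp
      then show "A - {x} \<noteq> {}" using A(2) by (metis One_nat_def card.empty diff_is_0_eq not_less_eq_eq numeral_2_eq_2)
      show "A - {x} \<subset> V" using A by blast
      show "A - {x} \<noteq> {v}" if "v \<in> X" for v using X1[of x] that x by auto
    qed
    then obtain q where q: "\<bar>sum b (A - {x}) + 2 * k * q\<bar> + 2 * k - 2 \<le> set_degree V mu W (A - {x})"
      unfolding roomy_def by blast
    obtain c where c: "b x = 2 * k * c" using bx by blast
    have sb: "sum b A = b x + sum b (A - {x})" using x finA by (simp add: sum.remove[of A x])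
    have "sum b A + 2 * k * (q - c) = sum b (A - {x}) + 2 * k * q" unfolding sb c by (simp add: algebra_simps)
    then have le: "set_degree V mu W A \<le> set_degree V mu W (A - {x})" using tight_le[OF AV A(3), of "q - c"] q by linarith
    have "(\<Sum>v\<in>V - (A - {x}). mu u v) = mu u x + (\<Sum>v\<in>V - A. mu u v)" for u
    proof -
      have "V - (A - {x}) = insert x (V - A)" using x xV by blast
      then show ?thesis using x fin by simp
    qed
    then have "cut_weight V mu (A - {x}) = (\<Sum>u\<in>A - {x}. mu u x) + (\<Sum>u\<in>A - {x}. \<Sum>v\<in>V - A. mu u v)"
      unfolding cut_weight_def by (simp add: sum.distrib)
    moreover have "cut_weight V mu A = (\<Sum>v\<in>V - A. mu x v) + (\<Sum>u\<in>A - {x}. \<Sum>v\<in>V - A. mu u v)"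
      unfolding cut_weight_def using x finA by (simp add: sum.remove[of A x])
    moreover have "sum W A = W x + sum W (A - {x})" using x finA by (simp add: sum.remove[of A x])
    ultimately have 1: "?W x \<le> (\<Sum>u\<in>A - {x}. mu u x)" using le unfolding set_degree_def by linarith
    have "set_degree A mu ?W {x} = (\<Sum>u\<in>A - {x}. mu u x) + ?W x" using sym[of x] by (simp add: set_degree_def cut_weight_def)
    then show "2 * ?W x \<le> set_degree A mu ?W {x}" using 1 by simp
  qed (use finA mu in auto)
qed

lemma has_orientation_by_contraction:
  assumes "A \<subset> V" "2 \<le> card A" "\<not> roomy k 0 V mu W b A"
    and IH: "\<And>V' mu' b' W' z' X'. card V' < card V \<Longrightarrow> orient k (V' :: 'v set) mu' b' W' z' X' \<Longrightarrow> has_orientation k V' mu' b' z'"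
  shows "has_orientation k V mu b z"
proof -
  have finA: "finite A" using assms(1) fin finite_subset by blast
  obtain a where a: "a \<in> A" using assms(2) by (metis card.empty equals0I not_numeral_le_zero)
  interpret contraction V A a by unfold_locales (use assms a fin in auto)
  have cA: "card A < card V" using assms(1) fin by (rule psubset_card_mono[rotated])
  have "card Q = Suc (card V - card A)" using a AV fin finA by (simp add: card_Diff_subset)
  then have cQ: "card Q < card V" using assms(2) cA by linarith
  show ?thesis
  proof (rule has_orientation_glue[OF mu])
    show "has_orientation k Q (contract_weights A a mu) (contract_fun A a b) (contract_fun A a z)"
      by (rule IH[OF cQ orient_contract[OF assms(1) a assms(2)]])
    show "has_orientation k A mu b (\<lambda>u. z u + (\<Sum>v\<in>V - A. g v u))"
      if "\<And>u v. u \<in> A \<Longrightarrow> v \<in> V - A \<Longrightarrow> \<bar>g v u\<bar> \<le> mu u v \<and> even (g v u - mu u v)"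
        "2 * k dvd (\<Sum>v\<in>V - A. \<Sum>u\<in>A. g v u) + sum z A - sum b A" for g
      by (rule IH[OF cA orient_inside[OF assms(1-3) that]])
  qed
qed

end

subsection \<open>The induction\<close>

context orient
begin

lemma neighbour_exists:
  assumes "x \<in> V" "k \<ge> 2" "V - {x} \<noteq> {}" "roomy k 2 V mu W b {x}" "roomy k 2 V mu W b (V - {x})"
  obtains y where "y \<in> V" "y \<noteq> x" "1 \<le> mu x y"
proof -
  have "\<exists>y\<in>V. y \<noteq> x \<and> 1 \<le> mu x y"
  proof (rule ccontr)
    assume *: "\<not> ?thesis"
    have "mu x v = 0" if "v \<in> V" for v using * that nonneg[of x v] diag[of x] by (cases "v = x") force+
    then have c: "cut_weight V mu {x} = 0" using cut_singleton[OF mu fin assms(1)] by simp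
    have "set_degree V mu W {x} + set_degree V mu W (V - {x}) = set_degree V mu W V"
      using set_degree_compl[of "{x}"] assms(1) c unfolding dgV by (simp add: set_degree_def)
    then have "roomy k 0 V mu W b V"
      by (intro roomy_add[OF assms(4,5)]) (use assms(1,2) fin in \<open>auto simp: sum.remove[of V x]\<close>)
    then show False using tightV by blast
  qed
  then show ?thesis using that by blast
qed

lemma signed_tight_exists:
  assumes "x \<in> V" "k > 0" "roomy k 2 V mu W b {x}" "\<not> roomy k 0 V mu W b {x}"
  obtains q where "\<bar>b x + 2 * k * q\<bar> \<le> k" "set_degree V mu W {x} = \<bar>b x + 2 * k * q\<bar> + 2 * k - 2"
proof -
  obtain p where p: "\<bar>b x + 2 * k * p\<bar> + 2 * k - 2 \<le> set_degree V mu W {x}"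
    using assms(3) unfolding roomy_def by auto
  obtain q where q: "\<bar>b x + 2 * k * q\<bar> \<le> k" using residue_exists[OF assms(2)] by blast
  have "\<bar>b x + 2 * k * q\<bar> \<le> \<bar>(b x + 2 * k * q) + 2 * k * (p - q)\<bar>" by (rule abs_le_shift[OF q])
  also have "(b x + 2 * k * q) + 2 * k * (p - q) = b x + 2 * k * p" by (simp add: algebra_simps)
  finally have "\<bar>b x + 2 * k * q\<bar> + 2 * k - 2 \<le> set_degree V mu W {x}" using p by linarith
  moreover have "set_degree V mu W {x} \<le> \<bar>b x + 2 * k * q\<bar> + 2 * k - 2" using tight_le[of "{x}" q] assms by simp
  ultimately show ?thesis using that[OF q] by linarith
qed

end

text \<open>The third component covers the two reductions that change neither \<open>V\<close> nor
  \<open>mu\<close>: deleting a root edge, and declaring a vertex exempt. Root edges may become more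
  numerous when the mass falls.\<close>

definition orient_measure :: "'v set \<Rightarrow> ('v \<Rightarrow> 'v \<Rightarrow> int) \<Rightarrow> ('v \<Rightarrow> int) \<Rightarrow> 'v set \<Rightarrow> nat \<times> nat \<times> nat" where
  "orient_measure V mu W X = (card V, nat (mass V mu), nat (2 * sum W V) + (if X = {} then 1 else 0))"

abbreviation "orient_order \<equiv> less_than <*lex*> less_than <*lex*> less_than"

text \<open>The situation in which no contraction applies: by \<open>big\<close>, only singletons
  can lack slack, so each reduction has to be checked at singletons alone.\<close>

locale orient_step = orient k V mu b W z X for k and V :: "'v set" and mu b W z X +
  assumes k2: "k \<ge> 2"
    and IH: "\<And>V' mu' b' W' z' X'.
      (orient_measure V' mu' W' X', orient_measure V mu W X) \<in> orient_order \<Longrightarrow>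
      orient k (V' :: 'v set) mu' b' W' z' X' \<Longrightarrow> has_orientation k V' mu' b' z'"
    and two: "card V \<ge> 2"
    and big: "\<And>A. A \<subset> V \<Longrightarrow> 2 \<le> card A \<Longrightarrow> roomy k 0 V mu W b A"
begin

lemma IH_card: "card (V' :: 'v set) < card V \<Longrightarrow> orient k V' mu' b' W' z' X' \<Longrightarrow> has_orientation k V' mu' b' z'"
  by (rule IH) (simp_all add: orient_measure_def)

lemma IH_mass: "mass V mu' < mass V mu \<Longrightarrow> orient k V mu' b' W' z' X' \<Longrightarrow> has_orientation k V mu' b' z'"
proof (rule IH)
  assume "mass V mu' < mass V mu" "orient k V mu' b' W' z' X'"
  moreover from this have "0 \<le> mass V mu'" using mass_nonneg orient.mu by blast
  ultimately show "(orient_measure V mu' W' X', orient_measure V mu W X) \<in> orient_order"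
    by (simp add: orient_measure_def)
qed

lemma big': "A \<subset> V \<Longrightarrow> A \<noteq> {} \<Longrightarrow> (\<And>v. A \<noteq> {v}) \<Longrightarrow> roomy k 0 V mu W b A"
  by (rule big, assumption)
    (metis One_nat_def Suc_leI card_1_singletonE card_gt_0_iff fin finite_subset le_neq_implies_less
      numeral_2_eq_2 psubset_imp_subset)

lemma big_pair: "A \<subset> V \<Longrightarrow> x \<in> A \<Longrightarrow> y \<in> A \<Longrightarrow> x \<noteq> y \<Longrightarrow> roomy k 0 V mu W b A"
  by (rule big') auto

lemma compl_nonempty: "V - {x} \<noteq> {}"
proof
  assume "V - {x} = {}"
  then have "V \<subseteq> {x}" by blast
  then have "card V \<le> 1" using card_mono[of "{x}" V] by simp
  then show False using two by simp
qed

text \<open>With residue zero, \<open>x\<close> can be emptied by splits, root edges first. Each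
  proper set that loses degree contains \<open>x\<close> and another vertex, or both
  \<open>y\<close> and \<open>w\<close>, and so has slack by \<open>big\<close>; the set
  \<open>{x}\<close> is exempt.\<close>

lemma has_orientation_exempt:
  assumes "x \<in> X"
  shows "has_orientation k V mu b z"
proof -
  have xV: "x \<in> V" and X: "X = {x}" using assms XV X1 by blast+
  \<comment> \<open>The first case includes an \<open>x\<close> without any neighbour, for an
    arbitrary other vertex \<open>y\<close>.\<close>
  consider y where "y \<in> V" "y \<noteq> x" "\<And>v. v \<in> V \<Longrightarrow> v \<noteq> y \<Longrightarrow> mu x v = 0"
    | y w where "y \<in> V" "w \<in> V" "y \<noteq> w" "mu x y \<noteq> 0" "mu x w \<noteq> 0"
    using compl_nonempty[of x] diag[of x] by blast
  then show ?thesis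
  proof cases
    case (1 y)
    have "card (V - {x}) < card V" using fin xV by (rule card_Diff1_less)
    from IH_card[OF this orient_drop_pendant[OF assms 1]] show ?thesis
      using has_orientation_drop_pendant[OF assms 1] k2 by simp
  next
    case (2 y w)
    then have yw: "1 \<le> mu x y" "1 \<le> mu x w" "x \<noteq> y" "x \<noteq> w"
      using nonneg[of x y] nonneg[of x w] diag[of x] by force+
    have out: "roomy k 0 V mu W b A" if "A \<noteq> {}" "A \<subset> V" "\<And>v. v \<in> X \<Longrightarrow> A \<noteq> {v}" "x \<in> A" for A
      using that X by (intro big') auto
    show ?thesis
    proof (cases "W x = 0")
      case True
      have "orient k V (lift mu x y w) b W z X"
      proof (rule orient_lift[OF xV 2(1,2) yw(3,4) yw(1,2)])
        fix A assume "A \<noteq> {}" "A \<subset> V" "\<And>v. v \<in> X \<Longrightarrow> A \<noteq> {v}"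
          "x \<in> A \<and> y \<notin> A \<and> w \<notin> A \<or> x \<notin> A \<and> y \<in> A \<and> w \<in> A"
        then show "roomy k 0 V mu W b A" using out big_pair[of A y w] 2(3) by blast
      qed (use X True 2(3) in auto)
      from IH_mass[OF mass_lift[OF fin xV 2(1,2) yw(3,4)] this]
      show ?thesis by (rule has_orientation_lift[OF fin xV 2(1,2) yw(3,4) weights_lift(1)[OF mu yw(1,2)], rotated]) (use 2(3) in auto)
    next
      case False
      then have "1 \<le> W x" using W_nonneg[OF xV] by linarith
      from root_edge_direction[OF this zW[OF xV] zW_even[OF xV]]
      obtain \<delta> :: int where \<delta>: "\<delta> = 1 \<or> \<delta> = -1" "\<bar>z x - \<delta>\<bar> \<le> W x - 1" .
      have "orient k V (remove_edge mu x y) b (bump (bump W x (-1)) y 1) (bump (bump z x (-\<delta>)) y \<delta>) X"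
        by (rule orient_root_lift[OF xV 2(1) yw(3,1) \<delta>]) (use X out in auto)
      from IH_mass[OF mass_remove_edge[OF fin xV 2(1) yw(3)] this]
      show ?thesis by (rule has_orientation_root_lift[OF fin xV 2(1) \<delta>(1)])
    qed
  qed
qed

lemma room2:
  assumes "X = {}" "A \<noteq> {}" "A \<subset> V"
  shows "roomy k 2 V mu W b A"
  using cond[OF assms(2,3)] assms(1) by blast

lemma neighbour:
  assumes "X = {}" "x \<in> V"
  obtains y where "y \<in> V" "y \<noteq> x" "1 \<le> mu x y"
proof -
  have "{x} \<subset> V" "V - {x} \<subset> V" using compl_nonempty[of x] assms(2) by blast+
  then have "roomy k 2 V mu W b {x}" "roomy k 2 V mu W b (V - {x})"
    using room2[OF assms(1)] compl_nonempty[of x] by simp_all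
  from neighbour_exists[OF assms(2) k2 compl_nonempty this] show ?thesis using that by metis
qed

text \<open>Slack at \<open>{x}\<close> admits one split at \<open>x\<close>. The only other
  singleton that can lose degree is \<open>{y}\<close>, when two parallel edges to the same
  \<open>y\<close> are removed.\<close>

lemma has_orientation_roomy_vertex:
  assumes X: "X = {}" and xV: "x \<in> V" and r: "roomy k 0 V mu W b {x}"
  shows "has_orientation k V mu b z"
proof -
  obtain y where y: "y \<in> V" "y \<noteq> x" "1 \<le> mu x y" using neighbour[OF X xV] by blast
  have out: "roomy k 0 V mu W b A" if A: "A \<noteq> {}" "A \<subset> V" "x \<in> A" for A
  proof (cases "A = {x}")
    case False
    then obtain v where v: "v \<in> A" "v \<noteq> x" using A by blast
    show ?thesis by (rule big_pair[OF A(2) v(1) A(3) v(2)])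
  qed (use r in simp)
  consider "W x \<noteq> 0" | "W x = 0" "card V = 2" | "W x = 0" "card V \<noteq> 2" by blast
  then show ?thesis
  proof cases
    case 1
    then have "1 \<le> W x" using W_nonneg[OF xV] by linarith
    from root_edge_direction[OF this zW[OF xV] zW_even[OF xV]]
    obtain \<delta> :: int where \<delta>: "\<delta> = 1 \<or> \<delta> = -1" "\<bar>z x - \<delta>\<bar> \<le> W x - 1" .
    have "orient k V (remove_edge mu x y) b (bump (bump W x (-1)) y 1) (bump (bump z x (-\<delta>)) y \<delta>) X"
      by (rule orient_root_lift[OF xV y(1) y(2)[symmetric] y(3) \<delta>]) (use X out in auto)
    from IH_mass[OF mass_remove_edge[OF fin xV y(1) y(2)[symmetric]] this]
    show ?thesis by (rule has_orientation_root_lift[OF fin xV y(1) \<delta>(1)])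
  next
    \<comment> \<open>Here \<open>{x, y}\<close> is not a proper subset, so nothing would protect
      \<open>{y}\<close> against a split; the instance is solved directly.\<close>
    case 2
    have "card {x, y} = 2" "{x, y} \<subseteq> V" using xV y by simp_all
    then have V: "V = {x, y}" using card_subset_eq[OF fin] 2(2) by metis
    have "roomy k 2 V mu W b {x}" by (rule room2[OF X]) (use V y(2) in auto)
    then show ?thesis by (intro has_orientation_two_vertices[OF V y(2)[symmetric] _ 2(1)]) (use k2 in simp_all)
  next
    case 3
    obtain w where w: "w \<in> V" "w \<noteq> x" "1 \<le> mu x w" "y = w \<Longrightarrow> 2 \<le> mu x y \<and> (\<forall>v\<in>V. v \<noteq> y \<longrightarrow> mu x v = 0)"
    proof (cases "\<exists>w\<in>V. w \<noteq> y \<and> mu x w \<noteq> 0")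
      case True
      then obtain w where w: "w \<in> V" "w \<noteq> y" "mu x w \<noteq> 0" by blast
      then have "w \<noteq> x" "1 \<le> mu x w" using nonneg[of x w] diag[of x] by auto
      then show ?thesis using w by (intro that[of w]) simp_all
    next
      case False
      then have "cut_weight V mu {x} = mu x y"
        using cut_singleton[OF mu fin xV] sum_pair_support[OF fin y(1), of "mu x"] by auto
      moreover have "2 * k \<le> set_degree V mu W {x}" using r by (auto simp: roomy_def)
      ultimately have "2 \<le> mu x y" using 3(1) k2 by (simp add: set_degree_def)
      moreover have "\<forall>v\<in>V. v \<noteq> y \<longrightarrow> mu x v = 0" using False by blast
      ultimately have "2 \<le> mu x y \<and> (\<forall>v\<in>V. v \<noteq> y \<longrightarrow> mu x v = 0)" by blast
      then show ?thesis by (rule that[OF y])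
    qed
    have "orient k V (lift mu x y w) b W z X"
    proof (rule orient_lift[OF xV y(1) w(1) y(2)[symmetric] w(2)[symmetric] y(3) w(3)])
      fix A assume A: "A \<noteq> {}" "A \<subset> V" "x \<in> A \<and> y \<notin> A \<and> w \<notin> A \<or> x \<notin> A \<and> y \<in> A \<and> w \<in> A"
      show "roomy k 0 V mu W b A"
      proof (cases "A = {y}")
        case False
        show ?thesis
        proof (cases "x \<in> A")
          case False
          then have y: "y \<in> A" using A(3) by blast
          then obtain v where v: "v \<in> A" "v \<noteq> y" using \<open>A \<noteq> {y}\<close> by blast
          show ?thesis by (rule big_pair[OF A(2) v(1) y v(2)])
        qed (rule out[OF A(1,2)])
      next
        case True
        \<comment> \<open>All edges at \<open>x\<close> go to \<open>y\<close>, so the degree of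
          \<open>{y}\<close> is the sum of those of \<open>{x, y}\<close> and \<open>{x}\<close>.
          Both are roomy, the former by \<open>big\<close> because a third vertex exists, and the
          residue of \<open>y\<close> is the difference of theirs.\<close>
        then have "y = w" using A(3) y(2) by auto
        have nbr: "mu x v = 0" if "v \<in> V" "v \<noteq> y" for v using w(4)[OF \<open>y = w\<close>] that by blast
        have "card {x, y} = 2" using y(2) by simp
        then have "{x, y} \<noteq> V" using 3(2) by blast
        then have xy: "{x, y} \<subset> V" using xV y by blast
        have "roomy k 0 V mu W b {x, y}" using big_pair[OF xy, of x y] y(2) by blast
        then obtain q where q: "\<bar>b x + b y + 2 * k * q\<bar> + 2 * k \<le> set_degree V mu W {x, y}"
          unfolding roomy_def using y(2) by auto
        obtain p where p: "\<bar>b x + 2 * k * p\<bar> + 2 * k \<le> set_degree V mu W {x}"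
          using r unfolding roomy_def by auto
        have dx: "set_degree V mu W {x} = mu x y"
          using cut_singleton[OF mu fin xV] sum_pair_support[OF fin y(1), of "mu x"] nbr 3(1) by (simp add: set_degree_def)
        have "(\<Sum>v\<in>V. mu y v) = mu y x + (\<Sum>v\<in>V - {x}. mu y v)" by (rule sum.remove[OF fin xV])
        also have "(\<Sum>v\<in>V - {x}. mu y v) = mu y y + (\<Sum>v\<in>V - {x, y}. mu y v)"
        proof -
          have "V - {x} - {y} = V - {x, y}" "finite (V - {x})" "y \<in> V - {x}" using fin y by auto
          then show ?thesis using sum.remove[of "V - {x}" y "mu y"] by metis
        qed
        finally have "cut_weight V mu {y} = mu x y + (\<Sum>v\<in>V - {x, y}. mu y v)"
          using cut_singleton[OF mu fin y(1)] diag[of y] sym[of x y] by simp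
        moreover have "cut_weight V mu {x, y} = (\<Sum>v\<in>V - {x, y}. mu y v)"
          using nbr y(2) by (simp add: cut_weight_def)
        ultimately have dy: "set_degree V mu W {y} = set_degree V mu W {x, y} + mu x y"
          using 3(1) y(2) by (simp add: set_degree_def)
        have "b y + 2 * k * (q - p) = (b x + b y + 2 * k * q) - (b x + 2 * k * p)"
          by (simp add: algebra_simps)
        then have "\<bar>sum b {y} + 2 * k * (q - p)\<bar> + 2 * k - 0 \<le> set_degree V mu W {y}"
          using p q dx dy k2 by simp
        then show ?thesis unfolding True roomy_def by blast
      qed
    qed (use X w(4) in simp_all)
    from IH_mass[OF mass_lift[OF fin xV y(1) w(1) y(2)[symmetric] w(2)[symmetric]] this]
    show ?thesis
      by (rule has_orientation_lift[OF fin xV y(1) w(1) y(2)[symmetric] w(2)[symmetric] weights_lift(1)[OF mu y(3) w(3)], rotated])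
        (use w(4) in simp_all)
  qed
qed

end

context orient_step
begin

text \<open>Arguing by contradiction turns each reduction into a structural fact: no residue is
  zero, no edge joins opposite signs, and root edges oppose the sign of their vertex. What survives
  has a single sign and is handled by the exchange.\<close>

lemma has_orientation_tight_vertices:
  assumes X: "X = {}" and tight: "\<And>x. x \<in> V \<Longrightarrow> \<not> roomy k 0 V mu W b {x}"
  shows "has_orientation k V mu b z"
proof (rule ccontr)
  assume no: "\<not> has_orientation k V mu b z"
  have sub: "{x} \<subset> V" "V - {x} \<subset> V" if "x \<in> V" for x
    using compl_nonempty[of x] that by blast+
  have r2: "roomy k 2 V mu W b {x}" if "x \<in> V" for x using room2[OF X _ sub(1)[OF that]] by blast
  have "\<exists>q. \<bar>b x + 2 * k * q\<bar> \<le> k \<and> set_degree V mu W {x} = \<bar>b x + 2 * k * q\<bar> + 2 * k - 2" if "x \<in> V" for x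
  proof -
    have "k > 0" using k2 by simp
    from signed_tight_exists[OF that this r2[OF that] tight[OF that]] show ?thesis by metis
  qed
  then obtain q where "\<And>x. x \<in> V \<Longrightarrow> \<bar>b x + 2 * k * q x\<bar> \<le> k \<and> set_degree V mu W {x} = \<bar>b x + 2 * k * q x\<bar> + 2 * k - 2"
    by metis
  moreover define t where "t x = b x + 2 * k * q x" for x
  ultimately have t: "\<bar>t x\<bar> \<le> k" "set_degree V mu W {x} = \<bar>t x\<bar> + 2 * k - 2" if "x \<in> V" for x
    using that by auto
  have big1: "roomy k 0 V mu W b A" if "A \<subset> V" "A \<noteq> {}" "\<And>v. v \<in> V \<Longrightarrow> A \<noteq> {v}" for A
    by (rule big') (use that in auto)

  have sum_b: "sum b V = b x + sum b (V - {x})" "sum W V = W x + sum W (V - {x})" if "x \<in> V" for x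
    by (rule sum.remove[OF fin that])+
  have dgc: "set_degree V mu W (V - {x}) = set_degree V mu W {x} - 2 * W x + sum W V" if "x \<in> V" for x
    using set_degree_compl[of "{x}"] that by (simp add: set_degree_def)

  have pos: "signed_tight k V mu W b \<sigma> x" if "x \<in> V" "1 \<le> \<sigma> * t x" "\<sigma> = 1 \<or> \<sigma> = -1" for x \<sigma>
    unfolding signed_tight_def using that t[of x] unfolding t_def by (intro exI[of _ "q x"]) auto
  \<comment> \<open>\<open>k\<close> and \<open>- k\<close> represent the same class.\<close>
  have both: "signed_tight k V mu W b \<sigma> x" if "x \<in> V" "\<bar>t x\<bar> = k" "\<sigma> = 1 \<or> \<sigma> = -1" for x \<sigma>
  proof (cases "\<sigma> * t x = k")
    case True
    then show ?thesis using pos[OF that(1) _ that(3)] k2 by simp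
  next
    case False
    then have *: "\<sigma> * t x = - k" using that by auto
    have "\<sigma> * (b x + 2 * k * (q x + \<sigma>)) = \<sigma> * t x + 2 * k * (\<sigma> * \<sigma>)"
      unfolding t_def by (simp add: algebra_simps)
    also have "\<sigma> * \<sigma> = 1" using that(3) by auto
    finally have "\<sigma> * (b x + 2 * k * (q x + \<sigma>)) = k" using * by simp
    then show ?thesis unfolding signed_tight_def using t(2)[OF that(1)] that(2) k2
      by (intro exI[of _ "q x + \<sigma>"]) simp
  qed

  \<comment> \<open>A vertex of residue zero would be made exempt. The required bound on
    \<open>2 * W x\<close> comes from comparing the tight \<open>V\<close> with
    \<open>V - {x}\<close>, which has the same residue.\<close>
  have nz: "t x \<noteq> 0" if x: "x \<in> V" for x
  proof
    assume t0: "t x = 0"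
    have "b x = 2 * k * (- q x)" using t0 unfolding t_def by simp
    then have bx: "2 * k dvd b x" by (metis dvd_triv_left)
    have "roomy k 2 V mu W b (V - {x})" using room2[OF X compl_nonempty sub(2)[OF x]] .
    then obtain p where p: "\<bar>sum b (V - {x}) + 2 * k * p\<bar> + 2 * k - 2 \<le> set_degree V mu W (V - {x})"
      unfolding roomy_def by auto
    have "sum b V + 2 * k * (p + q x) = sum b (V - {x}) + 2 * k * p"
      using t0 sum_b(1)[OF x] unfolding t_def by (simp add: algebra_simps)
    then have "sum W V \<le> set_degree V mu W (V - {x})"
      using tight_le[of V "p + q x"] tightV p dgV by simp
    then have W: "2 * W x \<le> set_degree V mu W {x}" using dgc[OF x] by linarith
    have "orient k V mu b W z {x}"
    proof
      show "roomy k 2 V mu W b A" if "A \<noteq> {}" "A \<subset> V" for A using room2[OF X that] .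
    qed (use fin mu zW zW_even par total tightV x bx W in auto)
    moreover have "(orient_measure V mu W {x}, orient_measure V mu W X) \<in> orient_order"
      using X by (simp add: orient_measure_def)
    ultimately show False using IH no by blast
  qed

  have no_edge: False if xy: "x \<in> V" "y \<in> V" "x \<noteq> y" "1 \<le> mu x y"
    and s: "signed_tight k V mu W b 1 x" "signed_tight k V mu W b (-1) y" for x y
  proof -
    have "orient k V (remove_edge mu x y) (bump (bump b x (-1)) y 1) W z {}"
      by (rule orient_delete_edge[OF xy X s]) (rule big1, auto)
    from IH_mass[OF mass_remove_edge[OF fin xy(1-3)] this]
    have "has_orientation k V mu b z" by (rule has_orientation_delete_edge[OF fin xy(1-3) s])
    with no show False ..
  qed

  \<comment> \<open>Otherwise some root edge at \<open>x\<close> has direction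
    \<open>\<sigma>\<close> and could be deleted.\<close>
  have root: "z x = - \<sigma> * W x" if x: "x \<in> V" and s: "signed_tight k V mu W b \<sigma> x" and \<sigma>: "\<sigma> = 1 \<or> \<sigma> = -1" for x \<sigma>
  proof (rule ccontr)
    assume n: "\<not> ?thesis"
    have d: "\<bar>z x - \<sigma>\<bar> \<le> W x - 1"
    proof -
      have "z x \<noteq> - \<sigma> * W x" using n .
      then show ?thesis using zW[OF x] zW_even[OF x] \<sigma> by (auto simp: abs_le_iff) presburger+
    qed
    have "orient k V mu (bump b x (-\<sigma>)) (bump W x (-1)) (bump z x (-\<sigma>)) {}"
      by (rule orient_delete_root_edge[OF x \<sigma> d X s]) (rule big1, auto)
    moreover have "(orient_measure V mu (bump W x (-1)) {}, orient_measure V mu W X) \<in> orient_order"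
    proof -
      have "sum (bump W x (-1)) V = sum W V - 1" using fin x by (simp add: sum_bump)
      moreover have "1 \<le> W x" using d by linarith
      then have "1 \<le> sum W V" using member_le_sum[of x V W] x W_nonneg fin by force
      ultimately show ?thesis using X by (simp add: orient_measure_def)
    qed
    ultimately have "has_orientation k V mu (bump b x (-\<sigma>)) (bump z x (-\<sigma>))" using IH by blast
    then have "has_orientation k V mu b z" by (rule has_orientation_delete_root_edge[OF \<sigma> s])
    with no show False ..
  qed

  \<comment> \<open>If both signs occurred, the positive and the negative vertices would form two
    parts with no edge between them, making \<open>V\<close> roomy.\<close>
  obtain \<sigma> :: int where \<sigma>: "\<sigma> = 1 \<or> \<sigma> = -1" and all: "\<And>x. x \<in> V \<Longrightarrow> 1 \<le> \<sigma> * t x"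
  proof -
    define P where "P = {x \<in> V. 0 < t x}"
    have PV: "P \<subseteq> V" unfolding P_def by blast
    have neg: "t x < 0" if "x \<in> V - P" for x using nz[of x] that unfolding P_def by auto
    consider "P = V" | "P = {}" | "P \<noteq> {}" "P \<subset> V" using PV by blast
    then show ?thesis
    proof cases
      case 1
      then show ?thesis using that[of 1] unfolding P_def by force
    next
      case 2
      then show ?thesis using that[of "-1"] neg by force
    next
      case 3
      have "mu x y = 0" if "x \<in> P" "y \<in> V - P" for x y
      proof (rule ccontr)
        assume "mu x y \<noteq> 0"
        then have "1 \<le> mu x y" using nonneg[of x y] by linarith
        moreover have "signed_tight k V mu W b 1 x" using pos[of x 1] that unfolding P_def by force
        moreover have "signed_tight k V mu W b (-1) y" using pos[of y "-1"] that neg[of y] by force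
        ultimately show False using no_edge[of x y] that PV by auto
      qed
      then have "cut_weight V mu P = 0" unfolding cut_weight_def by (intro sum.neutral ballI) auto
      then have d: "set_degree V mu W P + set_degree V mu W (V - P) = sum W V"
        using set_degree_compl[OF PV] by (simp add: set_degree_def)
      have "V - P \<noteq> {}" "V - P \<subset> V" using 3 by blast+
      then have r: "roomy k 2 V mu W b P" "roomy k 2 V mu W b (V - P)" 
        by (simp_all add: room2[OF X 3] room2[OF X])
      have "sum b V = sum b P + sum b (V - P)" using sum.subset_diff[OF PV fin, of b] by simp
      then have "roomy k 0 V mu W b V" by (intro roomy_add[OF r]) (use d dgV k2 in auto)
      then show ?thesis using tightV by blast
    qed
  qed
  have tight_all: "signed_tight k V mu W b \<sigma> x" if "x \<in> V" for x using pos[OF that all[OF that] \<sigma>] .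
  have z: "z x = - \<sigma> * W x" if "x \<in> V" for x using root[OF that tight_all[OF that] \<sigma>] .
  obtain x where x: "x \<in> V" "1 \<le> W x"
  proof -
    \<comment> \<open>Without root edges a set and its complement have equal degrees and opposite
      residues, so the slack of \<open>V - {v}\<close> passes to \<open>{v}\<close>, which is tight.
      Two vertices are again a direct case.\<close>
    have "\<exists>x\<in>V. W x \<noteq> 0"
    proof (rule ccontr)
      assume "\<not> ?thesis"
      then have W0: "W v = 0" if "v \<in> V" for v using that by blast
      then have sW: "sum W V = 0" and zV: "sum z V = 0" using z by simp_all
      have "V \<noteq> {}" using two by auto
      then obtain v where v: "v \<in> V" by blast
      show False
      proof (cases "card V = 2")
        case True
        obtain y where "V = {v, y}" "v \<noteq> y"
          using True v unfolding card_2_iff by (metis doubleton_eq_iff insert_iff singletonD)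
        from has_orientation_two_vertices[OF this _ W0[OF v] r2[OF v]] k2 no show False by simp
      next
        case False
        have "card (V - {v}) = card V - 1" using v fin by simp
        then have "2 \<le> card (V - {v})" using False two by linarith
        then have "roomy k 0 V mu W b (V - {v})" by (rule big[OF sub(2)[OF v]])
        then obtain p where p: "\<bar>sum b (V - {v}) + 2 * k * p\<bar> + 2 * k \<le> set_degree V mu W (V - {v})"
          unfolding roomy_def by auto
        obtain c where c: "sum b V = 2 * k * c" using total zV by auto
        have "b v + 2 * k * (- p - c) = - (sum b (V - {v}) + 2 * k * p)"
          using c sum_b(1)[OF v] by (simp add: algebra_simps)
        then have "\<bar>sum b {v} + 2 * k * (- p - c)\<bar> + 2 * k - 0 \<le> set_degree V mu W {v}"
          using p dgc[OF v] W0[OF v] sW by simp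
        then show False using tight[OF v] unfolding roomy_def by blast
      qed
    qed
    then show ?thesis using that W_nonneg by force
  qed
  \<comment> \<open>A residue of \<open>k\<close> counts for both signs, and \<open>root\<close>
    would then force the root edges at \<open>x\<close> to point both ways.\<close>
  have tx: "\<sigma> * t x < k"
  proof (rule ccontr)
    assume "\<not> ?thesis"
    then have "\<bar>t x\<bar> = k" using t(1)[OF x(1)] \<sigma> by auto
    then have "z x = - (- \<sigma>) * W x" by (intro root[OF x(1) both[OF x(1)]]) (use \<sigma> in auto)
    then show False using z[OF x(1)] x(2) \<sigma> by auto
  qed
  obtain y where y: "y \<in> V" "y \<noteq> x" "1 \<le> mu x y" using neighbour[OF X x(1)] by blast
  \<comment> \<open>The exchange flips the sign of \<open>x\<close>, which makes its edge to the
    neighbour \<open>y\<close> one between opposite signs.\<close>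
  have "orient k V (remove_edge mu x y) (bump (bump b x (\<sigma> * (k + 1))) y (-\<sigma>))
      (bump W x (k - 2)) (bump z x (\<sigma> * k)) {}"
  proof (rule orient_exchange[OF x(1) y(1) y(2)[symmetric] y(3) X k2 \<sigma>])
    show "1 \<le> \<sigma> * (b x + 2 * k * q x)" "\<sigma> * (b x + 2 * k * q x) < k"
      using all[OF x(1)] tx unfolding t_def by auto
    show "\<sigma> * (b x + 2 * k * q x) + 2 * k - 2 \<le> set_degree V mu W {x}"
      using t(2)[OF x(1)] \<sigma> all[OF x(1)] unfolding t_def by auto
    fix A assume A: "A \<subset> V" "A \<noteq> {}" "A \<noteq> {x}" "A \<noteq> {y}" "x \<in> A \<or> y \<in> A"
    show "roomy k 0 V mu W b A" by (rule big1[OF A(1,2)]) (use A in auto)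
  qed (use tight_all[OF y(1)] z x in auto)
  from IH_mass[OF mass_remove_edge[OF fin x(1) y(1) y(2)[symmetric]] this]
  have "has_orientation k V mu b z"
    by (rule has_orientation_exchange[OF fin x(1) y(1) y(2)[symmetric] \<sigma>, rotated 3])
      (use all[OF x(1)] tx tight_all[OF y(1)] in \<open>auto simp: t_def\<close>)
  with no show False ..
qed

end

theorem orient_solution:
  fixes V :: "'v set"
  assumes "orient k V mu b W z X" "k \<ge> 2"
  shows "has_orientation k V mu b z"
proof -
  have "wf (orient_order :: ((nat \<times> nat \<times> nat) \<times> nat \<times> nat \<times> nat) set)" by (intro wf_lex_prod wf_less_than)
  then show ?thesis using assms(1)
  proof (induction "orient_measure V mu W X" arbitrary: V mu b W z X rule: wf_induct_rule)
    case less
    interpret orient k V mu b W z X by (rule less.prems)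
    show ?case
    proof (cases "card V \<le> 1")
      case True
      then show ?thesis by (rule has_orientation_card_le_1)
    next
      case False
      show ?thesis
      proof (cases "\<exists>A. A \<subset> V \<and> 2 \<le> card A \<and> \<not> roomy k 0 V mu W b A")
        case True
        then obtain A where A: "A \<subset> V" "2 \<le> card A" "\<not> roomy k 0 V mu W b A" by blast
        show ?thesis
        proof (rule has_orientation_by_contraction[OF A])
          fix V' :: "'v set" and mu' b' W' z' X'
          assume "card V' < card V" "orient k V' mu' b' W' z' X'"
          then show "has_orientation k V' mu' b' z'"
            by (intro less.hyps[OF _ \<open>orient k V' mu' b' W' z' X'\<close>]) (simp add: orient_measure_def)
        qed
      next
        case noA: False
        interpret orient_step k V mu b W z X
        proof
          show "has_orientation k V' mu' b' z'"
            if "(orient_measure V' mu' W' X', orient_measure V mu W X) \<in> orient_order" "orient k V' mu' b' W' z' X'"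
            for V' :: "'v set" and mu' b' W' z' X' using less.hyps[OF that] .
        qed (use noA False assms(2) in auto)
        consider x where "x \<in> X" | x where "X = {}" "x \<in> V" "roomy k 0 V mu W b {x}"
          | "X = {}" "\<And>x. x \<in> V \<Longrightarrow> \<not> roomy k 0 V mu W b {x}" by blast
        then show ?thesis using has_orientation_exempt has_orientation_roomy_vertex has_orientation_tight_vertices by cases blast+
      qed
    qed
  qed
qed

subsection \<open>Edges inside the two sides\<close>

definition inc :: "('e \<Rightarrow> 'v) \<Rightarrow> ('e \<Rightarrow> 'v) \<Rightarrow> 'e \<Rightarrow> 'v \<Rightarrow> int" where
  "inc p q e v = at_vertex (p e) v + at_vertex (q e) v"

abbreviation sign :: "int \<Rightarrow> bool" where
  "sign s \<equiv> s = 1 \<or> s = -1"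

lemma weights_add: "weights mu \<Longrightarrow> weights nu \<Longrightarrow> weights (\<lambda>u v. mu u v + nu u v)"
  unfolding weights_def by (metis add_nonneg_nonneg add_0)

lemma net_split_unit_edge:
  assumes "weights mu" "finite V" "y \<in> V" "w \<in> V" "flow V (\<lambda>u v. mu u v + unit_edge y w u v) \<phi>"
  obtains \<delta> \<psi> where "sign \<delta>" "flow V mu \<psi>"
    "\<And>v. (\<Sum>u\<in>V. \<phi> v u) = (\<Sum>u\<in>V. \<psi> v u) + \<delta> * (at_vertex y v - at_vertex w v)"
proof -
  obtain \<delta> where \<delta>: "sign \<delta>" "flow V mu (\<lambda>u v. \<phi> u v - \<delta> * unit_arc y w u v)"
    using flow_split_unit_edge[OF assms(1,3,4,5)] by blast
  have "(\<Sum>u\<in>V. \<phi> v u - \<delta> * unit_arc y w v u) = (\<Sum>u\<in>V. \<phi> v u) - \<delta> * (\<Sum>u\<in>V. unit_arc y w v u)" for v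
    by (simp only: sum_subtractf sum_distrib_left)
  then have "(\<Sum>u\<in>V. \<phi> v u) = (\<Sum>u\<in>V. \<phi> v u - \<delta> * unit_arc y w v u) + \<delta> * (at_vertex y v - at_vertex w v)" for v
    unfolding sum_unit_arc[OF assms(2-4)] by simp
  from that[OF \<delta> this] show ?thesis .
qed

lemma weights_sum_unit_edge: "finite C \<Longrightarrow> weights (\<lambda>u v. \<Sum>e\<in>C. unit_edge (p e) (q e) u v)"
proof (induction C rule: finite_induct)
  case (insert e C)
  then show ?case using weights_add[OF weights_unit_edge insert.IH] by simp
qed (simp add: weights_def)

lemma decompose_flow:
  assumes "finite C" "finite V" "weights nu" "\<And>e. e \<in> C \<Longrightarrow> p e \<in> V \<and> q e \<in> V"
    and "flow V (\<lambda>u v. nu u v + (\<Sum>e\<in>C. unit_edge (p e) (q e) u v)) \<phi>"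
  shows "\<exists>\<epsilon> \<psi>. (\<forall>e. sign (\<epsilon> e)) \<and> flow V nu \<psi> \<and>
    (\<forall>v. (\<Sum>u\<in>V. \<phi> v u) = (\<Sum>u\<in>V. \<psi> v u) + (\<Sum>e\<in>C. \<epsilon> e * (at_vertex (p e) v - at_vertex (q e) v)))"
  using assms(1,4,5)
proof (induction C arbitrary: \<phi> rule: finite_induct)
  case empty
  then show ?case by (intro exI[of _ "\<lambda>_. 1"] exI[of _ \<phi>]) simp
next
  case (insert e C)
  let ?mu = "\<lambda>u v. nu u v + (\<Sum>e\<in>C. unit_edge (p e) (q e) u v)"
  have w: "weights ?mu" by (rule weights_add[OF assms(3) weights_sum_unit_edge[OF insert.hyps(1)]])
  have "flow V (\<lambda>u v. ?mu u v + unit_edge (p e) (q e) u v) \<phi>" using insert.prems(2) insert.hyps by (simp add: algebra_simps)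
  from net_split_unit_edge[OF w assms(2) _ _ this] obtain \<delta> \<phi>' where \<delta>: "sign \<delta>" "flow V ?mu \<phi>'"
    "\<And>v. (\<Sum>u\<in>V. \<phi> v u) = (\<Sum>u\<in>V. \<phi>' v u) + \<delta> * (at_vertex (p e) v - at_vertex (q e) v)"
    using insert.prems(1) by blast
  obtain \<epsilon> \<psi> where \<epsilon>: "\<forall>e. sign (\<epsilon> e)" "flow V nu \<psi>"
    "\<And>v. (\<Sum>u\<in>V. \<phi>' v u) = (\<Sum>u\<in>V. \<psi> v u) + (\<Sum>e\<in>C. \<epsilon> e * (at_vertex (p e) v - at_vertex (q e) v))"
    using insert.IH[OF _ \<delta>(2)] insert.prems(1) by blast
  show ?case
  proof (intro exI conjI allI)
    fix e' show "sign ((\<epsilon>(e := \<delta>)) e')" using \<delta>(1) \<epsilon>(1) by simp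
  next
    show "flow V nu \<psi>" by (rule \<epsilon>(2))
  next
    fix v
    have "(\<Sum>e'\<in>C. (\<epsilon>(e := \<delta>)) e' * (at_vertex (p e') v - at_vertex (q e') v))
      = (\<Sum>e'\<in>C. \<epsilon> e' * (at_vertex (p e') v - at_vertex (q e') v))"
      using insert.hyps(2) by (intro sum.cong) auto
    then show "(\<Sum>u\<in>V. \<phi> v u) = (\<Sum>u\<in>V. \<psi> v u)
        + (\<Sum>e'\<in>insert e C. (\<epsilon>(e := \<delta>)) e' * (at_vertex (p e') v - at_vertex (q e') v))"
      unfolding \<delta>(3) \<epsilon>(3) using insert.hyps by simp
  qed
qed

lemma inc_ends:
  assumes "v \<in> {p e, q e}"
  obtains u where "u \<in> {p e, q e}" "inc p q e = (\<lambda>x. at_vertex v x + at_vertex u x)"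
proof (cases "v = p e")
  case True
  then show ?thesis using that[of "q e"] by (simp add: inc_def fun_eq_iff)
next
  case False
  then have "v = q e" using assms by simp
  then show ?thesis using that[of "p e"] by (simp add: inc_def fun_eq_iff)
qed

text \<open>
  Two edges \<open>v u\<close> and \<open>v w\<close> with a common end and opposite signs act on the degrees like one arc
  between \<open>u\<close> and \<open>w\<close>, in either direction.
\<close>

lemma pair_adjacent_edges:
  assumes "finite V" "finite J" "p ` J \<union> q ` J \<subseteq> V"
  shows "\<exists>nu M. weights nu \<and> M \<subseteq> J \<and> even (card J + card M) \<and>
    (\<forall>e\<in>M. \<forall>e'\<in>M. e \<noteq> e' \<longrightarrow> {p e, q e} \<inter> {p e', q e'} = {}) \<and>
    (\<forall>v\<in>V. even ((\<Sum>e\<in>J. inc p q e v) - (\<Sum>u\<in>V. nu v u) - (\<Sum>e\<in>M. inc p q e v))) \<and>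
    (\<forall>\<phi> \<eta>. flow V nu \<phi> \<longrightarrow> (\<forall>e. sign (\<eta> e)) \<longrightarrow> (\<exists>\<epsilon>. (\<forall>e. sign (\<epsilon> e)) \<and>
      (\<forall>v\<in>V. (\<Sum>e\<in>J. \<epsilon> e * inc p q e v) = (\<Sum>u\<in>V. \<phi> v u) + (\<Sum>e\<in>M. \<eta> e * inc p q e v))))"
  (is "\<exists>nu M. ?P J nu M")
  using assms(2,3)
proof (induction J rule: measure_induct_rule[of card])
  case (less J)
  show ?case
  proof (cases "\<forall>e\<in>J. \<forall>e'\<in>J. e \<noteq> e' \<longrightarrow> {p e, q e} \<inter> {p e', q e'} = {}")
    case True
    have z: "weights (\<lambda>_ _. 0)" by (simp add: weights_def)
    have "(\<Sum>u\<in>V. \<phi> v u) = 0" if "flow V (\<lambda>_ _. 0) \<phi>" "v \<in> V" for \<phi> v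
    proof (rule sum.neutral, rule ballI)
      fix u assume "u \<in> V"
      then have "\<bar>\<phi> v u\<bar> \<le> 0" using that unfolding flow_def by blast
      then show "\<phi> v u = 0" by simp
    qed
    then have "?P J (\<lambda>_ _. 0) J" using True z by auto
    then show ?thesis by blast
  next
    case False
    then obtain e e' v where e: "e \<in> J" "e' \<in> J" "e \<noteq> e'" "v \<in> {p e, q e}" "v \<in> {p e', q e'}" by blast
    obtain u where u: "u \<in> {p e, q e}" "inc p q e = (\<lambda>x. at_vertex v x + at_vertex u x)"
      by (rule inc_ends[of v p e q, OF e(4)])
    obtain w where w: "w \<in> {p e', q e'}" "inc p q e' = (\<lambda>x. at_vertex v x + at_vertex w x)"
      by (rule inc_ends[of v p e' q, OF e(5)])
    have uw: "u \<in> V" "w \<in> V" using less.prems(2) e u(1) w(1) by auto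
    define J' where "J' = J - {e, e'}"
    have J': "J = insert e (insert e' J')" "e \<notin> insert e' J'" "e' \<notin> J'" "finite J'"
      using e less.prems(1) unfolding J'_def by auto
    have sumJ: "(\<Sum>e\<in>J. f e) = f e + f e' + (\<Sum>e\<in>J'. f e)" for f :: "_ \<Rightarrow> int"
      unfolding J'(1) using J' by simp
    have cJ: "card J = card J' + 2" unfolding J'(1) using J' by simp
    obtain nu M where nM: "?P J' nu M"
    proof -
      have "p ` J' \<union> q ` J' \<subseteq> V" using less.prems(2) unfolding J'_def by blast
      with less.IH[of J'] cJ J'(4) show ?thesis using that by auto
    qed
    \<comment> \<open>If \<open>u = w\<close>, the added edge is zero: the two opposite signs then
      cancel at every vertex.\<close>
    let ?nu = "\<lambda>a b. nu a b + unit_edge u w a b"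
    have wnu: "weights nu" and MJ: "M \<subseteq> J'" using nM by blast+
    have "?P J ?nu M"
    proof (intro conjI)
      show "weights ?nu" by (rule weights_add[OF wnu weights_unit_edge])
      show "M \<subseteq> J" using MJ J'_def by blast
      show "even (card J + card M)" using nM cJ by auto
      show "\<forall>e\<in>M. \<forall>e'\<in>M. e \<noteq> e' \<longrightarrow> {p e, q e} \<inter> {p e', q e'} = {}" using nM by blast
      show "\<forall>x\<in>V. even ((\<Sum>e\<in>J. inc p q e x) - (\<Sum>y\<in>V. ?nu x y) - (\<Sum>e\<in>M. inc p q e x))"
      proof
        fix x assume "x \<in> V"
        then have 1: "even ((\<Sum>e\<in>J'. inc p q e x) - (\<Sum>y\<in>V. nu x y) - (\<Sum>e\<in>M. inc p q e x))" using nM by blast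
        have "(\<Sum>y\<in>V. unit_edge u w x y) = (if u = w then 0 else at_vertex u x + at_vertex w x)"
          using sum_unit_edge[OF assms(1), of u w x] uw by auto
        then have 2: "even (inc p q e x + inc p q e' x - (\<Sum>y\<in>V. unit_edge u w x y))" unfolding u(2) w(2) by simp
        have "(\<Sum>e\<in>J. inc p q e x) - (\<Sum>y\<in>V. ?nu x y) - (\<Sum>e\<in>M. inc p q e x)
          = ((\<Sum>e\<in>J'. inc p q e x) - (\<Sum>y\<in>V. nu x y) - (\<Sum>e\<in>M. inc p q e x))
            + (inc p q e x + inc p q e' x - (\<Sum>y\<in>V. unit_edge u w x y))"
          unfolding sumJ sum.distrib by simp
        with 1 2 show "even ((\<Sum>e\<in>J. inc p q e x) - (\<Sum>y\<in>V. ?nu x y) - (\<Sum>e\<in>M. inc p q e x))"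
          by (simp only: dvd_add)
      qed
      show "\<forall>\<phi> \<eta>. flow V ?nu \<phi> \<longrightarrow> (\<forall>e. sign (\<eta> e)) \<longrightarrow> (\<exists>\<epsilon>. (\<forall>e. sign (\<epsilon> e)) \<and>
        (\<forall>x\<in>V. (\<Sum>e\<in>J. \<epsilon> e * inc p q e x) = (\<Sum>y\<in>V. \<phi> x y) + (\<Sum>e\<in>M. \<eta> e * inc p q e x)))"
      proof (intro allI impI)
        fix \<phi> :: "'a \<Rightarrow> 'a \<Rightarrow> int" and \<eta> :: "'b \<Rightarrow> int"
        assume \<phi>: "flow V ?nu \<phi>" and \<eta>: "\<forall>e. sign (\<eta> e)"
        obtain \<delta> \<psi> where \<delta>: "sign \<delta>" "flow V nu \<psi>"
          "\<And>x. (\<Sum>y\<in>V. \<phi> x y) = (\<Sum>y\<in>V. \<psi> x y) + \<delta> * (at_vertex u x - at_vertex w x)"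
          by (rule net_split_unit_edge[OF wnu assms(1) uw \<phi>]) blast
        obtain \<epsilon> where \<epsilon>: "\<forall>e. sign (\<epsilon> e)"
          "\<forall>x\<in>V. (\<Sum>e\<in>J'. \<epsilon> e * inc p q e x) = (\<Sum>y\<in>V. \<psi> x y) + (\<Sum>e\<in>M. \<eta> e * inc p q e x)"
          using nM \<delta>(2) \<eta> by blast
        define \<epsilon>' where "\<epsilon>' = \<epsilon>(e := \<delta>, e' := - \<delta>)"
        have "\<epsilon>' e = \<delta>" "\<epsilon>' e' = - \<delta>" unfolding \<epsilon>'_def using e(3) by auto
        moreover have "(\<Sum>e\<in>J'. \<epsilon>' e * inc p q e x) = (\<Sum>e\<in>J'. \<epsilon> e * inc p q e x)" for x
          using J' by (intro sum.cong) (auto simp: \<epsilon>'_def)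
        ultimately have "\<forall>x\<in>V. (\<Sum>e\<in>J. \<epsilon>' e * inc p q e x) = (\<Sum>y\<in>V. \<phi> x y) + (\<Sum>e\<in>M. \<eta> e * inc p q e x)"
          unfolding sumJ \<delta>(3) using \<epsilon>(2) by (simp add: u(2) w(2) algebra_simps)
        moreover have "\<forall>e. sign (\<epsilon>' e)" using \<epsilon>(1) \<delta>(1) unfolding \<epsilon>'_def by auto
        ultimately show "\<exists>\<epsilon>. (\<forall>e. sign (\<epsilon> e)) \<and>
          (\<forall>x\<in>V. (\<Sum>e\<in>J. \<epsilon> e * inc p q e x) = (\<Sum>y\<in>V. \<phi> x y) + (\<Sum>e\<in>M. \<eta> e * inc p q e x))" by blast
      qed
    qed
    then show ?thesis by blast
  qed
qed

text \<open>Splits preserve all nets, so they are applied until no vertex has two edges left. The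
  remaining edges form a matching and may be directed arbitrarily.\<close>

lemma balanced_flow:
  assumes "finite V" "weights mu"
  shows "\<exists>\<phi>. flow V mu \<phi> \<and> (\<forall>v\<in>V. \<bar>\<Sum>u\<in>V. \<phi> v u\<bar> \<le> 1)"
  using assms(2)
proof (induction "nat (mass V mu)" arbitrary: mu rule: less_induct)
  case less
  have pick: "1 \<le> mu x y" "x \<noteq> y" if "mu x y \<noteq> 0" for x y
    using that weightsD(2)[OF less.prems(1), of x y] weightsD(3)[OF less.prems(1), of x] by auto
  show ?case
  proof (cases "\<exists>x\<in>V. \<exists>y\<in>V. \<exists>w\<in>V. mu x y \<noteq> 0 \<and> mu x w \<noteq> 0 \<and> (y = w \<longrightarrow> 2 \<le> mu x y)")
    case True
    then obtain x y w where xyw: "x \<in> V" "y \<in> V" "w \<in> V" "mu x y \<noteq> 0" "mu x w \<noteq> 0" "y = w \<Longrightarrow> 2 \<le> mu x y"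
      by blast
    note ne = pick(2)[OF xyw(4)] pick(2)[OF xyw(5)]
    have w: "weights (\<lambda>u v. mu u v - unit_edge x y u v - unit_edge x w u v)" "weights (lift mu x y w)"
      using weights_lift[OF less.prems(1) pick(1)[OF xyw(4)] pick(1)[OF xyw(5)]] xyw(6) by blast+
    have "nat (mass V (lift mu x y w)) < nat (mass V mu)"
      using mass_lift[OF assms(1) xyw(1-3) ne, of mu] mass_nonneg[OF w(2), of V] by simp
    from less.hyps[OF this w(2)] obtain \<phi> where \<phi>: "flow V (lift mu x y w) \<phi>" "\<forall>v\<in>V. \<bar>\<Sum>u\<in>V. \<phi> v u\<bar> \<le> 1"
      by blast
    \<comment> \<open>The nets of \<open>\<phi>\<close> themselves are taken as targets with modulus
      two, where the bound \<open>< 2\<close> is the desired \<open>\<le> 1\<close>; this makes the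
      lifting lemma applicable.\<close>
    then have "has_orientation 1 V (lift mu x y w) (\<lambda>v. \<Sum>u\<in>V. \<phi> v u) (\<lambda>_. 0)"
      unfolding has_orientation_def by (intro exI[of _ \<phi>]) auto
    then have "has_orientation 1 V mu (\<lambda>v. \<Sum>u\<in>V. \<phi> v u) (\<lambda>_. 0)" by (rule has_orientation_lift[OF assms(1) xyw(1-3) ne w(1)])
    then show ?thesis unfolding has_orientation_def by force
  next
    case F: False
    show ?thesis
    proof (cases "\<exists>x\<in>V. \<exists>y\<in>V. mu x y \<noteq> 0")
      case True
      then obtain x y where xy: "x \<in> V" "y \<in> V" "mu x y \<noteq> 0" by blast
      have ne: "x \<noteq> y" by (rule pick(2)[OF xy(3)])
      let ?mu = "remove_edge mu x y"
      have w: "weights ?mu" by (rule weights_remove_edge[OF less.prems pick(1)[OF xy(3)]])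
      have "nat (mass V ?mu) < nat (mass V mu)"
        using mass_remove_edge[OF assms(1) xy(1,2) ne, of mu] mass_nonneg[OF w, of V] by simp
      from less.hyps[OF this w] obtain \<phi> where \<phi>: "flow V ?mu \<phi>" "\<forall>v\<in>V. \<bar>\<Sum>u\<in>V. \<phi> v u\<bar> \<le> 1" by blast
      have yx: "mu y x \<noteq> 0" using xy(3) weightsD(1)[OF less.prems, of x y] by simp
      have zero: "?mu a v = 0" if v: "v \<in> V" and a: "a = x \<or> a = y" for a v
      proof -
        define c where "c = (if a = x then y else x)"
        have c: "a \<in> V" "c \<in> V" "mu a c \<noteq> 0" using a xy yx unfolding c_def by auto
        show ?thesis
        proof (cases "v = c")
          case True
          have "\<not> 2 \<le> mu a c" using F c by blast
          then have "mu a c = 1" using pick(1)[OF c(3)] by linarith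
          moreover have "unit_edge x y a c = 1" using a ne unfolding c_def unit_edge_def by auto
          ultimately show ?thesis using True by (simp add: remove_edge_def)
        next
          case False
          then have "mu a v = 0" using F c v by blast
          moreover have "unit_edge x y a v = 0" using False a ne unfolding c_def unit_edge_def by auto
          ultimately show ?thesis by (simp add: remove_edge_def)
        qed
      qed
      have net0: "(\<Sum>u\<in>V. \<phi> a u) = 0" if "a = x \<or> a = y" for a
      proof (rule sum.neutral, rule ballI)
        fix u assume "u \<in> V"
        then have "\<bar>\<phi> a u\<bar> \<le> ?mu a u" using \<phi>(1) that xy(1,2) unfolding flow_def by blast
        then show "\<phi> a u = 0" using zero[OF \<open>u \<in> V\<close> that] by simp
      qed
      have "\<bar>\<Sum>u\<in>V. \<phi> v u + 1 * unit_arc x y v u\<bar> \<le> 1" if "v \<in> V" for v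
        unfolding net_remove_edge[OF assms(1) xy(1,2)]
        using net0[of x] net0[of y] \<phi>(2) that ne by (cases "v = x"; cases "v = y") simp_all
      moreover have "flow V mu (\<lambda>u v. \<phi> u v + 1 * unit_arc x y u v)" by (rule flow_remove_edge[OF \<phi>(1)]) simp
      ultimately show ?thesis by blast
    next
      case False
      then have "flow V mu (\<lambda>_ _. 0)" unfolding flow_def by simp
      then show ?thesis by (intro exI[of _ "\<lambda>_ _. 0"]) simp
    qed
  qed
qed

subsection \<open>Signings with prescribed net degrees\<close>

text \<open>A sum of \<open>k - 1\<close> signs, \<open>i\<close> of them positive, equals
  \<open>2 * i - (k - 1)\<close>. For odd \<open>k\<close> this reaches every residue modulo
  \<open>k\<close>, as \<open>(k + 1) / 2\<close> inverts two; for even \<open>k\<close> it reaches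
  exactly the odd ones.\<close>

lemma residue_of_sign_sum:
  fixes k B :: int
  assumes "k > 0" "even k \<Longrightarrow> odd B"
  shows "\<exists>i. 0 \<le> i \<and> i \<le> k - 1 \<and> k dvd B - (2 * i - (k - 1))"
proof -
  obtain j where j: "k dvd B + k - 1 - 2 * j"
  proof (cases "even k")
    case True
    then have "even (B + k - 1)" using assms(2) by simp
    then obtain j where "B + k - 1 = 2 * j" by blast
    then show ?thesis using that[of j] by simp
  next
    case False
    then obtain h where h: "k + 1 = 2 * h" by (metis even_plus_one_iff evenE)
    have "B + k - 1 - 2 * ((B + k - 1) * h) = (B + k - 1) * (1 - 2 * h)" by (simp add: algebra_simps)
    also have "1 - 2 * h = - k" using h by linarith
    finally have "k dvd B + k - 1 - 2 * ((B + k - 1) * h)" by simp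
    then show ?thesis by (rule that)
  qed
  have "k dvd 2 * (j - j mod k)" by (simp add: minus_mod_eq_mult_div)
  then have "k dvd (B + k - 1 - 2 * j) + 2 * (j - j mod k)" using j by (rule dvd_add[rotated])
  then have "k dvd B - (2 * (j mod k) - (k - 1))" by (simp add: algebra_simps)
  moreover have "0 \<le> j mod k" "j mod k \<le> k - 1" using assms(1) pos_mod_bound[of k j] by auto
  ultimately show ?thesis by blast
qed

lemma sum_signs_parity:
  assumes "\<And>e. e \<in> A \<Longrightarrow> sign (s e)"
  shows "even ((\<Sum>e\<in>A. s e) - int (card A))"
proof -
  have "(\<Sum>e\<in>A. s e) - int (card A) = (\<Sum>e\<in>A. s e - 1)" by (simp add: sum_subtractf)
  also have "even \<dots>" by (intro dvd_sum) (use assms in force)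
  finally show ?thesis .
qed

text \<open>A least residue of absolute value \<open>k\<close> would demand degree
  \<open>3 * k - 2\<close>. At degree \<open>3 * k - 3\<close> parity rules this residue out, which
  saves one edge.\<close>

lemma roomy_if_cut_large:
  assumes "k > 0" "even (sum b A - set_degree V mu W A)" "3 * k - 3 \<le> set_degree V mu W A"
  shows "roomy k 2 V mu W b A"
proof -
  obtain q where q: "\<bar>sum b A + 2 * k * q\<bar> \<le> k" using residue_exists[OF assms(1)] by blast
  have "even (\<bar>sum b A + 2 * k * q\<bar> - set_degree V mu W A)" using assms(2) by auto
  then have "\<bar>sum b A + 2 * k * q\<bar> + 2 * k - 2 \<le> set_degree V mu W A"
    using q assms(3) by presburger
  then show ?thesis unfolding roomy_def by blast
qed

locale end_pairs =
  fixes V :: "'v set" and E :: "'e set" and p q :: "'e \<Rightarrow> 'v"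
  assumes finV: "finite V" and finE: "finite E" and ends_V: "e \<in> E \<Longrightarrow> p e \<in> V \<and> q e \<in> V"
begin

lemma inc_nonneg: "0 \<le> inc p q e v"
  unfolding inc_def by simp

lemma inc_zero: "v \<notin> {p e, q e} \<Longrightarrow> inc p q e v = 0"
  unfolding inc_def by auto

lemma sum_weighted_inc: "e \<in> E \<Longrightarrow> (\<Sum>v\<in>V. f v * inc p q e v) = f (p e) + f (q e)"
  unfolding inc_def using ends_V[of e] finV by (simp add: distrib_left sum.distrib)

lemma sum_inc: "e \<in> E \<Longrightarrow> (\<Sum>v\<in>V. c * inc p q e v) = c + c"
  using sum_weighted_inc[of e "\<lambda>_. c"] by simp

lemma matching_sum:
  assumes "M \<subseteq> E" "\<forall>e\<in>M. \<forall>e'\<in>M. e \<noteq> e' \<longrightarrow> {p e, q e} \<inter> {p e', q e'} = {}"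
  obtains "(\<Sum>e\<in>M. \<eta> e * inc p q e v) = 0"
    | e where "e \<in> M" "v \<in> {p e, q e}" "(\<Sum>e\<in>M. \<eta> e * inc p q e v) = \<eta> e * inc p q e v"
proof (cases "\<exists>e\<in>M. v \<in> {p e, q e}")
  case True
  then obtain e where e: "e \<in> M" "v \<in> {p e, q e}" by blast
  have finM: "finite M" using assms(1) finE finite_subset by blast
  have "\<eta> e' * inc p q e' v = 0" if "e' \<in> M" "e' \<noteq> e" for e'
  proof -
    have "v \<notin> {p e', q e'}" using assms(2) e that by blast
    then show ?thesis by (simp add: inc_zero)
  qed
  from sum_pair_support[OF finM e(1) this] have "(\<Sum>e\<in>M. \<eta> e * inc p q e v) = \<eta> e * inc p q e v" .
  then show ?thesis by (rule that(2)[OF e])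
next
  case False
  then have "(\<Sum>e\<in>M. \<eta> e * inc p q e v) = 0" by (intro sum.neutral) (auto simp: inc_zero)
  then show ?thesis using that(1) by blast
qed

text \<open>An unpaired loop adds two in absolute value to a net among \<open>-1\<close>,
  \<open>0\<close>, \<open>1\<close>. It is taken with sign \<open>1\<close> unless the net is
  \<open>1\<close>, which yields \<open>1\<close>, \<open>2\<close>, \<open>-1\<close> respectively;
  an unpaired edge that is not a loop adds just \<open>1\<close>. Modulus two is separate because
  the choice of loop signs in \<open>signing\<close> relies on \<open>k \<ge> 2\<close>.\<close>

lemma signing_modulus_one:
  "\<exists>\<epsilon>. (\<forall>e. sign (\<epsilon> e)) \<and> (\<forall>v\<in>V. - 2 < (\<Sum>e\<in>E. \<epsilon> e * inc p q e v) \<and> (\<Sum>e\<in>E. \<epsilon> e * inc p q e v) \<le> 2)"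
proof -
  have EV: "p ` E \<union> q ` E \<subseteq> V" using ends_V by blast
  obtain nu M where nM: "weights nu" "M \<subseteq> E"
    "\<forall>e\<in>M. \<forall>e'\<in>M. e \<noteq> e' \<longrightarrow> {p e, q e} \<inter> {p e', q e'} = {}"
    "\<forall>\<phi> \<eta>. flow V nu \<phi> \<longrightarrow> (\<forall>e. sign (\<eta> e)) \<longrightarrow> (\<exists>\<epsilon>. (\<forall>e. sign (\<epsilon> e)) \<and>
      (\<forall>v\<in>V. (\<Sum>e\<in>E. \<epsilon> e * inc p q e v) = (\<Sum>u\<in>V. \<phi> v u) + (\<Sum>e\<in>M. \<eta> e * inc p q e v)))"
    using pair_adjacent_edges[OF finV finE EV] by (elim exE conjE) (rule that)
  obtain \<phi> where \<phi>: "flow V nu \<phi>" "\<And>v. v \<in> V \<Longrightarrow> \<bar>\<Sum>u\<in>V. \<phi> v u\<bar> \<le> 1"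
    using balanced_flow[OF finV nM(1)] by blast
  define \<eta> :: "'e \<Rightarrow> int" where "\<eta> e = (if p e = q e \<and> 0 < (\<Sum>u\<in>V. \<phi> (p e) u) then -1 else 1)" for e
  have "\<forall>e. sign (\<eta> e)" unfolding \<eta>_def by simp
  with nM(4) \<phi>(1) obtain \<epsilon> where \<epsilon>: "\<forall>e. sign (\<epsilon> e)"
    "\<forall>v\<in>V. (\<Sum>e\<in>E. \<epsilon> e * inc p q e v) = (\<Sum>u\<in>V. \<phi> v u) + (\<Sum>e\<in>M. \<eta> e * inc p q e v)" by blast
  have "- 2 < (\<Sum>u\<in>V. \<phi> v u) + (\<Sum>e\<in>M. \<eta> e * inc p q e v) \<and>
      (\<Sum>u\<in>V. \<phi> v u) + (\<Sum>e\<in>M. \<eta> e * inc p q e v) \<le> 2" if v: "v \<in> V" for v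
  proof (rule matching_sum[OF nM(2,3), of \<eta> v])
    assume "(\<Sum>e\<in>M. \<eta> e * inc p q e v) = 0"
    then show ?thesis using \<phi>(2)[OF v] by linarith
  next
    fix e assume e: "v \<in> {p e, q e}" "(\<Sum>e\<in>M. \<eta> e * inc p q e v) = \<eta> e * inc p q e v"
    show ?thesis
    proof (cases "p e = q e")
      case True
      then have "v = p e" "inc p q e v = 2" using e(1) by (auto simp: inc_def)
      then show ?thesis unfolding e(2) using \<phi>(2)[OF v] True by (auto simp: \<eta>_def)
    next
      case False
      then have "inc p q e v = 1" "\<eta> e = 1" using e(1) by (auto simp: inc_def \<eta>_def)
      then show ?thesis unfolding e(2) using \<phi>(2)[OF v] by auto
    qed
  qed
  then show ?thesis using \<epsilon> by (intro exI[of _ \<epsilon>]) simp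
qed

text \<open>The half-open window reflects the asymmetry of \<open>f v \<le> d / 2 < f v + k\<close>:
  the total may reach \<open>2 * k\<close> but not \<open>- 2 * k\<close>. This one extra value
  absorbs an unpaired edge at \<open>v\<close>.\<close>

lemma signing:
  fixes k :: int and f :: "'v \<Rightarrow> int" and X :: "'v set"
  defines "C \<equiv> {e \<in> E. p e \<in> X \<and> q e \<notin> X}"
  defines "\<beta> v \<equiv> 2 * f v - (\<Sum>e\<in>E. inc p q e v)"
  assumes k2: "k \<ge> 2" and evk: "even k \<Longrightarrow> even (sum f V)"
    and inside: "\<And>e. e \<in> E - C \<Longrightarrow> p e \<in> X \<longleftrightarrow> q e \<in> X"
    and many: "k - 1 \<le> int (card (E - C))"
    and cuts: "\<And>A. A \<noteq> {} \<Longrightarrow> A \<subset> V \<Longrightarrow> 3 * k - 3 \<le> int (card {e \<in> C. (p e \<in> A) \<noteq> (q e \<in> A)})"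
  shows "\<exists>\<epsilon>. (\<forall>e. sign (\<epsilon> e)) \<and> (\<forall>v\<in>V. 2 * k dvd (\<Sum>e\<in>E. \<epsilon> e * inc p q e v) - \<beta> v \<and>
    - 2 * k < (\<Sum>e\<in>E. \<epsilon> e * inc p q e v) \<and> (\<Sum>e\<in>E. \<epsilon> e * inc p q e v) \<le> 2 * k)"
proof -
  define \<sigma> :: "'v \<Rightarrow> int" where "\<sigma> v = (if v \<in> X then 1 else -1)" for v
  define \<tau> where "\<tau> e = \<sigma> (p e)" for e
  have \<sigma>: "sign (\<sigma> v)" "\<sigma> v * \<sigma> v = 1" for v unfolding \<sigma>_def by auto
  have \<tau>: "sign (\<tau> e)" for e unfolding \<tau>_def using \<sigma> by blast
  have CE: "C \<subseteq> E" and finC: "finite C" using finE unfolding C_def by auto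
  have crossC: "\<sigma> v * inc p q e v = at_vertex (p e) v - at_vertex (q e) v" if "e \<in> C" for e v
    using that unfolding C_def \<sigma>_def inc_def by auto
  have insideI: "\<sigma> v * inc p q e v = \<tau> e * inc p q e v" if "e \<in> E - C" for e v
    using inside[OF that] unfolding \<sigma>_def \<tau>_def inc_def by (auto simp: of_bool_def)
  \<comment> \<open>These become root edges. Their number \<open>k - 1\<close> is enough to adjust
    the total residue, while their \<open>2 * k - 2\<close> ends are too few to make
    \<open>V\<close> roomy.\<close>
  obtain J1 where J1: "J1 \<subseteq> E - C" "card J1 = nat (k - 1)"
  proof (rule obtain_subset_with_card_n)
    show "nat (k - 1) \<le> card (E - C)" using many by linarith
  qed
  define J where "J = E - C - J1"
  have finJ: "finite J" "finite J1" "finite (E - C)" using finE J1 finite_subset unfolding J_def by auto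
  have split: "(\<Sum>e\<in>E. g e) = (\<Sum>e\<in>C. g e) + ((\<Sum>e\<in>J. g e) + (\<Sum>e\<in>J1. g e))" for g :: "'e \<Rightarrow> int"
    unfolding J_def sum.subset_diff[OF CE finE] sum.subset_diff[OF J1(1) finJ(3)] by simp
  have JE: "e \<in> E" if "e \<in> J" for e using that unfolding J_def by blast
  have J1E: "e \<in> E" if "e \<in> J1" for e using that J1(1) by blast
  have JV: "p ` J \<union> q ` J \<subseteq> V" using ends_V JE by blast
  obtain nu M where nM: "weights nu" "M \<subseteq> J" "even (card J + card M)"
    "\<forall>e\<in>M. \<forall>e'\<in>M. e \<noteq> e' \<longrightarrow> {p e, q e} \<inter> {p e', q e'} = {}"
    "\<forall>v\<in>V. even ((\<Sum>e\<in>J. inc p q e v) - (\<Sum>u\<in>V. nu v u) - (\<Sum>e\<in>M. inc p q e v))"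
    "\<forall>\<phi> \<eta>. flow V nu \<phi> \<longrightarrow> (\<forall>e. sign (\<eta> e)) \<longrightarrow> (\<exists>\<epsilon>. (\<forall>e. sign (\<epsilon> e)) \<and>
      (\<forall>v\<in>V. (\<Sum>e\<in>J. \<epsilon> e * inc p q e v) = (\<Sum>u\<in>V. \<phi> v u) + (\<Sum>e\<in>M. \<eta> e * inc p q e v)))"
    using pair_adjacent_edges[OF finV finJ(1) JV] by (elim exE conjE) (rule that)
  \<comment> \<open>In the untwisted signs an unpaired edge gets \<open>1\<close>. For a loop this
    overshoots \<open>2 * k\<close> only when the total would be \<open>2 * k + 1\<close>, that is,
    only in the class of \<open>1\<close>; exactly there the loop gets \<open>-1\<close>.\<close>
  define \<eta> where "\<eta> e = (if p e = q e \<and> 2 * k dvd \<beta> (p e) - 1 then - \<tau> e else \<tau> e)" for e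
  have \<eta>: "\<forall>e. sign (\<eta> e)" unfolding \<eta>_def using \<tau> by auto
  define off where "off v = (\<Sum>e\<in>M. \<eta> e * inc p q e v)" for v
  define b where "b v = \<sigma> v * \<beta> v - off v" for v
  define W where "W v = (\<Sum>e\<in>J1. inc p q e v)" for v
  define mu where "mu u v = nu u v + (\<Sum>e\<in>C. unit_edge (p e) (q e) u v)" for u v
  have wmu: "weights mu" unfolding mu_def[abs_def] by (rule weights_add[OF nM(1) weights_sum_unit_edge[OF finC]])
  have ME: "M \<subseteq> E" "finite M" using nM(2) JE finJ(1) finite_subset by auto

  \<comment> \<open>Every edge has two ends, so all totals are even; the condition modulo
    \<open>2 * k\<close> on \<open>sum b V - sum z V\<close> becomes one modulo \<open>k\<close> on
    \<open>B\<close>.\<close>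
  define B where "B = (\<Sum>v\<in>V. \<sigma> v * f v) - (\<Sum>e\<in>E - C. \<tau> e) - (\<Sum>e\<in>M. \<eta> e)"
  have sum_b: "sum b V = 2 * B"
  proof -
    have "(\<Sum>v\<in>V. \<sigma> v * (\<Sum>e\<in>E. inc p q e v)) = (\<Sum>e\<in>E. \<Sum>v\<in>V. \<sigma> v * inc p q e v)"
      unfolding sum_distrib_left by (rule sum.swap)
    also have "\<dots> = (\<Sum>e\<in>E. \<sigma> (p e) + \<sigma> (q e))" by (intro sum.cong refl sum_weighted_inc)
    also have "\<dots> = (\<Sum>e\<in>E - C. \<sigma> (p e) + \<sigma> (q e)) + (\<Sum>e\<in>C. \<sigma> (p e) + \<sigma> (q e))"
      by (rule sum.subset_diff[OF CE finE])
    also have "(\<Sum>e\<in>C. \<sigma> (p e) + \<sigma> (q e)) = 0" by (intro sum.neutral) (auto simp: C_def \<sigma>_def)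
    also have "(\<Sum>e\<in>E - C. \<sigma> (p e) + \<sigma> (q e)) = (\<Sum>e\<in>E - C. 2 * \<tau> e)"
      by (intro sum.cong refl) (use inside in \<open>auto simp: \<tau>_def \<sigma>_def\<close>)
    finally have 1: "(\<Sum>v\<in>V. \<sigma> v * (\<Sum>e\<in>E. inc p q e v)) = 2 * (\<Sum>e\<in>E - C. \<tau> e)"
      by (simp add: sum_distrib_left)
    have "sum off V = (\<Sum>e\<in>M. \<Sum>v\<in>V. \<eta> e * inc p q e v)" unfolding off_def by (rule sum.swap)
    also have "\<dots> = (\<Sum>e\<in>M. \<eta> e + \<eta> e)"
      by (intro sum.cong refl) (use ME in \<open>auto simp: sum_inc subsetD\<close>)
    finally have 2: "sum off V = 2 * (\<Sum>e\<in>M. \<eta> e)" by (simp add: sum_distrib_left)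
    have "sum b V = (\<Sum>v\<in>V. 2 * (\<sigma> v * f v) - \<sigma> v * (\<Sum>e\<in>E. inc p q e v) - off v)"
      unfolding b_def \<beta>_def by (intro sum.cong refl) (simp add: algebra_simps)
    then show ?thesis unfolding B_def using 1 2 by (simp add: sum_subtractf flip: sum_distrib_left)
  qed
  \<comment> \<open>Pairing preserves parity, so the numbers of edges in \<open>E - C\<close> and in
    \<open>M\<close> differ by \<open>k - 1\<close> modulo two, and \<open>k - 1\<close> is odd. The
    sum of \<open>f\<close> contributes an even amount.\<close>
  have "odd B" if "even k"
  proof -
    have "(\<Sum>v\<in>V. \<sigma> v * f v) - sum f V = (\<Sum>v\<in>V. (\<sigma> v - 1) * f v)" by (simp add: sum_subtractf left_diff_distrib)
    also have "even \<dots>" by (intro dvd_sum) (simp add: \<sigma>_def)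
    finally have 1: "even (\<Sum>v\<in>V. \<sigma> v * f v)" using evk[OF that] by simp
    have 2: "even ((\<Sum>e\<in>E - C. \<tau> e) - int (card (E - C)))" "even ((\<Sum>e\<in>M. \<eta> e) - int (card M))"
      by (rule sum_signs_parity, use \<tau> \<eta> in blast)+
    have "card J = card (E - C) - card J1" unfolding J_def using J1 finJ by (simp add: card_Diff_subset)
    then have "int (card (E - C)) = int (card J) + (k - 1)" using J1(2) many k2 by linarith
    then have "odd (int (card (E - C)) + int (card M))" using that nM(3) by (simp flip: of_nat_add)
    then show ?thesis using 1 2 unfolding B_def by presburger
  qed
  then obtain i where i: "0 \<le> i" "i \<le> k - 1" "k dvd B - (2 * i - (k - 1))"
    using residue_of_sign_sum[of k B] k2 by auto
  obtain L where L: "L \<subseteq> J1" "card L = nat i"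
  proof (rule obtain_subset_with_card_n)
    show "nat i \<le> card J1" using i J1(2) by simp
  qed
  define \<epsilon>1 :: "'e \<Rightarrow> int" where "\<epsilon>1 e = (if e \<in> L then 1 else -1)" for e
  define z where "z v = (\<Sum>e\<in>J1. \<epsilon>1 e * inc p q e v)" for v
  have "(\<Sum>e\<in>J1. \<epsilon>1 e) = (\<Sum>e\<in>J1 - L. \<epsilon>1 e) + (\<Sum>e\<in>L. \<epsilon>1 e)" by (rule sum.subset_diff[OF L(1) finJ(2)])
  also have "\<dots> = i - int (card (J1 - L))" unfolding \<epsilon>1_def using L(2) i by simp
  also have "int (card (J1 - L)) = k - 1 - i"
    using L i J1(2) finJ(2) finite_subset[OF L(1)] card_mono[OF finJ(2) L(1)]
    by (simp add: card_Diff_subset of_nat_diff)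
  finally have \<epsilon>1: "(\<Sum>e\<in>J1. \<epsilon>1 e) = 2 * i - (k - 1)" by simp
  have "sum z V = (\<Sum>e\<in>J1. \<Sum>v\<in>V. \<epsilon>1 e * inc p q e v)" unfolding z_def by (rule sum.swap)
  also have "\<dots> = (\<Sum>e\<in>J1. \<epsilon>1 e + \<epsilon>1 e)" by (intro sum.cong refl) (use J1E in \<open>auto simp: sum_inc\<close>)
  finally have sum_z: "sum z V = 2 * (2 * i - (k - 1))" unfolding sum.distrib \<epsilon>1 by simp
  have "sum W V = (\<Sum>e\<in>J1. \<Sum>v\<in>V. 1 * inc p q e v)" unfolding W_def by (simp add: sum.swap[of _ J1 V])
  also have "\<dots> = (\<Sum>e\<in>J1. 1 + 1)" by (intro sum.cong refl sum_inc J1E)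
  finally have sum_W: "sum W V = 2 * k - 2" using J1(2) k2 by simp

  have dg1: "set_degree V mu W {v} = (\<Sum>u\<in>V. nu v u) + (\<Sum>e\<in>C. inc p q e v) + W v" if v: "v \<in> V" for v
  proof -
    have "(\<Sum>u\<in>V. unit_edge (p e) (q e) v u) = inc p q e v" if "e \<in> C" for e
      using sum_unit_edge[OF finV, of "p e" "q e" v] that ends_V[of e] by (auto simp: C_def inc_def)
    then have "(\<Sum>u\<in>V. \<Sum>e\<in>C. unit_edge (p e) (q e) v u) = (\<Sum>e\<in>C. inc p q e v)" by (subst sum.swap) simp
    then show ?thesis unfolding set_degree_def cut_singleton[OF wmu finV v] by (simp add: mu_def sum.distrib)
  qed
  have b_par: "even (b v - set_degree V mu W {v})" if v: "v \<in> V" for v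
  proof -
    have "off v - (\<Sum>e\<in>M. inc p q e v) = (\<Sum>e\<in>M. (\<eta> e - 1) * inc p q e v)"
      unfolding off_def by (simp add: sum_subtractf left_diff_distrib)
    also have "even \<dots>"
    proof (intro dvd_sum dvd_mult2)
      fix e show "even (\<eta> e - 1)" using \<eta>[rule_format, of e] by auto
    qed
    finally have 1: "even (off v - (\<Sum>e\<in>M. inc p q e v))" .
    have 2: "even (\<sigma> v * \<beta> v - \<beta> v)" using \<sigma>(1)[of v] by auto
    have 3: "even (\<beta> v + (\<Sum>e\<in>E. inc p q e v))" unfolding \<beta>_def by simp
    have "b v - set_degree V mu W {v} = (\<sigma> v * \<beta> v - \<beta> v) + (\<beta> v + (\<Sum>e\<in>E. inc p q e v))
      - (off v - (\<Sum>e\<in>M. inc p q e v))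
      - ((\<Sum>e\<in>J. inc p q e v) - (\<Sum>u\<in>V. nu v u) - (\<Sum>e\<in>M. inc p q e v))
      - 2 * ((\<Sum>u\<in>V. nu v u) + (\<Sum>e\<in>C. inc p q e v) + W v + (\<Sum>e\<in>M. inc p q e v))"
      unfolding b_def dg1[OF v] split W_def by simp
    then show ?thesis using 1 2 3 nM(5)[rule_format, OF v] by (simp only: dvd_add dvd_diff dvd_triv_left)
  qed
  have big: "3 * k - 3 \<le> set_degree V mu W A" if A: "A \<noteq> {}" "A \<subset> V" for A
  proof -
    have "cut_weight V (\<lambda>u v. \<Sum>e\<in>C. unit_edge (p e) (q e) u v) A = (\<Sum>e\<in>C. cut_weight V (unit_edge (p e) (q e)) A)"
      unfolding cut_weight_def by (simp only: sum.swap[of _ C])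
    also have "\<dots> = (\<Sum>e\<in>C. of_bool ((p e \<in> A) \<noteq> (q e \<in> A)))"
      by (intro sum.cong refl cut_unit_edge finV) (use A ends_V CE in auto)
    also have "\<dots> = int (card {e \<in> C. (p e \<in> A) \<noteq> (q e \<in> A)})"
      using finC by (simp add: of_bool_def sum.If_cases Int_def)
    finally have "cut_weight V mu A = cut_weight V nu A + int (card {e \<in> C. (p e \<in> A) \<noteq> (q e \<in> A)})"
      unfolding mu_def[abs_def] cut_add by simp
    moreover have "0 \<le> sum W A" unfolding W_def by (intro sum_nonneg inc_nonneg)
    ultimately show ?thesis using cuts[OF A] cut_nonneg[OF nM(1), of V A] unfolding set_degree_def by linarith
  qed
  have "orient k V mu b W z {}"
  proof
    fix v assume v: "v \<in> V"
    have "\<bar>z v\<bar> \<le> (\<Sum>e\<in>J1. \<bar>\<epsilon>1 e * inc p q e v\<bar>)" unfolding z_def by (rule sum_abs)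
    also have "\<dots> = W v" unfolding W_def
      by (intro sum.cong refl) (auto simp: \<epsilon>1_def abs_mult inc_nonneg)
    finally show "\<bar>z v\<bar> \<le> W v" .
    have "W v - z v = (\<Sum>e\<in>J1. (1 - \<epsilon>1 e) * inc p q e v)"
      unfolding W_def z_def by (simp add: sum_subtractf left_diff_distrib)
    also have "even \<dots>" by (intro dvd_sum) (simp add: \<epsilon>1_def)
    finally show "even (W v - z v)" .
  next
    have "sum b V - sum z V = 2 * (B - (2 * i - (k - 1)))" unfolding sum_b sum_z by simp
    then show "2 * k dvd sum b V - sum z V" using i(3) by (simp only: mult_dvd_mono dvd_refl)
    show "\<not> roomy k 0 V mu W b V" unfolding roomy_def set_degree_def using sum_W k2 by auto
    show "roomy k 2 V mu W b A" if "A \<noteq> {}" "A \<subset> V" for A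
      by (rule roomy_if_cut_large[OF _ sum_set_degree_parity[OF wmu finV _ b_par] big[OF that]]) (use k2 that in auto)
  qed (use finV wmu b_par in auto)
  then have "has_orientation k V mu b z" using k2 by (rule orient_solution)
  then obtain \<phi> where \<phi>: "flow V mu \<phi>" "\<And>v. v \<in> V \<Longrightarrow> 2 * k dvd (\<Sum>u\<in>V. \<phi> v u) + z v - b v"
    "\<And>v. v \<in> V \<Longrightarrow> \<bar>(\<Sum>u\<in>V. \<phi> v u) + z v\<bar> < 2 * k" unfolding has_orientation_def by blast
  obtain \<epsilon>C \<psi> where \<epsilon>C: "\<forall>e. sign (\<epsilon>C e)" "flow V nu \<psi>"
    "\<And>v. (\<Sum>u\<in>V. \<phi> v u) = (\<Sum>u\<in>V. \<psi> v u) + (\<Sum>e\<in>C. \<epsilon>C e * (at_vertex (p e) v - at_vertex (q e) v))"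
    using decompose_flow[OF finC finV nM(1) _ \<phi>(1)[unfolded mu_def[abs_def]]] ends_V CE by blast
  obtain \<epsilon>J where \<epsilon>J: "\<forall>e. sign (\<epsilon>J e)"
    "\<forall>v\<in>V. (\<Sum>e\<in>J. \<epsilon>J e * inc p q e v) = (\<Sum>u\<in>V. \<psi> v u) + off v"
    using nM(6) \<epsilon>C(2) \<eta> unfolding off_def by blast
  \<comment> \<open>The factor \<open>\<tau> e\<close> undoes the negation of degrees outside
    \<open>X\<close> for inside edges; for crossing edges it is built into the order of their
    ends.\<close>
  define \<epsilon> where "\<epsilon> e = (if e \<in> C then \<epsilon>C e else if e \<in> J then \<tau> e * \<epsilon>J e else \<tau> e * \<epsilon>1 e)" for e
  have sgn: "\<forall>e. sign (\<epsilon> e)"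
  proof
    fix e show "sign (\<epsilon> e)" using \<epsilon>C(1)[rule_format, of e] \<epsilon>J(1)[rule_format, of e] \<tau>[of e] unfolding \<epsilon>_def \<epsilon>1_def by auto
  qed
  have net: "(\<Sum>e\<in>E. \<epsilon> e * inc p q e v) = \<sigma> v * ((\<Sum>u\<in>V. \<phi> v u) + z v + off v)" if v: "v \<in> V" for v
  proof -
    have inc: "x * inc p q e v = \<sigma> v * (x * (\<sigma> v * inc p q e v))" for x e
      using \<sigma>(2)[of v] by (metis mult.assoc mult.commute mult_1)
    have "(\<Sum>e\<in>C. \<epsilon> e * inc p q e v) = \<sigma> v * (\<Sum>e\<in>C. \<epsilon>C e * (at_vertex (p e) v - at_vertex (q e) v))"
      unfolding sum_distrib_left
    proof (rule sum.cong[OF refl])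
      fix e assume e: "e \<in> C"
      show "\<epsilon> e * inc p q e v = \<sigma> v * (\<epsilon>C e * (at_vertex (p e) v - at_vertex (q e) v))"
        using inc[of "\<epsilon> e" e] crossC[OF e, of v] e by (simp add: \<epsilon>_def)
    qed
    moreover have "(\<Sum>e\<in>J. \<epsilon> e * inc p q e v) = \<sigma> v * (\<Sum>e\<in>J. \<epsilon>J e * inc p q e v)"
      unfolding sum_distrib_left
    proof (rule sum.cong[OF refl])
      fix e assume e: "e \<in> J"
      show "\<epsilon> e * inc p q e v = \<sigma> v * (\<epsilon>J e * inc p q e v)"
        using insideI[of e v] e by (auto simp: \<epsilon>_def J_def algebra_simps)
    qed
    moreover have "(\<Sum>e\<in>J1. \<epsilon> e * inc p q e v) = \<sigma> v * z v"
      unfolding z_def sum_distrib_left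
    proof (rule sum.cong[OF refl])
      fix e assume e: "e \<in> J1"
      show "\<epsilon> e * inc p q e v = \<sigma> v * (\<epsilon>1 e * inc p q e v)"
        using insideI[of e v] e J1(1) by (auto simp: \<epsilon>_def J_def algebra_simps)
    qed
    ultimately show ?thesis unfolding split \<epsilon>C(3) using \<epsilon>J(2) v by (simp add: algebra_simps)
  qed
  have "2 * k dvd (\<Sum>e\<in>E. \<epsilon> e * inc p q e v) - \<beta> v \<and>
    - 2 * k < (\<Sum>e\<in>E. \<epsilon> e * inc p q e v) \<and> (\<Sum>e\<in>E. \<epsilon> e * inc p q e v) \<le> 2 * k" if v: "v \<in> V" for v
  proof -
    define n where "n = \<sigma> v * ((\<Sum>u\<in>V. \<phi> v u) + z v)"
    have N: "(\<Sum>e\<in>E. \<epsilon> e * inc p q e v) = n + \<sigma> v * off v" unfolding net[OF v] n_def by (simp add: algebra_simps)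
    have nb: "\<bar>n\<bar> < 2 * k" using \<phi>(3)[OF v] \<sigma>(1)[of v] unfolding n_def by auto
    have "n + \<sigma> v * off v - \<beta> v = \<sigma> v * ((\<Sum>u\<in>V. \<phi> v u) + z v - b v)"
      unfolding n_def b_def using \<sigma>(2)[of v] by (simp add: algebra_simps flip: mult.assoc)
    then have d: "2 * k dvd n + \<sigma> v * off v - \<beta> v" using \<phi>(2)[OF v] by simp
    have "- 2 * k < n + \<sigma> v * off v \<and> n + \<sigma> v * off v \<le> 2 * k"
    proof (rule matching_sum[OF ME(1) nM(4), of \<eta> v])
      assume "(\<Sum>e\<in>M. \<eta> e * inc p q e v) = 0"
      then have "off v = 0" unfolding off_def .
      then show ?thesis using nb by auto
    next
      fix e assume e: "e \<in> M" "v \<in> {p e, q e}" "(\<Sum>e\<in>M. \<eta> e * inc p q e v) = \<eta> e * inc p q e v"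
      have \<tau>e: "\<tau> e = \<sigma> v"
        using inside[of e] e(1,2) nM(2) unfolding J_def \<tau>_def \<sigma>_def by auto
      have off: "off v = \<eta> e * inc p q e v" using e(3) unfolding off_def .
      consider "p e \<noteq> q e" | "p e = q e" "2 * k dvd \<beta> v - 1" | "p e = q e" "\<not> 2 * k dvd \<beta> v - 1" by blast
      then show ?thesis
      proof cases
        case 1
        then have "inc p q e v = 1" "\<eta> e = \<sigma> v" using e(2) \<tau>e by (auto simp: inc_def \<eta>_def)
        then have "\<sigma> v * off v = 1" using off \<sigma>(2)[of v] by simp
        then show ?thesis using nb by linarith
      next
        case 2
        then have "inc p q e v = 2" "\<eta> e = - \<sigma> v" using e(2) \<tau>e by (auto simp: inc_def \<eta>_def)
        then have s: "\<sigma> v * off v = - 2" using off \<sigma>(2)[of v] by simp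
        have "2 * k dvd n - 3"
        proof -
          have "2 * k dvd (n + \<sigma> v * off v - \<beta> v) + (\<beta> v - 1)" using d 2(2) by (rule dvd_add)
          then show ?thesis unfolding s by (simp add: algebra_simps)
        qed
        then obtain c where c: "n = 3 + 2 * k * c" by (metis add.commute diff_add_cancel dvdE)
        \<comment> \<open>The two values that would leave the window after subtracting two. As
          \<open>n\<close> is congruent to \<open>3\<close>, it is odd, and it is not congruent to
          \<open>1\<close> since \<open>k \<ge> 2\<close>.\<close>
        have "n \<noteq> - 2 * k + 1" "n \<noteq> - 2 * k + 2"
        proof -
          show "n \<noteq> - 2 * k + 2" using c even_mult_iff[of 2 "k * c"] by (simp only: mult.assoc) presburger
          show "n \<noteq> - 2 * k + 1"
          proof
            assume "n = - 2 * k + 1"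
            then have "k * (c + 1) = - 1" using c by (simp add: algebra_simps)
            then have "k dvd 1" by (metis dvd_minus_iff dvd_triv_left)
            then show False using k2 zdvd_imp_le[of k 1] by simp
          qed
        qed
        then show ?thesis using nb s by linarith
      next
        case 3
        then have "inc p q e v = 2" "\<eta> e = \<sigma> v" using e(2) \<tau>e by (auto simp: inc_def \<eta>_def)
        then have s: "\<sigma> v * off v = 2" using off \<sigma>(2)[of v] by simp
        have "n \<noteq> 2 * k - 1"
        proof
          assume "n = 2 * k - 1"
          then have "n + \<sigma> v * off v - \<beta> v = 2 * k - (\<beta> v - 1)" unfolding s by simp
          then have "2 * k dvd 2 * k - (\<beta> v - 1)" using d by argo
          then have "2 * k dvd \<beta> v - 1" by (simp add: dvd_diff_right_iff)
          then show False using 3(2) by blast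
        qed
        then show ?thesis using nb s by linarith
      qed
    qed
    then show ?thesis using d unfolding N by blast
  qed
  then show ?thesis using sgn by (intro exI[of _ \<epsilon>]) blast
qed

end

subsection \<open>From graphs to signings\<close>

lemma exists_maximiser:
  fixes g :: "'a set \<Rightarrow> nat"
  assumes "finite V"
  obtains X where "X \<subseteq> V" "\<And>Y. Y \<subseteq> V \<Longrightarrow> g Y \<le> g X"
proof -
  have fin: "finite (g ` Pow V)" using assms by simp
  have "Max (g ` Pow V) \<in> g ` Pow V" by (rule Max_in[OF fin]) auto
  then obtain X where X: "X \<in> Pow V" "Max (g ` Pow V) = g X" by blast
  have "g Y \<le> g X" if "Y \<subseteq> V" for Y using Max_ge[OF fin, of "g Y"] that unfolding X(2) by blast
  then show ?thesis using that X(1) by blast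
qed

lemma Upair_separates: "(\<exists>u v. Upair a b = Upair u v \<and> u \<in> A \<and> v \<notin> A) \<longleftrightarrow> (a \<in> A) \<noteq> (b \<in> A)"
  by auto

context multigraph
begin

lemma mem_cut_edges: "e \<in> edges G \<Longrightarrow> ends G e = Upair a b \<Longrightarrow> e \<in> cut_edges G A \<longleftrightarrow> (a \<in> A) \<noteq> (b \<in> A)"
  unfolding cut_edges_def using Upair_separates[of a b A] by auto

lemma cut_edges_symdiff:
  "cut_edges G ((X - A) \<union> (A - X)) = (cut_edges G X - cut_edges G A) \<union> (cut_edges G A - cut_edges G X)"
proof -
  have *: "e \<in> cut_edges G ((X - A) \<union> (A - X)) \<longleftrightarrow>
      e \<in> (cut_edges G X - cut_edges G A) \<union> (cut_edges G A - cut_edges G X)" if "e \<in> edges G" for e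
  proof -
    obtain a b where ab: "ends G e = Upair a b" by (metis uprod_exhaust)
    show ?thesis by (auto simp: mem_cut_edges[OF that ab])
  qed
  have sub: "cut_edges G B \<subseteq> edges G" for B unfolding cut_edges_def by blast
  show ?thesis
  proof (rule set_eqI)
    fix e show "e \<in> cut_edges G ((X - A) \<union> (A - X)) \<longleftrightarrow>
      e \<in> (cut_edges G X - cut_edges G A) \<union> (cut_edges G A - cut_edges G X)"
      by (cases "e \<in> edges G") (rule *, assumption, use sub in fast)
  qed
qed

text \<open>Moving the vertices of \<open>A\<close> to the other side replaces the maximum cut by
  its symmetric difference with the cut of \<open>A\<close>. Maximality means that at least as many
  edges are lost as gained.\<close>

lemma max_cut_half:
  assumes max: "\<And>Y. Y \<subseteq> verts G \<Longrightarrow> card (cut_edges G Y) \<le> card (cut_edges G X)"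
    and "X \<subseteq> verts G" "A \<subseteq> verts G"
  shows "card (cut_edges G A) \<le> 2 * card (cut_edges G X \<inter> cut_edges G A)"
proof -
  let ?X = "cut_edges G X" and ?A = "cut_edges G A"
  have fin: "finite ?X" "finite ?A" using finite_edges unfolding cut_edges_def by auto
  have "card (?X - ?A) + card (?A - ?X) = card (cut_edges G ((X - A) \<union> (A - X)))"
    unfolding cut_edges_symdiff by (rule card_Un_disjoint[symmetric]) (use fin in auto)
  also have "\<dots> \<le> card ?X" by (rule max) (use assms(2,3) in blast)
  also have "card ?X = card (?X - ?A) + card (?X \<inter> ?A)"
    using card_Int_Diff[OF fin(1), of ?A] by simp
  finally have "card (?A - ?X) \<le> card (?X \<inter> ?A)" by simp
  then show ?thesis using card_Int_Diff[OF fin(2), of ?X] by (simp add: Int_commute)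
qed

lemma bipartite_index_le_cut:
  assumes "X \<subseteq> verts G"
  shows "bipartite_index G \<le> card (edges G - cut_edges G X)"
  unfolding bipartite_index_def
proof (rule Least_le, intro exI conjI)
  let ?H = "G\<lparr>edges := cut_edges G X\<rparr>"
  show "spanning_subgraph ?H G" unfolding spanning_subgraph_def cut_edges_def by auto
  show "bipartite ?H" unfolding bipartite_def
  proof (intro exI conjI ballI)
    show "X \<union> (verts G - X) = verts ?H" using assms by auto
    fix e assume "e \<in> edges ?H"
    then obtain u v where uv: "e \<in> edges G" "ends G e = Upair u v" "u \<in> X" "v \<notin> X"
      unfolding cut_edges_def by auto
    moreover from this have "v \<in> verts G" using ends_in_verts[of e] by auto
    ultimately show "\<exists>x\<in>X. \<exists>y\<in>verts G - X. ends ?H e = Upair x y" by auto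
  qed auto
qed auto

lemma degree_as_sum:
  assumes "F \<subseteq> edges G" "\<And>e. e \<in> edges G \<Longrightarrow> ends G e = Upair (p e) (q e)"
  shows "int (degree (G\<lparr>edges := F\<rparr>) v) = (\<Sum>e\<in>F. inc p q e v)"
proof -
  have finF: "finite F" using assms(1) finite_edges finite_subset by blast
  have "(\<Sum>e\<in>F. inc p q e v) = (\<Sum>e\<in>F. of_bool (v \<in> set_uprod (ends G e)) + of_bool (ends G e = Upair v v))"
    using assms by (intro sum.cong refl) (auto simp: inc_def subset_iff)
  also have "\<dots> = int (card {e \<in> F. v \<in> set_uprod (ends G e)}) + int (card {e \<in> F. ends G e = Upair v v})"
    using finF by (simp add: sum.distrib of_bool_def sum.If_cases Int_def)
  finally show ?thesis unfolding degree_def by simp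
qed

end

theorem corollary1p4:
  fixes G :: "('v, 'e) mgraph" and k :: nat and f :: "'v \<Rightarrow> nat"
  assumes "multigraph G"
    and "k > 0"
    and "\<And>v. v \<in> verts G \<Longrightarrow> f v > 0"
    and "\<And>v. v \<in> verts G \<Longrightarrow>
           real (f v) \<le> real (degree G v) / 2 \<and> real (degree G v) / 2 < real (f v) + real k"
    and "int (bipartite_index G) \<ge> int k - 1"
    and "even ((int k - 1) * (\<Sum>v\<in>verts G. int (f v)))"
    and "edge_connected (6 * int k - 7) G"
  shows "\<exists>H. spanning_subgraph H G \<and> (\<forall>v \<in> verts G. degree H v \<in> {f v, f v + k})"
proof -
  interpret multigraph G by (rule assms(1))
  obtain X where X: "X \<subseteq> verts G" "\<And>Y. Y \<subseteq> verts G \<Longrightarrow> card (cut_edges G Y) \<le> card (cut_edges G X)"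
    by (rule exists_maximiser[OF finite_verts, of "\<lambda>Y. card (cut_edges G Y)"]) blast
  \<comment> \<open>The ends are named so that \<open>p e\<close> is the end in \<open>X\<close> of
    every crossing edge; this fixes which direction the sign \<open>1\<close> stands for.\<close>
  have "\<exists>a b. ends G e = Upair a b \<and> (b \<in> X \<longrightarrow> a \<in> X)" for e
  proof -
    obtain a b where "ends G e = Upair a b" by (metis uprod_exhaust)
    moreover have "Upair a b = Upair b a" by simp
    ultimately show ?thesis by metis
  qed
  then obtain p q where pq: "\<And>e. ends G e = Upair (p e) (q e)" "\<And>e. q e \<in> X \<Longrightarrow> p e \<in> X" by metis
  interpret end_pairs "verts G" "edges G" p q
  proof
    show "p e \<in> verts G \<and> q e \<in> verts G" if "e \<in> edges G" for e
      using ends_in_verts[OF that] unfolding pq(1) by auto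
  qed (rule finite_verts finite_edges)+
  have cross: "cut_edges G A = {e \<in> edges G. (p e \<in> A) \<noteq> (q e \<in> A)}" for A
    using mem_cut_edges[OF _ pq(1)] unfolding cut_edges_def by blast
  have C: "{e \<in> edges G. p e \<in> X \<and> q e \<notin> X} = cut_edges G X"
    unfolding cross using pq(2) by blast
  define d where "d v = (\<Sum>e\<in>edges G. inc p q e v)" for v
  have deg: "int (degree G v) = d v" for v
    using degree_as_sum[of "edges G" p q v] pq(1) unfolding d_def by simp
  have f: "2 * int (f v) \<le> d v" "d v < 2 * int (f v) + 2 * int k" if "v \<in> verts G" for v
    using assms(4)[OF that] deg[of v] by linarith+
  obtain \<epsilon> where \<epsilon>: "\<forall>e. sign (\<epsilon> e)"
    "\<And>v. v \<in> verts G \<Longrightarrow> 2 * int k dvd (\<Sum>e\<in>edges G. \<epsilon> e * inc p q e v) - (2 * int (f v) - d v)"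
    "\<And>v. v \<in> verts G \<Longrightarrow> - 2 * int k < (\<Sum>e\<in>edges G. \<epsilon> e * inc p q e v)"
    "\<And>v. v \<in> verts G \<Longrightarrow> (\<Sum>e\<in>edges G. \<epsilon> e * inc p q e v) \<le> 2 * int k"
  proof (cases "k = 1")
    case True
    obtain \<epsilon> where \<epsilon>: "\<forall>e. sign (\<epsilon> e)" "\<forall>v\<in>verts G. - 2 < (\<Sum>e\<in>edges G. \<epsilon> e * inc p q e v) \<and>
        (\<Sum>e\<in>edges G. \<epsilon> e * inc p q e v) \<le> 2"
      using signing_modulus_one by blast
    have "even ((\<Sum>e\<in>edges G. \<epsilon> e * inc p q e v) - (2 * int (f v) - d v))" for v
    proof -
      have "(\<Sum>e\<in>edges G. \<epsilon> e * inc p q e v) + d v = (\<Sum>e\<in>edges G. (\<epsilon> e + 1) * inc p q e v)"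
        unfolding d_def by (simp add: sum.distrib distrib_right)
      also have "even \<dots>"
      proof (intro dvd_sum dvd_mult2)
        fix e show "even (\<epsilon> e + 1)" using \<epsilon>(1)[rule_format, of e] by auto
      qed
      finally show ?thesis by presburger
    qed
    then show ?thesis using that[of \<epsilon>] \<epsilon> True by simp
  next
    case False
    have "\<exists>\<epsilon>. (\<forall>e. sign (\<epsilon> e)) \<and> (\<forall>v\<in>verts G.
        2 * int k dvd (\<Sum>e\<in>edges G. \<epsilon> e * inc p q e v) - (2 * int (f v) - d v) \<and>
        - 2 * int k < (\<Sum>e\<in>edges G. \<epsilon> e * inc p q e v) \<and> (\<Sum>e\<in>edges G. \<epsilon> e * inc p q e v) \<le> 2 * int k)"
      unfolding d_def
    proof (rule signing[of "int k" "\<lambda>v. int (f v)" X], unfold C)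
      show "2 \<le> int k" using False assms(2) by linarith
      show "even (\<Sum>v\<in>verts G. int (f v))" if "even (int k)" using assms(6) that by auto
      show "p e \<in> X \<longleftrightarrow> q e \<in> X" if "e \<in> edges G - cut_edges G X" for e
        using that unfolding cross by blast
      show "int k - 1 \<le> int (card (edges G - cut_edges G X))"
        using assms(5) bipartite_index_le_cut[OF X(1)] by linarith
      fix A assume A: "A \<noteq> {}" "A \<subset> verts G"
      have "{e \<in> cut_edges G X. (p e \<in> A) \<noteq> (q e \<in> A)} = cut_edges G X \<inter> cut_edges G A"
        unfolding cross by blast
      moreover have "card (cut_edges G A) \<le> 2 * card (cut_edges G X \<inter> cut_edges G A)"
        by (rule max_cut_half[OF X(2,1)]) (use A in auto)
      moreover have "6 * int k - 7 \<le> int (card (cut_edges G A))"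
        using assms(7) A unfolding edge_connected_def by blast
      \<comment> \<open>Half of \<open>6 * k - 7\<close>, rounded up to an integer.\<close>
      ultimately show "3 * int k - 3 \<le> int (card {e \<in> cut_edges G X. (p e \<in> A) \<noteq> (q e \<in> A)})"
        by simp
    qed
    then show ?thesis using that by blast
  qed
  define F where "F = {e \<in> edges G. \<epsilon> e = 1}"
  define H where "H = G\<lparr>edges := F\<rparr>"
  have FE: "F \<subseteq> edges G" unfolding F_def by blast
  have "degree H v \<in> {f v, f v + k}" if v: "v \<in> verts G" for v
  proof -
    define h where "h = int (degree H v)"
    have h: "h = (\<Sum>e\<in>F. inc p q e v)" unfolding h_def H_def using degree_as_sum[OF FE pq(1)] by simp
    have "(\<Sum>e\<in>edges G. \<epsilon> e * inc p q e v) = (\<Sum>e\<in>edges G - F. \<epsilon> e * inc p q e v) + (\<Sum>e\<in>F. \<epsilon> e * inc p q e v)"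
      by (rule sum.subset_diff[OF FE finite_edges])
    also have "(\<Sum>e\<in>F. \<epsilon> e * inc p q e v) = h" unfolding h by (intro sum.cong refl) (simp add: F_def)
    also have "(\<Sum>e\<in>edges G - F. \<epsilon> e * inc p q e v) = (\<Sum>e\<in>edges G - F. - inc p q e v)"
    proof (rule sum.cong[OF refl])
      fix e assume "e \<in> edges G - F"
      then have "\<epsilon> e = -1" using \<epsilon>(1)[rule_format, of e] unfolding F_def by auto
      then show "\<epsilon> e * inc p q e v = - inc p q e v" by simp
    qed
    also have "\<dots> = h - d v" unfolding h d_def sum.subset_diff[OF FE finite_edges] by (simp add: sum_negf)
    finally have net: "(\<Sum>e\<in>edges G. \<epsilon> e * inc p q e v) = 2 * h - d v" by simp
    have "2 * int k dvd 2 * (h - int (f v))" using \<epsilon>(2)[OF v] unfolding net by simp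
    then have "int k dvd h - int (f v)" unfolding dvd_mult_cancel_left by simp
    then obtain c where c: "h - int (f v) = int k * c" by blast
    \<comment> \<open>The lower end of the window meets \<open>2 * f v \<le> d v\<close>, the upper
      end meets \<open>d v < 2 * f v + 2 * k\<close>. Strictly between \<open>- k\<close> and
      \<open>2 * k\<close> the only multiples of \<open>k\<close> are \<open>0\<close> and
      \<open>k\<close>.\<close>
    have "- int k < h - int (f v)" "h - int (f v) < 2 * int k"
      using \<epsilon>(3,4)[OF v] f[OF v] unfolding net by linarith+
    then have "int k * (- 1) < int k * c" "int k * c < int k * 2" unfolding c by linarith+
    then have "-1 < c" "c < 2" using assms(2) by (simp_all only: mult_less_cancel_left_pos of_nat_0_less_iff)
    then have "c = 0 \<or> c = 1" by linarith
    then show ?thesis using c unfolding h_def by auto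
  qed
  moreover have "spanning_subgraph H G" unfolding spanning_subgraph_def H_def using FE by auto
  ultimately show ?thesis by blast
qed

end
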